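(* Let $(\hat R,\hat F)$ be a compatible pair of R-matrices on $V\otimes V$, with $\hat R$ an even Hecke R-matrix of height $n$ (with parameter $q$) and $\hat F$ a closed R-matrix. Let $M$ be the matrix of generators of the algebra ${\cal M}(\hat R,\hat F)$. Then for every integer $k\ge 1$ the following matrix identities hold: $$(-1)^{k-1}k_q\, M^{\wedge k}=\sum_{i=0}^{k-1}(-q)^i\, M^{\overline{k-i}}\,\sigma_i(M),$$ $$k_q\, M^{{\cal S}k}=\sum_{i=0}^{k-1}q^{-i}\, M^{\overline{k-i}}\,\tau_i(M).$$
   Context: **R-matrices.** $V$ is a finite-dimensional complex vector space. For $X\in\mathrm{End}(V\otimes V)$, $X_k$ denotes $X$ acting in the $k$-th and $(k+1)$-st factors of a tensor power of $V$ (identity elsewhere); for $X\in \mathrm{End}(V)$, $X_k$ denotes $X$ acting in the $k$-th factor; the same notation is used for matrices with entries in a (noncommutative) algebra. $I$ denotes the identity. An R-matrix is an $X\in\mathrm{Aut}(V\otimes V)$ with $X_1X_2X_1=X_2X_1X_2$. R-matrices $\hat R,\hat F$ are compatible if $\hat R_1\hat F_2\hat F_1=\hat F_2\hat F_1\hat R_2$ and $\hat F_1\hat F_2\hat R_1=\hat R_2\hat F_1\hat F_2$. **Even Hecke R-matrix.** $\hat R$ is Hecke if $\hat R^2=I+(q-q^{-1})\hat R$ with a number $q\ne 0$. Put $k_q=(q^k-q^{-k})/(q-q^{-1})=\sum_{j=0}^{k-1}q^{k-1-2j}$ (the last expression being used if $q=\pm1$); it is assumed that $k_q\neq 0$ for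 all $k\ge1$. The $q$-antisymmetrizers and $q$-symmetrizers $A^{(k)},S^{(k)}\in\mathrm{End}(V^{\otimes k})$ are defined by $A^{(1)}=S^{(1)}=I$, $$A^{(k)}=\tfrac1{k_q}A^{(k-1)}\bigl(q^{k-1}-(k-1)_q\hat R_{k-1}\bigr)A^{(k-1)},\quad S^{(k)}=\tfrac1{k_q}S^{(k-1)}\bigl(q^{1-k}+(k-1)_q\hat R_{k-1}\bigr)S^{(k-1)}.$$ $\hat R$ is even of height $n$ if $A^{(n+1)}=0$ and $\mathrm{rank}\,A^{(n)}=1$. **Closed R-matrix and quantum trace.** Write $\hat F=\hat F^{ab}_{cd}$ (row indices $a,b$, column indices $c,d$). $\hat F$ is closed if it is invertible as an operator on $V\otimes V$ and there is a matrix $\Psi^{ab}_{cd}$ with $\Psi^{af}_{cg}\hat F^{gb}_{fd}=\delta^a_d\delta^b_c$ (summation over repeated indices). Put $D^a_b=\Psi^{ac}_{bc}$. For a matrix $X$ with entries in an arbitrary algebra, $\mathrm{Tr}_{\hat F}X:=\mathrm{Tr}(DX)$; $\mathrm{Tr}_{\hat F\,(i_1,\dots,i_k)}X:=\mathrm{Tr}_{(i_1,\dots,i_k)}(D_{i_1}\cdots D_{i_k}X)$ is the quantum trace in the factors numbered $i_1,\dots,i_k$. **The algebra ${\cal M}(\hat R,\hat F)$.** For a $\dim V\times\dim V$ matrix $M$ put $M_{\overline 1}=M_1$, $M_{\overline{k+1}}=\hat F_kM_{\overline k}\hat F_k^{-1}$. Put $\hat R^{\hat F}=\hat F\hat R\hat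 F^{-1}$ and $\hat R^{\hat F\hat F}=\hat F\hat R^{\hat F}\hat F^{-1}$. ${\cal M}(\hat R,\hat F)$ is the unital associative algebra generated by the entries of a matrix $M$ subject to the relations $\hat R_1M_{\overline1}M_{\overline2}=M_{\overline1}M_{\overline2}\hat R^{\hat F\hat F}_1$. **Symmetric functions and matrix powers.** With $\hat R_{1\to k-1}=\hat R_1\hat R_2\cdots\hat R_{k-1}$ (identity for $k=1$), for $k\ge 1$: $$\sigma_k(M)=\mathrm{Tr}_{\hat F\,(1,\dots,k)}(A^{(k)}M_{\overline1}\cdots M_{\overline k}),\qquad \tau_k(M)=\mathrm{Tr}_{\hat F\,(1,\dots,k)}(S^{(k)}M_{\overline1}\cdots M_{\overline k}),$$ and $\sigma_0(M)=\tau_0(M)=1$. The following are matrices acting in the first factor $V_1$ with entries in ${\cal M}(\hat R,\hat F)$ (for $k=1$ all equal $M$): $$M^{\overline k}=\mathrm{Tr}_{\hat F\,(2,\dots,k)}(\hat R_{1\to k-1}M_{\overline1}\cdots M_{\overline k}),$$ $$M^{\wedge k}=\mathrm{Tr}_{\hat F\,(2,\dots,k)}(A^{(k)}M_{\overline1}\cdots M_{\overline k}),\qquad M^{{\cal S}k}=\mathrm{Tr}_{\hat F\,(2,\dots,k)}(S^{(k)}M_{\overline1}\cdots M_{\overline k}).$$ In a product such as $M^{\overline{k-i}}\sigma_i(M)$ each matrix entry is multiplied on the right by the algebra element. *)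

theory Defs
  imports
    "HOL-Analysis.Analysis"
    "HOL-Library.Function_Algebras"
    "HOL-Library.Poly_Mapping"
    "HOL-Algebra.QuotRing"
begin

section \<open>Unital associative complex algebras\<close>

class complex_algebra_1 = ring_1 +
  fixes scaleC :: "complex \<Rightarrow> 'a \<Rightarrow> 'a"  (infixr "*\<^sub>C" 75)
  assumes scaleC_add_right: "c *\<^sub>C (x + y) = c *\<^sub>C x + c *\<^sub>C y"
    and scaleC_add_left: "(c + d) *\<^sub>C x = c *\<^sub>C x + d *\<^sub>C x"
    and scaleC_scaleC: "c *\<^sub>C d *\<^sub>C x = (c * d) *\<^sub>C x"
    and scaleC_one: "1 *\<^sub>C x = x"
    and mult_scaleC_left: "(c *\<^sub>C x) * y = c *\<^sub>C (x * y)"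
    and mult_scaleC_right: "x * (c *\<^sub>C y) = c *\<^sub>C (x * y)"

section \<open>Matrices acting in tensor powers of V\<close>

text \<open>
  \<open>V\<close> is the complex vector space with basis indexed by a finite type \<open>'n\<close>.
  A matrix acting in \<open>V\<otimes>V\<close> is an element of \<open>complex^('n\<times>'n)^('n\<times>'n)\<close>; the entry
  \<open>X$(a,b)$(c,d)\<close> has row indices \<open>a, b\<close> and column indices \<open>c, d\<close>.

  The basis of the \<open>m\<close>-th tensor power of \<open>V\<close> is indexed by the lists over \<open>'n\<close> of length \<open>m\<close>.
  An element of type \<open>('n, 'a) tens_mat\<close> gives matrices (with entries in \<open>'a\<close>) in all tensor powers
  simultaneously: the one in the \<open>m\<close>-th power is its restriction to the row and column indices of
  length \<open>m\<close>.  In this way \<open>X\<^sub>k\<close> is a single object, whatever number of factors it is considered in,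
  and a matrix in the first \<open>k\<close> factors is tacitly tensored with the identity in the later ones.
\<close>

type_synonym ('n, 'a) tens_mat = "'n list \<Rightarrow> 'n list \<Rightarrow> 'a"

definition tens_id :: "('n, 'a::ring_1) tens_mat" where
  "tens_id i j = (if i = j then 1 else 0)"

definition tens_mult :: "('n::finite, 'a::ring_1) tens_mat \<Rightarrow> ('n, 'a) tens_mat \<Rightarrow> ('n, 'a) tens_mat"
  (infixl "\<star>" 70) where
  "(X \<star> Y) i j = (\<Sum>l | length l = length i. X i l * Y l j)"

text \<open>Equality of the matrices acting in the \<open>m\<close>-th tensor power.\<close>

definition eq_in_power :: "nat \<Rightarrow> ('n, 'a) tens_mat \<Rightarrow> ('n, 'a) tens_mat \<Rightarrow> bool" where
  "eq_in_power m X Y \<longleftrightarrow> (\<forall>i j. length i = m \<and> length j = m \<longrightarrow> X i j = Y i j)"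

text \<open>
  \<open>at1 k X\<close> is \<open>X\<^sub>k\<close> for a matrix \<open>X\<close> in \<open>V\<close>, and \<open>at2 k X\<close> is \<open>X\<^sub>k\<close> for a matrix \<open>X\<close> in
  \<open>V\<otimes>V\<close>; factors are numbered from 1, list positions from 0.  In tensor powers with too few
  factors, where \<open>X\<^sub>k\<close> has no meaning, the value is 0.
\<close>

definition at1 :: "nat \<Rightarrow> 'a::ring_1^'n^'n \<Rightarrow> ('n::finite, 'a) tens_mat" where
  "at1 k X i j =
     (if length i = length j \<and> 1 \<le> k \<and> k \<le> length i
         \<and> (\<forall>r<length i. r \<noteq> k - 1 \<longrightarrow> i ! r = j ! r)
      then X $ (i ! (k - 1)) $ (j ! (k - 1)) else 0)"

definition at2 :: "nat \<Rightarrow> 'a::ring_1^('n \<times> 'n)^('n \<times> 'n) \<Rightarrow> ('n::finite, 'a) tens_mat" where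
  "at2 k X i j =
     (if length i = length j \<and> 1 \<le> k \<and> k + 1 \<le> length i
         \<and> (\<forall>r<length i. r \<noteq> k - 1 \<and> r \<noteq> k \<longrightarrow> i ! r = j ! r)
      then X $ (i ! (k - 1), i ! k) $ (j ! (k - 1), j ! k) else 0)"

text \<open>A numerical matrix regarded as a matrix with entries in a complex algebra.\<close>

definition alg_mat :: "('n, complex) tens_mat \<Rightarrow> ('n, 'a::complex_algebra_1) tens_mat" where
  "alg_mat X = (\<lambda>i j. X i j *\<^sub>C 1)"

text \<open>Rank (dimension of the column space) of a matrix acting in the \<open>m\<close>-th tensor power.\<close>

definition rank_in_power :: "nat \<Rightarrow> ('n, complex) tens_mat \<Rightarrow> nat" where
  "rank_in_power m X =
     vector_space.dim (\<lambda>(c::complex) (v :: 'n list \<Rightarrow> complex) i. c * v i)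
       {(\<lambda>i. if length i = m then X i j else 0) | j. length j = m}"

section \<open>R-matrices\<close>

type_synonym 'n mat2 = "complex^('n \<times> 'n)^('n \<times> 'n)"

definition R_matrix :: "'n::finite mat2 \<Rightarrow> bool" where
  "R_matrix X \<longleftrightarrow> invertible X \<and>
     eq_in_power 3 (at2 1 X \<star> at2 2 X \<star> at2 1 X) (at2 2 X \<star> at2 1 X \<star> at2 2 X)"

definition compatible_pair :: "'n::finite mat2 \<Rightarrow> 'n mat2 \<Rightarrow> bool" where
  "compatible_pair R F \<longleftrightarrow> R_matrix R \<and> R_matrix F \<and>
     eq_in_power 3 (at2 1 R \<star> at2 2 F \<star> at2 1 F) (at2 2 F \<star> at2 1 F \<star> at2 2 R) \<and>
     eq_in_power 3 (at2 1 F \<star> at2 2 F \<star> at2 1 R) (at2 2 R \<star> at2 1 F \<star> at2 2 F)"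

text \<open>
  \<open>qnum q k\<close> equals \<open>(q^k - q^(-k)) / (q - q^(-1))\<close> when \<open>q^2 \<noteq> 1\<close>.
\<close>

definition qnum :: "complex \<Rightarrow> nat \<Rightarrow> complex" where
  "qnum q k = (\<Sum>j<k. q powi (int k - 1 - 2 * int j))"

definition Hecke :: "complex \<Rightarrow> 'n::finite mat2 \<Rightarrow> bool" where
  "Hecke q R \<longleftrightarrow> q \<noteq> 0 \<and> R ** R = mat 1 + mat (q - inverse q) ** R"

text \<open>
  The \<open>q\<close>-antisymmetrizers and \<open>q\<close>-symmetrizers; the index 0 is given the value \<open>I\<close> for totality.
\<close>

fun antisym :: "complex \<Rightarrow> 'n::finite mat2 \<Rightarrow> nat \<Rightarrow> ('n, complex) tens_mat" where
  "antisym q R 0 = tens_id"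
| "antisym q R (Suc 0) = tens_id"
| "antisym q R (Suc (Suc k)) = (\<lambda>i j. 1 / qnum q (k + 2) *
     (antisym q R (k + 1)
      \<star> (\<lambda>i' j'. q ^ (k + 1) * tens_id i' j' - qnum q (k + 1) * at2 (k + 1) R i' j')
      \<star> antisym q R (k + 1)) i j)"

fun symm :: "complex \<Rightarrow> 'n::finite mat2 \<Rightarrow> nat \<Rightarrow> ('n, complex) tens_mat" where
  "symm q R 0 = tens_id"
| "symm q R (Suc 0) = tens_id"
| "symm q R (Suc (Suc k)) = (\<lambda>i j. 1 / qnum q (k + 2) *
     (symm q R (k + 1)
      \<star> (\<lambda>i' j'. inverse q ^ (k + 1) * tens_id i' j' + qnum q (k + 1) * at2 (k + 1) R i' j')
      \<star> symm q R (k + 1)) i j)"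

definition even_height :: "complex \<Rightarrow> 'n::finite mat2 \<Rightarrow> nat \<Rightarrow> bool" where
  "even_height q R n \<longleftrightarrow>
     eq_in_power (n + 1) (antisym q R (n + 1)) (\<lambda>i j. 0) \<and>
     rank_in_power n (antisym q R n) = 1"

section \<open>Closed R-matrices and the quantum trace\<close>

definition skew_inverse :: "'n::finite mat2 \<Rightarrow> 'n mat2 \<Rightarrow> bool" where
  "skew_inverse F \<Psi> \<longleftrightarrow>
     (\<forall>a b c d. (\<Sum>f\<in>UNIV. \<Sum>g\<in>UNIV. \<Psi> $ (a,f) $ (c,g) * F $ (g,b) $ (f,d))
        = (if a = d \<and> b = c then 1 else 0))"

definition closed_R :: "'n::finite mat2 \<Rightarrow> bool" where
  "closed_R F \<longleftrightarrow> invertible F \<and> (\<exists>\<Psi>. skew_inverse F \<Psi>)"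

text \<open>
  The choice of \<open>\<Psi>\<close> is immaterial: up to a permutation of the indices, \<open>\<Psi>\<close> is a one-sided inverse
  of a square matrix, hence unique.
\<close>

definition qtr_D :: "'n::finite mat2 \<Rightarrow> complex^'n^'n" where
  "qtr_D F = (let \<Psi> = (SOME \<Psi>. skew_inverse F \<Psi>) in \<chi> a b. \<Sum>c\<in>UNIV. \<Psi> $ (a,c) $ (b,c))"

text \<open>
  \<open>D_prod F j k\<close> is the product of the \<open>D\<^sub>p\<close> over \<open>j < p \<le> k\<close>, and \<open>qtr F j k X\<close> is the
  quantum trace of \<open>X\<close> in the factors \<open>j + 1, \<dots>, k\<close> of the \<open>k\<close>-th tensor power: a matrix acting in
  the first \<open>j\<close> factors.  For \<open>j = 0\<close> it has a single entry, at the row and column \<open>[]\<close>.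
\<close>

definition D_prod :: "'n::finite mat2 \<Rightarrow> nat \<Rightarrow> nat \<Rightarrow> ('n, complex) tens_mat" where
  "D_prod F j k = foldr (\<lambda>p Y. at1 p (qtr_D F) \<star> Y) [j + 1..<k + 1] tens_id"

definition qtr ::
    "'n::finite mat2 \<Rightarrow> nat \<Rightarrow> nat \<Rightarrow> ('n, 'a::complex_algebra_1) tens_mat \<Rightarrow> ('n, 'a) tens_mat" where
  "qtr F j k X = (\<lambda>i i'. \<Sum>l | length l = k - j. (alg_mat (D_prod F j k) \<star> X) (i @ l) (i' @ l))"

section \<open>Symmetric functions and powers of a matrix\<close>

text \<open>\<open>Mbar F M k\<close> is \<open>M\<close> with the overlined index \<open>k \<ge> 1\<close>; the index 0 is unused.\<close>

fun Mbar :: "'n::finite mat2 \<Rightarrow> 'a::complex_algebra_1^'n^'n \<Rightarrow> nat \<Rightarrow> ('n, 'a) tens_mat" where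
  "Mbar F M 0 = tens_id"
| "Mbar F M (Suc 0) = at1 1 M"
| "Mbar F M (Suc (Suc k)) =
     alg_mat (at2 (k + 1) F) \<star> Mbar F M (k + 1) \<star> alg_mat (at2 (k + 1) (matrix_inv F))"

primrec Mprod :: "'n::finite mat2 \<Rightarrow> 'a::complex_algebra_1^'n^'n \<Rightarrow> nat \<Rightarrow> ('n, 'a) tens_mat" where
  "Mprod F M 0 = tens_id"
| "Mprod F M (Suc k) = Mprod F M k \<star> Mbar F M (Suc k)"

text \<open>\<open>Rchain R m\<close> is the product \<open>R\<^sub>1 R\<^sub>2 \<dots> R\<^sub>m\<close>.\<close>

primrec Rchain :: "'n::finite mat2 \<Rightarrow> nat \<Rightarrow> ('n, complex) tens_mat" where
  "Rchain R 0 = tens_id"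
| "Rchain R (Suc m) = Rchain R m \<star> at2 (Suc m) R"

definition sigma_fun ::
    "complex \<Rightarrow> 'n::finite mat2 \<Rightarrow> 'n mat2 \<Rightarrow> 'a::complex_algebra_1^'n^'n \<Rightarrow> nat \<Rightarrow> 'a" where
  "sigma_fun q R F M k =
     (if k = 0 then 1 else qtr F 0 k (alg_mat (antisym q R k) \<star> Mprod F M k) [] [])"

definition tau_fun ::
    "complex \<Rightarrow> 'n::finite mat2 \<Rightarrow> 'n mat2 \<Rightarrow> 'a::complex_algebra_1^'n^'n \<Rightarrow> nat \<Rightarrow> 'a" where
  "tau_fun q R F M k =
     (if k = 0 then 1 else qtr F 0 k (alg_mat (symm q R k) \<star> Mprod F M k) [] [])"

definition mat_power ::
    "'n::finite mat2 \<Rightarrow> 'n mat2 \<Rightarrow> 'a::complex_algebra_1^'n^'n \<Rightarrow> nat \<Rightarrow> 'a^'n^'n" where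
  "mat_power R F M k =
     (\<chi> a b. qtr F 1 k (alg_mat (Rchain R (k - 1)) \<star> Mprod F M k) [a] [b])"

definition wedge_power ::
    "complex \<Rightarrow> 'n::finite mat2 \<Rightarrow> 'n mat2 \<Rightarrow> 'a::complex_algebra_1^'n^'n \<Rightarrow> nat \<Rightarrow> 'a^'n^'n" where
  "wedge_power q R F M k =
     (\<chi> a b. qtr F 1 k (alg_mat (antisym q R k) \<star> Mprod F M k) [a] [b])"

definition sym_power ::
    "complex \<Rightarrow> 'n::finite mat2 \<Rightarrow> 'n mat2 \<Rightarrow> 'a::complex_algebra_1^'n^'n \<Rightarrow> nat \<Rightarrow> 'a^'n^'n" where
  "sym_power q R F M k =
     (\<chi> a b. qtr F 1 k (alg_mat (symm q R k) \<star> Mprod F M k) [a] [b])"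

section \<open>Free algebras\<close>

datatype 'g word = Word "'g list"

instantiation word :: (type) monoid_add
begin

definition "0 = Word []"

fun plus_word :: "'a word \<Rightarrow> 'a word \<Rightarrow> 'a word" where
  "Word u + Word v = Word (u @ v)"

instance
proof
  fix a b c :: "'a word"
  show "a + b + c = a + (b + c)" by (cases a; cases b; cases c) simp
  show "0 + a = a" "a + 0 = a" by (cases a; simp add: zero_word_def)+
qed

end

text \<open>
  Finitely supported functions on words with the convolution product: the free unital associative
  complex algebra on the generators \<open>'g\<close>.
\<close>

type_synonym 'g free_alg = "'g word \<Rightarrow>\<^sub>0 complex"

instantiation complex :: complex_algebra_1
begin

definition "c *\<^sub>C (z::complex) = c * z"

instance
  by standard (simp_all add: scaleC_complex_def algebra_simps)

end

lemma single_0_central: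
  fixes p :: "'g::monoid_add \<Rightarrow>\<^sub>0 'a::complex_algebra_1"
  shows "Poly_Mapping.single 0 (c *\<^sub>C 1) * p = p * Poly_Mapping.single 0 (c *\<^sub>C 1)"
proof (induction p rule: update_induct)
  case const
  show ?case by simp
next
  case (update f a b)
  have "Poly_Mapping.update a b f = f + Poly_Mapping.single a b"
    using update(1)
    by (intro poly_mapping_eqI)
      (auto simp: lookup_update lookup_add lookup_single when_def in_keys_iff)
  moreover have "(c *\<^sub>C 1) * b = b * (c *\<^sub>C 1)"
    by (simp add: mult_scaleC_left mult_scaleC_right)
  ultimately show ?case
    using update(3) by (simp add: distrib_left distrib_right mult_single)
qed

instantiation poly_mapping :: (monoid_add, complex_algebra_1) complex_algebra_1
begin

definition "c *\<^sub>C (p :: 'a \<Rightarrow>\<^sub>0 'b) = Poly_Mapping.single 0 (c *\<^sub>C 1) * p"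

instance
proof
  fix c d :: complex and x y :: "'a \<Rightarrow>\<^sub>0 'b"
  show "c *\<^sub>C (x + y) = c *\<^sub>C x + c *\<^sub>C y"
    by (simp add: scaleC_poly_mapping_def distrib_left)
  show "(c + d) *\<^sub>C x = c *\<^sub>C x + d *\<^sub>C x"
    by (simp add: scaleC_poly_mapping_def scaleC_add_left single_add distrib_right)
  show "c *\<^sub>C d *\<^sub>C x = (c * d) *\<^sub>C x"
    by (simp add: scaleC_poly_mapping_def mult_single mult_scaleC_left scaleC_scaleC
        flip: mult.assoc)
  show "1 *\<^sub>C x = x"
    by (simp add: scaleC_poly_mapping_def scaleC_one)
  show "(c *\<^sub>C x) * y = c *\<^sub>C (x * y)"
    by (simp add: scaleC_poly_mapping_def mult.assoc)
  show "x * (c *\<^sub>C y) = c *\<^sub>C (x * y)"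
    by (metis scaleC_poly_mapping_def single_0_central mult.assoc)
qed

end

definition free_ring :: "'g free_alg ring" where
  "free_ring = \<lparr>carrier = UNIV, monoid.mult = (*), one = 1, ring.zero = 0, add = (+)\<rparr>"

lemma ring_free_ring: "ring (free_ring :: 'g free_alg ring)"
  unfolding free_ring_def
  by (rule ringI)
    (auto intro!: abelian_groupI monoidI exI[of _ "- x" for x]
      simp: algebra_simps add_eq_0_iff2)

section \<open>The algebra M(R,F)\<close>

text \<open>
  The algebra is the quotient of the free algebra on the symbols \<open>(a,b)\<close>, standing for the matrix
  entries of \<open>M\<close>, by the two-sided ideal generated by the entries of the matrix relation.  (The
  scalars lie in the free algebra, so ring ideals are closed under multiplication by scalars.)
\<close>

definition gen_mat :: "('n \<times> 'n) free_alg^'n^'n" where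
  "gen_mat = (\<chi> a b. Poly_Mapping.single (Word [(a,b)]) 1)"

definition twist :: "'n::finite mat2 \<Rightarrow> 'n mat2 \<Rightarrow> 'n mat2" where
  "twist F R = F ** R ** matrix_inv F"

definition QM_relators :: "'n::finite mat2 \<Rightarrow> 'n mat2 \<Rightarrow> ('n \<times> 'n) free_alg set" where
  "QM_relators R F =
     {(alg_mat (at2 1 R) \<star> Mbar F gen_mat 1 \<star> Mbar F gen_mat 2) i j
        - (Mbar F gen_mat 1 \<star> Mbar F gen_mat 2 \<star> alg_mat (at2 1 (twist F (twist F R)))) i j
      | i j. length i = 2 \<and> length j = 2}"

definition QM_ideal :: "'n::finite mat2 \<Rightarrow> 'n mat2 \<Rightarrow> ('n \<times> 'n) free_alg set" where
  "QM_ideal R F = genideal free_ring (QM_relators R F)"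

definition QM_algebra :: "'n::finite mat2 \<Rightarrow> 'n mat2 \<Rightarrow> ('n \<times> 'n) free_alg set ring" where
  "QM_algebra R F = free_ring Quot QM_ideal R F"

definition QM_proj :: "'n::finite mat2 \<Rightarrow> 'n mat2 \<Rightarrow> ('n \<times> 'n) free_alg \<Rightarrow> ('n \<times> 'n) free_alg set" where
  "QM_proj R F x = QM_ideal R F +>\<^bsub>free_ring\<^esub> x"

text \<open>
  The projection onto the quotient is a surjective ring homomorphism.  Hence an expression in the
  generators of \<open>M(R,F)\<close> is the image under \<open>QM_proj\<close> of the same expression formed in the free
  algebra with \<open>gen_mat\<close>, and identities in \<open>M(R,F)\<close> can be stated as equalities of such images.
\<close>

lemma ideal_QM_ideal: "ideal (QM_ideal R F) free_ring"
  unfolding QM_ideal_def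
  by (rule ring.genideal_ideal[OF ring_free_ring]) (simp add: free_ring_def)

lemma ring_QM_algebra: "ring (QM_algebra R F)"
  unfolding QM_algebra_def by (rule ideal.quotient_is_ring[OF ideal_QM_ideal])

lemma QM_proj_hom: "QM_proj R F \<in> ring_hom free_ring (QM_algebra R F)"
  unfolding QM_algebra_def QM_proj_def
  by (rule ideal.rcos_ring_hom[OF ideal_QM_ideal])

lemma QM_proj_surj: "range (QM_proj R F) = carrier (QM_algebra R F)"
  by (auto simp: QM_proj_def QM_algebra_def FactRing_def A_RCOSETS_def' free_ring_def)

lemma QM_proj_eq_iff: "QM_proj R F x = QM_proj R F y \<longleftrightarrow> x - y \<in> QM_ideal R F"
proof -
  interpret ring "free_ring :: ('a \<times> 'a) free_alg ring" by (rule ring_free_ring)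
  have "\<ominus>\<^bsub>free_ring\<^esub> z = - z" for z :: "('a \<times> 'a) free_alg"
    by (rule minus_equality) (simp_all add: free_ring_def)
  then have "x \<ominus>\<^bsub>free_ring\<^esub> y = x - y"
    by (simp add: a_minus_def) (simp add: free_ring_def)
  then show ?thesis
    using quotient_eq_iff_same_a_r_cos[OF ideal_QM_ideal, of x y R F]
    by (simp add: QM_proj_def free_ring_def)
qed

end

theory Submission
  imports Defs
begin

text \<open>
  The argument takes place in a unital complex algebra containing commuting copies of the matrix
  units of \<open>V\<close>, one copy for each factor \<open>p = 0, 1, 2, \<dots>\<close> (locale \<open>matrix_units\<close>).  Operators in all
  tensor powers then live in one ring, \<open>R\<close> and \<open>F\<close> can act in any two distinct factors, and the
  partial trace over the factor \<open>p\<close> is \<open>X \<mapsto> \<Sum> u\<^sub>p\<^sup>a\<^sup>b X u\<^sub>p\<^sup>b\<^sup>a\<close>, which again acts trivially in the factor \<open>p\<close>.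
  A ring with these properties is made of row-finite matrices indexed by sequences.

  Three properties of the quantum trace \<open>T\<^sub>p(X) = tr\<^sub>p(D\<^sub>p X)\<close> are needed: \<open>T\<^sub>r(F\<^sub>p\<^sub>r) = 1\<close> (\<open>qt_F\<close>);
  \<open>T\<^sub>r(F\<^sub>p\<^sub>r X F\<^sub>p\<^sub>r\<^sup>-\<^sup>1) = T\<^sub>p(X)\<close> when \<open>X\<close> does not involve the factor \<open>r\<close> (\<open>qt_conj\<close>); and
  \<open>T\<^sub>pT\<^sub>r(X R\<^sup>F\<^sup>F) = T\<^sub>pT\<^sub>r(R X)\<close> (\<open>qt_cyc\<close>).  The last two are proved with auxiliary factors: because \<open>F\<close> is
  skew invertible, every \<open>X\<close> is a combination of partial traces of products of \<open>F\<close>'s joining the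
  auxiliary factors to the given ones, and the Yang-Baxter and compatibility relations move \<open>F\<close> or \<open>R\<close>
  through these products to the auxiliary factors.

  For the rest of this overview the factors are numbered from 1, as in the statement.  The relation of
  the algebra gives \<open>R\<^sub>j M\<^sub>1\<dots>M\<^sub>k = M\<^sub>1\<dots>M\<^sub>k R\<^sub>j\<^sup>F\<^sup>F\<close>, so by \<open>qt_cyc\<close> the functional
  \<open>\<Phi>(X) = T\<^sub>2\<dots>T\<^sub>k(X M\<^sub>1\<dots>M\<^sub>k)\<close> satisfies \<open>\<Phi>(X R\<^sub>j) = \<Phi>(R\<^sub>j X)\<close> for \<open>2 \<le> j < k\<close>.  Let \<open>A\<^sup>(\<^sup>s\<^sup>,\<^sup>i\<^sup>)\<close> be the
  antisymmetrizer in \<open>i\<close> factors starting with the factor \<open>s\<close>.  Conjugation by a product of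
  neighbouring \<open>F\<close>'s shifts everything by one factor, so \<open>qt_conj\<close> gives
  \<open>\<Phi>(R\<^sub>1\<dots>R\<^sub>s\<^sub>-\<^sub>1 A\<^sup>(\<^sup>s\<^sup>+\<^sup>1\<^sup>,\<^sup>i\<^sup>)) = M\<^sup>s \<sigma>\<^sub>i(M)\<close> for \<open>k = s + i\<close>, where \<open>M\<^sup>s\<close> is the matrix power (\<open>pw_sg\<close>).  The recursion
  \<open>[i+1] A\<^sup>(\<^sup>s\<^sup>,\<^sup>i\<^sup>+\<^sup>1\<^sup>) = A\<^sup>(\<^sup>s\<^sup>+\<^sup>1\<^sup>,\<^sup>i\<^sup>) (q\<^sup>i - [i] R\<^sub>s) A\<^sup>(\<^sup>s\<^sup>+\<^sup>1\<^sup>,\<^sup>i\<^sup>)\<close> at the first factor (\<open>antisym_of_first\<close>) then turns into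
  a two-term recursion for the elements \<open>\<Phi>(R\<^sub>1\<dots>R\<^sub>s\<^sub>-\<^sub>1 A\<^sup>(\<^sup>s\<^sup>,\<^sup>i\<^sup>+\<^sup>1\<^sup>))\<close> with \<open>k = s + i\<close> (\<open>B_Suc\<close>), which starts at
  the matrix power \<open>M\<^sup>k\<close> (\<open>i = 0\<close>) and ends at \<open>M\<^sup>\<and>\<^sup>k\<close> (\<open>s = 1\<close>).  Solving it gives the
  first identity.  The second is the first for the parameter \<open>-1/q\<close>: the Hecke relation is unchanged and the symmetrizers for \<open>q\<close> are the
  antisymmetrizers for \<open>-1/q\<close> (\<open>symm_eq_antisym\<close>).
\<close>

section \<open>Scalars\<close>

interpretation scaleC: vector_space "scaleC :: complex \<Rightarrow> 'a::complex_algebra_1 \<Rightarrow> 'a"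
  by unfold_locales (simp_all add: scaleC_add_right scaleC_add_left scaleC_scaleC scaleC_one)

section \<open>Matrix units in the factors of a tensor power\<close>

text \<open>
  A ring containing, for each factor \<open>p\<close> (numbered from 0), a copy \<open>u p a b\<close> of the matrix units of
  \<open>V\<close>, with units for different factors commuting.
\<close>

locale matrix_units =
  fixes u :: "nat \<Rightarrow> 'n::finite \<Rightarrow> 'n \<Rightarrow> 'b::complex_algebra_1"
  assumes u_mult: "u p a b * u p c d = (if b = c then u p a d else 0)"
    and u_sum: "(\<Sum>a\<in>UNIV. u p a a) = 1"
    and u_commute: "p \<noteq> r \<Longrightarrow> u p a b * u r c d = u r c d * u p a b"
begin

text \<open>
  \<open>op1 p x\<close> is the numerical matrix \<open>x\<close> acting in the factor \<open>p\<close>, and \<open>op2 p r X\<close> is \<open>X\<close> acting in the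
  factors \<open>p\<close> and \<open>r\<close>, which need not be neighbours.
\<close>

definition op1 :: "nat \<Rightarrow> complex^'n^'n \<Rightarrow> 'b" where
  "op1 p x = (\<Sum>a\<in>UNIV. \<Sum>b\<in>UNIV. x $ a $ b *\<^sub>C u p a b)"

definition op2 :: "nat \<Rightarrow> nat \<Rightarrow> 'n mat2 \<Rightarrow> 'b" where
  "op2 p r X = (\<Sum>a\<in>UNIV. \<Sum>c\<in>UNIV. \<Sum>b\<in>UNIV. \<Sum>d\<in>UNIV. X $ (a,b) $ (c,d) *\<^sub>C (u p a c * u r b d))"

text \<open>
  The element \<open>X\<close> acts trivially in the factor \<open>p\<close>: it commutes with all matrices acting there.
\<close>

definition free :: "nat \<Rightarrow> 'b \<Rightarrow> bool" where
  "free p X \<longleftrightarrow> (\<forall>a b. X * u p a b = u p a b * X)"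

text \<open>
  Partial trace over the factor \<open>p\<close>, tensored back with the identity in that factor.
\<close>

definition ptr :: "nat \<Rightarrow> 'b \<Rightarrow> 'b" where
  "ptr p X = (\<Sum>a\<in>UNIV. \<Sum>b\<in>UNIV. u p a b * X * u p b a)"

lemma u_mult_left: "u p a b * (u p c d * X) = (if b = c then u p a d * X else 0)"
  using u_mult[of p a b c d] by (simp flip: mult.assoc)

lemma free_0 [simp]: "free p 0" and free_1 [simp]: "free p 1"
  by (simp_all add: free_def)

lemma free_add [intro]: "free p X \<Longrightarrow> free p Y \<Longrightarrow> free p (X + Y)"
  and free_scaleC [intro]: "free p X \<Longrightarrow> free p (c *\<^sub>C X)"
  by (simp_all add: free_def algebra_simps mult_scaleC_left mult_scaleC_right)

lemma free_mult [intro]: "free p X \<Longrightarrow> free p Y \<Longrightarrow> free p (X * Y)"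
  unfolding free_def by (simp add: mult.assoc) (simp flip: mult.assoc)

lemma free_sum [intro]: "(\<And>x. x \<in> S \<Longrightarrow> free p (f x)) \<Longrightarrow> free p (\<Sum>x\<in>S. f x)"
  by (induction S rule: infinite_finite_induct) auto

lemma free_u [intro]: "p \<noteq> r \<Longrightarrow> free p (u r a b)"
  by (simp add: free_def u_commute)

lemma free_op1 [intro]: "p \<noteq> r \<Longrightarrow> free p (op1 r x)"
  unfolding op1_def by auto

lemma free_op2 [intro]: "s \<noteq> p \<Longrightarrow> s \<noteq> r \<Longrightarrow> free s (op2 p r X)"
  unfolding op2_def by (intro free_sum free_scaleC free_mult free_u) auto

lemma free_uD: "free p X \<Longrightarrow> X * u p a b = u p a b * X"
  by (simp add: free_def)

lemma op1_commute: "free p X \<Longrightarrow> X * op1 p x = op1 p x * X"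
  unfolding op1_def
  by (simp add: sum_distrib_left sum_distrib_right mult_scaleC_left mult_scaleC_right free_uD)

lemma op2_commute: 
  assumes "free p X" "free r X"
  shows "X * op2 p r Y = op2 p r Y * X"
proof -
  have "X * (u p a c * u r b d) = u p a c * u r b d * X" for a b c d
    using assms by (metis free_uD mult.assoc)
  then show ?thesis
    unfolding op2_def
    by (simp add: sum_distrib_left sum_distrib_right mult_scaleC_left mult_scaleC_right)
qed

lemma ptr_add: "ptr p (X + Y) = ptr p X + ptr p Y"
  and ptr_diff: "ptr p (X - Y) = ptr p X - ptr p Y"
  and ptr_scaleC: "ptr p (c *\<^sub>C X) = c *\<^sub>C ptr p X"
  and ptr_0 [simp]: "ptr p 0 = 0"
  by (simp_all add: ptr_def algebra_simps sum.distrib sum_subtractf mult_scaleC_left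
      mult_scaleC_right scaleC.scale_sum_right)

lemma ptr_sum: "ptr p (\<Sum>x\<in>S. f x) = (\<Sum>x\<in>S. ptr p (f x))"
  by (induction S rule: infinite_finite_induct) (simp_all add: ptr_add)

lemma ptr_mult_left: "free p A \<Longrightarrow> ptr p (A * X) = A * ptr p X"
  unfolding ptr_def sum_distrib_left
  by (intro sum.cong refl) (simp flip: mult.assoc add: free_uD)

lemma ptr_mult_right: "free p A \<Longrightarrow> ptr p (X * A) = ptr p X * A"
  unfolding ptr_def sum_distrib_right
  by (intro sum.cong refl) (simp add: mult.assoc free_uD)

lemma ptr_cyc_u: "ptr p (u p c d * X) = ptr p (X * u p c d)"
proof -
  have "ptr p (u p c d * X) = (\<Sum>a\<in>UNIV. \<Sum>b\<in>UNIV. if b = c then u p a d * X * u p b a else 0)"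
    unfolding ptr_def
    by (intro sum.cong refl) (auto simp: u_mult_left mult.assoc)
  also have "\<dots> = (\<Sum>a\<in>UNIV. \<Sum>b\<in>UNIV. if d = b then u p a b * X * u p c a else 0)"
    by simp
  also have "\<dots> = ptr p (X * u p c d)"
    unfolding ptr_def
    by (intro sum.cong refl) (auto simp: u_mult mult.assoc)
  finally show ?thesis .
qed

lemma ptr_commute: "p \<noteq> r \<Longrightarrow> ptr p (ptr r X) = ptr r (ptr p X)"
proof -
  assume "p \<noteq> r"
  then have "u p a b * ptr r X * u p b a = ptr r (u p a b * X * u p b a)" for a b
    by (subst ptr_mult_right) (auto simp: ptr_mult_left free_u)
  then show ?thesis
    by (subst (1) ptr_def) (simp add: ptr_def[of p X] ptr_sum)
qed

lemma free_ptr_same [simp]: "free p (ptr p X)"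
  unfolding free_def
proof (intro allI)
  fix c d
  have "ptr p X * u p c d = (\<Sum>a\<in>UNIV. \<Sum>b\<in>UNIV. if a = c then u p a b * X * u p b d else 0)"
    unfolding ptr_def sum_distrib_right
    by (intro sum.cong refl) (auto simp: u_mult mult.assoc)
  also have "\<dots> = (\<Sum>b\<in>UNIV. \<Sum>a\<in>UNIV. if a = c then u p c b * X * u p b d else 0)"
    by (subst sum.swap) (intro sum.cong refl, simp)
  also have "\<dots> = (\<Sum>b\<in>UNIV. \<Sum>a\<in>UNIV. if a = d then u p c b * X * u p b d else 0)"
    by simp
  also have "\<dots> = (\<Sum>a\<in>UNIV. \<Sum>b\<in>UNIV. if a = d then u p c b * X * u p b a else 0)"
    by (subst sum.swap) (intro sum.cong refl, simp)
  also have "\<dots> = u p c d * ptr p X"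
    unfolding ptr_def sum_distrib_left
    by (intro sum.cong refl) (auto simp: u_mult_left mult.assoc)
  finally show "ptr p X * u p c d = u p c d * ptr p X" .
qed

lemma free_ptr [intro]: "free r X \<Longrightarrow> free r (ptr p X)"
proof (cases "r = p")
  case False
  assume "free r X"
  then show ?thesis
    unfolding ptr_def using False by (intro free_sum free_mult free_u) auto
qed simp

lemma ptr_u: "ptr p (u p c d) = (if c = d then 1 else 0)"
proof -
  have "ptr p (u p c d) = (\<Sum>a\<in>UNIV. \<Sum>b\<in>UNIV. if b = c then (if d = c then u p a a else 0) else 0)"
    unfolding ptr_def by (intro sum.cong refl) (auto simp: u_mult)
  also have "\<dots> = (if c = d then 1 else 0)"
    by (auto simp: u_sum)
  finally show ?thesis .
qed

lemma op2_one: "p \<noteq> r \<Longrightarrow> op2 p r (mat 1) = 1"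
proof -
  have "op2 p r (mat 1) = (\<Sum>a\<in>UNIV. \<Sum>c\<in>UNIV. \<Sum>b\<in>UNIV. \<Sum>d\<in>UNIV.
      if d = b then (if a = c then u p a a * u r b b else 0) else 0)"
    unfolding op2_def mat_def by (intro sum.cong refl) auto
  also have "\<dots> = (\<Sum>a\<in>UNIV. \<Sum>c\<in>UNIV. if a = c then (\<Sum>b\<in>UNIV. u p a a * u r b b) else 0)"
    by (intro sum.cong refl) auto
  also have "\<dots> = 1"
    by (simp add: u_sum flip: sum_distrib_left)
  finally show ?thesis .
qed

lemma op2_u: 
  assumes "p \<noteq> r"
  shows "op2 p r X * (u p c c' * u r d d')
    = (\<Sum>a\<in>UNIV. \<Sum>b\<in>UNIV. X $ (a,b) $ (c,d) *\<^sub>C (u p a c' * u r b d'))"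
proof -
  have *: "u p a e * u r b f * (u p c c' * u r d d')
      = (if f = d then (if e = c then u p a c' * u r b d' else 0) else 0)" for a b e f
  proof -
    have "u p a e * u r b f * (u p c c' * u r d d') = u p a e * (u r b f * u p c c') * u r d d'"
      by (simp add: mult.assoc)
    also have "\<dots> = u p a e * (u p c c' * u r b f) * u r d d'"
      using assms by (simp add: u_commute)
    also have "\<dots> = (u p a e * u p c c') * (u r b f * u r d d')"
      by (simp add: mult.assoc)
    finally show ?thesis by (simp add: u_mult)
  qed
  have "op2 p r X * (u p c c' * u r d d') = (\<Sum>a\<in>UNIV. \<Sum>e\<in>UNIV. \<Sum>b\<in>UNIV. \<Sum>f\<in>UNIV.
      if f = d then (if e = c then X $ (a,b) $ (c,d) *\<^sub>C (u p a c' * u r b d') else 0) else 0)"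
    unfolding op2_def sum_distrib_right mult_scaleC_left *
    by (intro sum.cong refl) auto
  also have "\<dots> = (\<Sum>a\<in>UNIV. \<Sum>e\<in>UNIV. if e = c then (\<Sum>b\<in>UNIV. X $ (a,b) $ (c,d) *\<^sub>C (u p a c' * u r b d')) else 0)"
    by (intro sum.cong refl) auto
  finally show ?thesis by simp
qed

lemma op2_mult: 
  assumes "p \<noteq> r"
  shows "op2 p r X * op2 p r Y = op2 p r (X ** Y)"
proof -
  have swap5: "(\<Sum>c\<in>UNIV. \<Sum>c'\<in>UNIV. \<Sum>d\<in>UNIV. \<Sum>d'\<in>UNIV. \<Sum>a\<in>UNIV. \<Sum>b\<in>UNIV. g c c' d d' a b)
     = (\<Sum>a\<in>UNIV. \<Sum>c'\<in>UNIV. \<Sum>b\<in>UNIV. \<Sum>d'\<in>UNIV. \<Sum>c\<in>UNIV. \<Sum>d\<in>UNIV. g c c' d d' a b)"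
    for g :: "'n \<Rightarrow> 'n \<Rightarrow> 'n \<Rightarrow> 'n \<Rightarrow> 'n \<Rightarrow> 'n \<Rightarrow> 'b"
    unfolding sum.cartesian_product
    by (rule sum.reindex_bij_witness[of _ 
          "\<lambda>(a,c',b,d',c,d). (c,c',d,d',a,b)" "\<lambda>(c,c',d,d',a,b). (a,c',b,d',c,d)"]) auto
  have "op2 p r X * op2 p r Y = (\<Sum>c\<in>UNIV. \<Sum>c'\<in>UNIV. \<Sum>d\<in>UNIV. \<Sum>d'\<in>UNIV. \<Sum>a\<in>UNIV. \<Sum>b\<in>UNIV.
      (X $ (a,b) $ (c,d) * Y $ (c,d) $ (c',d')) *\<^sub>C (u p a c' * u r b d'))"
    unfolding op2_def[of p r Y] sum_distrib_left mult_scaleC_right op2_u[OF assms]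
    by (simp add: scaleC.scale_sum_right scaleC_scaleC mult.commute)
  also have "\<dots> = (\<Sum>a\<in>UNIV. \<Sum>c'\<in>UNIV. \<Sum>b\<in>UNIV. \<Sum>d'\<in>UNIV. \<Sum>c\<in>UNIV. \<Sum>d\<in>UNIV.
      (X $ (a,b) $ (c,d) * Y $ (c,d) $ (c',d')) *\<^sub>C (u p a c' * u r b d'))"
    by (rule swap5)
  also have "\<dots> = op2 p r (X ** Y)"
    unfolding op2_def matrix_matrix_mult_def
    by (simp add: sum.cartesian_product scaleC.scale_sum_left case_prod_unfold)
  finally show ?thesis .
qed

text \<open>
  Tracing out one of the two factors of \<open>X\<close> against a matrix unit contracts one pair of indices.  The
  sums on the right have the shape that the skew inverse of \<open>F\<close> undoes.
\<close>

lemma ptr_op2_u: 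
  assumes "s \<noteq> t"
  shows "ptr s (op2 s t X * u s c a) = (\<Sum>b\<in>UNIV. \<Sum>d\<in>UNIV. X $ (a,b) $ (c,d) *\<^sub>C u t b d)"
proof -
  have *: "ptr s (u s e f * u t b d * u s c a) = (if e = a then (if f = c then u t b d else 0) else 0)" 
    for e f b d
  proof -
    have "u s e f * u t b d * u s c a = u t b d * (u s e f * u s c a)"
      using assms by (metis u_commute mult.assoc)
    then show ?thesis
      using assms by (auto simp: u_mult ptr_mult_left free_u ptr_u)
  qed
  have "ptr s (op2 s t X * u s c a) = (\<Sum>e\<in>UNIV. \<Sum>f\<in>UNIV. \<Sum>b\<in>UNIV. \<Sum>d\<in>UNIV.
     if e = a then (if f = c then X $ (a,b) $ (c,d) *\<^sub>C u t b d else 0) else 0)"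
    unfolding op2_def sum_distrib_right mult_scaleC_left ptr_sum ptr_scaleC *
    by (intro sum.cong refl) auto
  also have "\<dots> = (\<Sum>e\<in>UNIV. if e = a then (\<Sum>f\<in>UNIV. if f = c then
      (\<Sum>b\<in>UNIV. \<Sum>d\<in>UNIV. X $ (a,b) $ (c,d) *\<^sub>C u t b d) else 0) else 0)"
    by (rule sum.cong[OF refl]) (auto intro!: sum.cong simp del: sum.delta sum.delta')
  finally show ?thesis by simp
qed

text \<open>
  Sandwiching \<open>X\<close> between matrix units contracts the other pair of indices, with the same shape of sum.
\<close>

lemma u_op2_u:
  assumes "s \<noteq> t"
  shows "u s j i * op2 s t X * u s c a
    = (\<Sum>b\<in>UNIV. \<Sum>d\<in>UNIV. X $ (i,b) $ (c,d) *\<^sub>C (u s j a * u t b d))"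
proof -
  have *: "u s j i * (u s e f * u t b d) * u s c a 
     = (if e = i then (if f = c then u s j a * u t b d else 0) else 0)" for e f b d
  proof -
    have "u s j i * (u s e f * u t b d) * u s c a = u s j i * u s e f * (u t b d * u s c a)"
      by (simp add: mult.assoc)
    also have "\<dots> = u s j i * u s e f * u s c a * u t b d"
      using assms by (simp add: mult.assoc u_commute)
    finally show ?thesis by (auto simp: u_mult)
  qed
  have "u s j i * op2 s t X * u s c a = (\<Sum>e\<in>UNIV. \<Sum>f\<in>UNIV. \<Sum>b\<in>UNIV. \<Sum>d\<in>UNIV.
     if e = i then (if f = c then X $ (i,b) $ (c,d) *\<^sub>C (u s j a * u t b d) else 0) else 0)"
    unfolding op2_def sum_distrib_right sum_distrib_left mult_scaleC_right mult_scaleC_left *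
    by (intro sum.cong refl) auto
  also have "\<dots> = (\<Sum>e\<in>UNIV. if e = i then (\<Sum>f\<in>UNIV. if f = c then
      (\<Sum>b\<in>UNIV. \<Sum>d\<in>UNIV. X $ (i,b) $ (c,d) *\<^sub>C (u s j a * u t b d)) else 0) else 0)"
    by (rule sum.cong[OF refl]) (auto intro!: sum.cong simp del: sum.delta sum.delta')
  finally show ?thesis by simp
qed

lemma ptr_op1_u: "ptr p (op1 p x * u p c d) = x $ d $ c *\<^sub>C 1"
proof -
  have "ptr p (op1 p x * u p c d) = (\<Sum>a\<in>UNIV. \<Sum>b\<in>UNIV. if b = c then (if a = d then x $ a $ b *\<^sub>C 1 else 0) else 0)"
    unfolding op1_def sum_distrib_right mult_scaleC_left ptr_sum ptr_scaleC u_mult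
    by (intro sum.cong refl) (auto simp: ptr_u)
  then show ?thesis by simp
qed

text \<open>
  The coefficient of \<open>u p c d\<close> in the expansion of \<open>X\<close> along the factor \<open>p\<close>; it acts trivially there.
\<close>

definition coeff :: "nat \<Rightarrow> 'n \<Rightarrow> 'n \<Rightarrow> 'b \<Rightarrow> 'b" where
  "coeff p c d X = ptr p (u p d c * X)"

lemma expand_u: "X = (\<Sum>c\<in>UNIV. \<Sum>d\<in>UNIV. u p c d * coeff p c d X)"
proof -
  have "u p c d * coeff p c d X = u p c c * X * u p d d" for c d
  proof -
    have "u p c d * coeff p c d X = (\<Sum>a\<in>UNIV. \<Sum>b\<in>UNIV. 
       if b = d then (if a = d then u p c c * X * u p d d else 0) else 0)"
      unfolding coeff_def ptr_def sum_distrib_left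
      by (intro sum.cong refl) (auto simp: u_mult_left u_mult mult.assoc)
    then show ?thesis by simp
  qed
  then have "(\<Sum>c\<in>UNIV. \<Sum>d\<in>UNIV. u p c d * coeff p c d X) = (\<Sum>c\<in>UNIV. u p c c) * X * (\<Sum>d\<in>UNIV. u p d d)"
    by (simp add: sum_distrib_left sum_distrib_right) (rule sum.swap)
  then show ?thesis by (simp add: u_sum)
qed

lemma free_coeff_same [simp]: "free p (coeff p c d X)"
  by (simp add: coeff_def)

lemma free_coeff [intro]: "free r X \<Longrightarrow> free r (coeff p c d X)"
  by (cases "r = p") (auto simp: coeff_def)

end

section \<open>The quantum trace of a closed braiding\<close>

text \<open>
  The defining equation of \<open>\<Psi>\<close> says that, after a regrouping of indices, \<open>\<Psi>\<close> is a left inverse of \<open>F\<close> as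
  a square matrix; hence it is a right inverse too.
\<close>

lemma skew_inverse_right:
  assumes "skew_inverse F \<Psi>"
  shows "(\<Sum>b\<in>UNIV. \<Sum>d\<in>UNIV. F $ (a,b) $ (c,d) * \<Psi> $ (d,c') $ (b,a')) = (if c = c' \<and> a = a' then 1 else 0)"
proof -
  define A :: "'a mat2" where "A = (\<chi> x y. \<Psi> $ (fst x, fst y) $ (snd x, snd y))"
  define B :: "'a mat2" where "B = (\<chi> x y. F $ (snd x, snd y) $ (fst x, fst y))"
  have "A ** B = mat 1"
    using assms
    by (simp add: vec_eq_iff matrix_matrix_mult_def A_def B_def mat_def skew_inverse_def 
        UNIV_Times_UNIV[symmetric] sum.cartesian_product' del: UNIV_Times_UNIV)
  then have "B ** A = mat 1"
    using matrix_left_right_inverse by blast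
  then have "(B ** A) $ (c,a) $ (c',a') = (if c = c' \<and> a = a' then 1 else 0)"
    by (simp add: mat_def)
  then show ?thesis
    by (subst sum.swap)
      (simp add: matrix_matrix_mult_def A_def B_def
        UNIV_Times_UNIV[symmetric] sum.cartesian_product' del: UNIV_Times_UNIV)
qed

lemma matrix_inv_inverse:
  assumes "invertible (A :: 'a::semiring_1^'n^'n)"
  shows "A ** matrix_inv A = mat 1" "matrix_inv A ** A = mat 1"
  using someI_ex[OF assms[unfolded invertible_def]] by (simp_all add: matrix_inv_def)

text \<open>
  A closed braiding \<open>F\<close> with skew inverse \<open>\<Psi>\<close> and the matrix \<open>D\<close> of the quantum trace, together with
  a matrix \<open>R\<close> compatible with \<open>F\<close>.  The braid relations are required for any three distinct factors.
\<close>

locale closed_braiding = matrix_units u 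
  for u :: "nat \<Rightarrow> 'n::finite \<Rightarrow> 'n \<Rightarrow> 'b::complex_algebra_1" +
  fixes R F \<Psi> :: "'n mat2" and D :: "complex^'n^'n"
  assumes invertible_F: "invertible F"
    and braid_F: "distinct [p,r,s] \<Longrightarrow>
      op2 p r F * op2 r s F * op2 p r F = op2 r s F * op2 p r F * op2 r s F"
    and RFF: "distinct [p,r,s] \<Longrightarrow>
      op2 p r R * op2 r s F * op2 p r F = op2 r s F * op2 p r F * op2 r s R"
    and FFR: "distinct [p,r,s] \<Longrightarrow>
      op2 p r F * op2 r s F * op2 p r R = op2 r s R * op2 p r F * op2 r s F"
    and skew: "skew_inverse F \<Psi>"
    and D_def: "D = (\<chi> a b. \<Sum>c\<in>UNIV. \<Psi> $ (a,c) $ (b,c))"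
begin

abbreviation "Fi \<equiv> matrix_inv F"

lemma F_Fi: "p \<noteq> r \<Longrightarrow> op2 p r F * op2 p r Fi = 1"
  and Fi_F: "p \<noteq> r \<Longrightarrow> op2 p r Fi * op2 p r F = 1"
  using matrix_inv_inverse[OF invertible_F] by (simp_all add: op2_mult op2_one)

lemma F_Fi_left: "p \<noteq> r \<Longrightarrow> op2 p r F * (op2 p r Fi * X) = X"
  and Fi_F_left: "p \<noteq> r \<Longrightarrow> op2 p r Fi * (op2 p r F * X) = X"
  by (simp_all add: F_Fi Fi_F flip: mult.assoc)

lemma op2_twist: "p \<noteq> r \<Longrightarrow> op2 p r (twist F X) = op2 p r F * op2 p r X * op2 p r Fi"
  by (simp add: twist_def op2_mult)

text \<open>
  Quantum trace over the factor \<open>p\<close>.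
\<close>

definition qt :: "nat \<Rightarrow> 'b \<Rightarrow> 'b" where
  "qt p X = ptr p (op1 p D * X)"

lemma qt_add: "qt p (X + Y) = qt p X + qt p Y"
  and qt_diff: "qt p (X - Y) = qt p X - qt p Y"
  and qt_scaleC: "qt p (c *\<^sub>C X) = c *\<^sub>C qt p X"
  and qt_0 [simp]: "qt p 0 = 0"
  by (simp_all add: qt_def distrib_left right_diff_distrib ptr_add ptr_diff mult_scaleC_right ptr_scaleC)

lemma qt_sum: "qt p (\<Sum>x\<in>S. f x) = (\<Sum>x\<in>S. qt p (f x))"
  by (induction S rule: infinite_finite_induct) (simp_all add: qt_add)

lemma qt_mult_left: "free p A \<Longrightarrow> qt p (A * X) = A * qt p X"
  by (simp add: qt_def op1_commute flip: ptr_mult_left mult.assoc)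

lemma qt_mult_right: "free p A \<Longrightarrow> qt p (X * A) = qt p X * A"
  by (simp add: qt_def flip: ptr_mult_right mult.assoc)

lemma free_qt_same [simp]: "free p (qt p X)"
  by (simp add: qt_def)

lemma free_qt [intro]: "free r X \<Longrightarrow> free r (qt p X)"
  by (cases "r = p") (auto simp: qt_def)

lemma ptr_qt_commute: "p \<noteq> r \<Longrightarrow> ptr p (qt r X) = qt r (ptr p X)"
  unfolding qt_def by (subst ptr_commute) (auto simp: ptr_mult_left free_op1)

lemma F_D: "(\<Sum>b\<in>UNIV. \<Sum>d\<in>UNIV. F $ (a,b) $ (c,d) * D $ d $ b) = (if a = c then 1 else 0)"
proof -
  have "(\<Sum>b\<in>UNIV. \<Sum>d\<in>UNIV. F $ (a,b) $ (c,d) * D $ d $ b)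
      = (\<Sum>b\<in>UNIV. \<Sum>e\<in>UNIV. \<Sum>d\<in>UNIV. F $ (a,b) $ (c,d) * \<Psi> $ (d,e) $ (b,e))"
    unfolding D_def by (subst (2) sum.swap) (simp add: sum_distrib_left)
  also have "\<dots> = (\<Sum>e\<in>UNIV. \<Sum>b\<in>UNIV. \<Sum>d\<in>UNIV. F $ (a,b) $ (c,d) * \<Psi> $ (d,e) $ (b,e))"
    by (rule sum.swap)
  also have "\<dots> = (\<Sum>e\<in>UNIV. if c = e then (if a = e then 1 else 0) else 0)"
    unfolding skew_inverse_right[OF skew] by (intro sum.cong) auto
  finally show ?thesis by simp
qed

lemma qt_F: 
  assumes "p \<noteq> r"
  shows "qt r (op2 p r F) = 1"
proof -
  have *: "qt r (u p a c * u r b d) = D $ d $ b *\<^sub>C u p a c" for a b c d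
    using assms by (simp add: qt_mult_left free_u) (simp add: qt_def ptr_op1_u mult_scaleC_right)
  have "qt r (op2 p r F) = (\<Sum>a\<in>UNIV. \<Sum>c\<in>UNIV. (\<Sum>b\<in>UNIV. \<Sum>d\<in>UNIV. F $ (a,b) $ (c,d) * D $ d $ b) *\<^sub>C u p a c)"
    unfolding op2_def qt_sum qt_scaleC * by (simp add: scaleC_scaleC scaleC.scale_sum_left)
  also have "\<dots> = (\<Sum>a\<in>UNIV. \<Sum>c\<in>UNIV. if a = c then u p a c else 0)"
    unfolding F_D by (intro sum.cong) auto
  finally show ?thesis by (simp add: u_sum)
qed

text \<open>
  A linear condition holds for all \<open>w b d\<close> if it holds for their combinations with the coefficients of
  \<open>F\<close>: the skew inverse recovers each \<open>w b d\<close> from these combinations.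
\<close>

lemma skew_span:
  assumes "P 0" and "\<And>x y. P x \<Longrightarrow> P y \<Longrightarrow> P (x + y)" and "\<And>c x. P x \<Longrightarrow> P (c *\<^sub>C x)"
    and "\<And>a c. P (\<Sum>b\<in>UNIV. \<Sum>d\<in>UNIV. F $ (a,b) $ (c,d) *\<^sub>C w b d)"
  shows "P (w b d :: 'b)"
proof -
  have P_sum: "P (\<Sum>x\<in>S. f x)" if "\<And>x. P (f x)" for f :: "'n \<Rightarrow> 'b" and S
    using that by (induction S rule: infinite_finite_induct) (auto intro: assms(1,2))
  have "(\<Sum>f\<in>UNIV. \<Sum>g\<in>UNIV. \<Psi> $ (d,f) $ (b,g) *\<^sub>C
      (\<Sum>b\<in>UNIV. \<Sum>d\<in>UNIV. F $ (g,b) $ (f,d) *\<^sub>C w b d))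
    = (\<Sum>f\<in>UNIV. \<Sum>g\<in>UNIV. \<Sum>b'\<in>UNIV. \<Sum>d'\<in>UNIV. (\<Psi> $ (d,f) $ (b,g) * F $ (g,b') $ (f,d')) *\<^sub>C w b' d')"
    by (simp add: scaleC.scale_sum_right scaleC_scaleC)
  also have "\<dots> = (\<Sum>b'\<in>UNIV. \<Sum>d'\<in>UNIV. \<Sum>f\<in>UNIV. \<Sum>g\<in>UNIV. (\<Psi> $ (d,f) $ (b,g) * F $ (g,b') $ (f,d')) *\<^sub>C w b' d')"
    unfolding sum.cartesian_product
    by (rule sum.reindex_bij_witness[of _ "\<lambda>(b',d',f,g). (f,g,b',d')" "\<lambda>(f,g,b',d'). (b',d',f,g)"]) auto
  also have "\<dots> = (\<Sum>b'\<in>UNIV. \<Sum>d'\<in>UNIV. (if d = d' \<and> b' = b then 1 else 0) *\<^sub>C w b' d')"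
    using skew by (simp add: skew_inverse_def flip: scaleC.scale_sum_left)
  also have "\<dots> = (\<Sum>b'\<in>UNIV. \<Sum>d'\<in>UNIV. if d = d' then if b' = b then w b d else 0 else 0)"
    by (intro sum.cong) auto
  also have "\<dots> = w b d" by simp
  finally have "w b d = (\<Sum>f\<in>UNIV. \<Sum>g\<in>UNIV. \<Psi> $ (d,f) $ (b,g) *\<^sub>C
      (\<Sum>b\<in>UNIV. \<Sum>d\<in>UNIV. F $ (g,b) $ (f,d) *\<^sub>C w b d))" ..
  moreover have "P \<dots>"
    by (intro P_sum assms(3,4))
  ultimately show ?thesis by simp
qed

lemma qt_conj_u:
  assumes "p \<noteq> r"
  shows "qt r (op2 p r F * u p b d * op2 p r Fi) = qt p (u p b d)"
proof (rule skew_span[of "\<lambda>X. qt r (op2 p r F * X * op2 p r Fi) = qt p X" "u p"])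
  obtain s where s: "s \<noteq> p" "s \<noteq> r"
    using infinite_UNIV_nat by (metis (full_types) n_not_Suc_n nat.distinct(1) nat.inject)
  fix a c
  let ?y = "u s c a"
  \<comment> \<open>By linearity it suffices to treat partial traces over an auxiliary factor \<open>s\<close>.\<close>
  have *: "(\<Sum>b\<in>UNIV. \<Sum>d\<in>UNIV. F $ (a,b) $ (c,d) *\<^sub>C u p b d) = ptr s (op2 s p F * ?y)"
    using s by (simp add: ptr_op2_u)
  have conj: "op2 p r F * op2 s p F * op2 p r Fi = op2 s p Fi * op2 p r F * op2 s p F"
  proof -
    have "op2 s p Fi * (op2 s p F * op2 p r F * op2 s p F) * op2 p r Fi
        = op2 s p Fi * (op2 p r F * op2 s p F * op2 p r F) * op2 p r Fi"
      using braid_F[of s p r] s assms by simp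
    then show ?thesis
      using s assms by (simp add: mult.assoc Fi_F_left F_Fi)
  qed
  have "op2 p r F * ptr s (op2 s p F * ?y) * op2 p r Fi 
      = ptr s (op2 p r F * (op2 s p F * ?y) * op2 p r Fi)"
    using s by (simp add: ptr_mult_left ptr_mult_right free_op2)
  also have "\<dots> = ptr s (op2 p r F * op2 s p F * op2 p r Fi * ?y)"
    using s assms by (simp add: mult.assoc) (subst op2_commute, auto simp: mult.assoc free_u)
  also have "qt r \<dots> = ptr s (qt r (op2 s p Fi * op2 p r F * (op2 s p F * ?y)))"
    unfolding conj using s by (simp add: ptr_qt_commute mult.assoc)
  also have "qt r (op2 s p Fi * op2 p r F * (op2 s p F * ?y)) = op2 s p Fi * qt r (op2 p r F) * (op2 s p F * ?y)"
  proof -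
    have "free r (op2 s p F * ?y)" "free r (op2 s p Fi)"
      using s assms by (auto simp: free_u free_op2)
    then show ?thesis by (simp add: qt_mult_left qt_mult_right)
  qed
  also have "\<dots> = ?y"
    using s assms by (simp add: qt_F Fi_F_left)
  finally have 1: "qt r (op2 p r F * ptr s (op2 s p F * ?y) * op2 p r Fi) = ptr s ?y" .
  have "qt p (ptr s (op2 s p F * ?y)) = ptr s (qt p (op2 s p F * ?y))"
    using s by (simp add: ptr_qt_commute)
  also have "\<dots> = ptr s ?y"
    using s by (subst qt_mult_right) (auto simp: free_u qt_F)
  finally show "qt r (op2 p r F * (\<Sum>b\<in>UNIV. \<Sum>d\<in>UNIV. F $ (a,b) $ (c,d) *\<^sub>C u p b d) * op2 p r Fi)
    = qt p (\<Sum>b\<in>UNIV. \<Sum>d\<in>UNIV. F $ (a,b) $ (c,d) *\<^sub>C u p b d)"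
    unfolding * 1 by simp
qed (simp_all add: distrib_left distrib_right qt_add mult_scaleC_left mult_scaleC_right qt_scaleC)

lemma qt_conj:
  assumes "p \<noteq> r" "free r X"
  shows "qt r (op2 p r F * X * op2 p r Fi) = qt p X"
proof -
  have *: "qt r (op2 p r F * (u p c d * coeff p c d X) * op2 p r Fi) = qt p (u p c d * coeff p c d X)" for c d
  proof -
    have fr: "free p (coeff p c d X)" "free r (coeff p c d X)" using assms by auto
    have "op2 p r F * (u p c d * coeff p c d X) * op2 p r Fi
        = op2 p r F * u p c d * op2 p r Fi * coeff p c d X"
      using op2_commute[OF fr, of Fi] by (simp add: mult.assoc)
    then show ?thesis
      using fr by (simp add: qt_mult_right qt_conj_u assms)
  qed
  have "qt r (op2 p r F * (\<Sum>c\<in>UNIV. \<Sum>d\<in>UNIV. u p c d * coeff p c d X) * op2 p r Fi)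
    = qt p (\<Sum>c\<in>UNIV. \<Sum>d\<in>UNIV. u p c d * coeff p c d X)"
    by (simp add: sum_distrib_left sum_distrib_right qt_sum *)
  then show ?thesis by (simp flip: expand_u)
qed

text \<open>
  The quantum trace over two factors is cyclic up to the double twist of \<open>R\<close>.
\<close>

lemma qt_cyc_u:
  assumes pr: "p \<noteq> r"
  shows "qt p (qt r (op2 p r R * (u p a c * u r b d)))
    = qt p (qt r (u p a c * u r b d * op2 p r (twist F (twist F R))))"
proof -
  define R' where "R' = twist F (twist F R)"
  define P where "P X \<longleftrightarrow> qt p (qt r (op2 p r R * X)) = qt p (qt r (X * op2 p r R'))" for X
  have P0: "P 0" and P_add: "\<And>x y. P x \<Longrightarrow> P y \<Longrightarrow> P (x + y)" and P_scale: "\<And>c x. P x \<Longrightarrow> P (c *\<^sub>C x)"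
    by (simp_all add: P_def distrib_left distrib_right qt_add mult_scaleC_left mult_scaleC_right qt_scaleC)
  \<comment> \<open>Two auxiliary factors; \<open>Z\<close> is the braiding of \<open>V \<otimes> V\<close> in the factors \<open>s, t\<close> with \<open>V \<otimes> V\<close> in the
      factors \<open>p, r\<close>.\<close>
  obtain s t where st: "distinct [s, t, p, r]"
  proof
    show "distinct [p + r + 1, p + r + 2, p, r]" using pr by auto
  qed
  then have ne: "s \<noteq> t" "t \<noteq> s" "s \<noteq> p" "p \<noteq> s" "s \<noteq> r" "r \<noteq> s" "t \<noteq> p" "p \<noteq> t" "t \<noteq> r" "r \<noteq> t" "p \<noteq> r" "r \<noteq> p"
    by auto
  let ?A = "op2 s t F" and ?B = "op2 t p F" and ?C = "op2 p r F"
  define Z where "Z = ?B * ?C * ?A * ?B"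
  have AC: "?A * ?C = ?C * ?A"
    using ne by (intro op2_commute free_op2) auto
  have Z': "Z = ?B * ?A * ?C * ?B" by (simp add: Z_def AC mult.assoc)
  have slide: "op2 p r X * Z = Z * op2 s t X \<and> op2 s t X * Z = Z * op2 p r X"
    if rff: "\<And>p r s. distinct [p,r,s] \<Longrightarrow>
        op2 p r X * op2 r s F * op2 p r F = op2 r s F * op2 p r F * op2 r s X"
      and ffr: "\<And>p r s. distinct [p,r,s] \<Longrightarrow>
        op2 p r F * op2 r s F * op2 p r X = op2 r s X * op2 p r F * op2 r s F" for X
  proof
    have "op2 p r X * Z = op2 p r X * ?B * ?C * ?A * ?B" by (simp add: Z_def mult.assoc)
    also have "\<dots> = ?B * ?C * (op2 t p X * ?A * ?B)"
      using ffr[of t p r] ne by (simp flip: mult.assoc)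
    also have "\<dots> = Z * op2 s t X"
      using ffr[of s t p] ne by (simp add: mult.assoc Z_def)
    finally show "op2 p r X * Z = Z * op2 s t X" .
    have "op2 s t X * Z = op2 s t X * ?B * ?A * ?C * ?B" by (simp add: Z' mult.assoc)
    also have "\<dots> = ?B * ?A * (op2 t p X * ?C * ?B)"
      using rff[of s t p] ne by (simp flip: mult.assoc)
    also have "\<dots> = Z * op2 p r X"
      using rff[of t p r] ne by (simp add: mult.assoc Z')
    finally show "op2 s t X * Z = Z * op2 p r X" .
  qed
  have RZ: "op2 p r R * Z = Z * op2 s t R" "op2 s t R * Z = Z * op2 p r R"
    using slide[OF RFF FFR] by auto
  have FZ: "?A * Z = Z * ?C"
    using slide[of F] braid_F by auto
  have FiZ: "op2 s t Fi * Z = Z * op2 p r Fi"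
  proof -
    have "op2 s t Fi * Z = op2 s t Fi * (Z * ?C) * op2 p r Fi"
      using pr by (simp add: mult.assoc F_Fi)
    also have "\<dots> = Z * op2 p r Fi"
      using ne by (simp add: FZ[symmetric] Fi_F_left flip: mult.assoc) (simp add: Fi_F)
    finally show ?thesis .
  qed
  have R'_st: "op2 s t R' = ?A * ?A * op2 s t R * op2 s t Fi * op2 s t Fi"
    and R'_pr: "op2 p r R' = ?C * ?C * op2 p r R * op2 p r Fi * op2 p r Fi"
    using ne by (simp_all add: R'_def op2_twist mult.assoc)
  have R'Z: "Z * op2 p r R' = op2 s t R' * Z"
  proof -
    have left: "op2 s t Fi * (Z * X) = Z * (op2 p r Fi * X)" "op2 s t R * (Z * X) = Z * (op2 p r R * X)"
      "?A * (Z * X) = Z * (?C * X)" for X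
      by (simp_all flip: mult.assoc add: FiZ RZ(2) FZ)
    show ?thesis
      by (simp add: R'_st R'_pr mult.assoc left FiZ RZ(2) FZ)
  qed
  have qtZ: "qt p (qt r Z) = ?A * ?A"
  proof -
    have "qt r Z = ?B * qt r ?C * (?A * ?B)"
    proof -
      have "free r ?B" "free r (?A * ?B)" using ne by (auto simp: free_op2)
      then have "qt r (?B * (?C * (?A * ?B))) = ?B * (qt r ?C * (?A * ?B))"
        by (simp only: qt_mult_left qt_mult_right)
      then show ?thesis by (simp add: Z_def mult.assoc)
    qed
    also have "\<dots> = ?A * ?B * ?A"
      using ne braid_F[of s t p] by (simp add: qt_F mult.assoc)
    also have "qt p \<dots> = ?A * qt p ?B * ?A"
      using ne by (simp add: qt_mult_right qt_mult_left mult.assoc free_op2)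
    finally show ?thesis using ne by (simp add: qt_F)
  qed
  \<comment> \<open>For partial traces of \<open>Z\<close> times a matrix in the auxiliary factors, both sides can be computed:
      \<open>R\<close> and its double twist slide through \<open>Z\<close> into the factors \<open>s, t\<close>, and \<open>Z\<close> itself has quantum
      trace \<open>F\<^sup>2\<close>.\<close>
  have base: "P (ptr s (ptr t (Z * (u s j i * u t j' i'))))" for j i j' i'
  proof -
    define y where "y = u s j i * u t j' i'"
    have fy: "free p y" "free r y" using ne by (auto simp: y_def free_u)
    have fst: "free s (op2 p r X)" "free t (op2 p r X)" "free p (op2 s t X)" "free r (op2 s t X)" for X
      using ne by (auto simp: free_op2)
    have *: "qt p (qt r (ptr s (ptr t X))) = ptr s (ptr t (qt p (qt r X)))" for X
      using ne by (simp add: ptr_qt_commute)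
    have "qt p (qt r (op2 p r R * ptr s (ptr t (Z * y)))) = ptr s (ptr t (qt p (qt r (op2 p r R * Z * y))))"
      using fst by (simp add: ptr_mult_left mult.assoc flip: *)
    also have "qt p (qt r (op2 p r R * Z * y)) = qt p (qt r (Z * (op2 s t R * y)))"
      by (simp add: RZ mult.assoc)
    also have "\<dots> = qt p (qt r Z) * (op2 s t R * y)"
    proof -
      have "free p (op2 s t R * y)" "free r (op2 s t R * y)" using fy fst by auto
      then show ?thesis by (simp add: qt_mult_right)
    qed
    also have "\<dots> = ?A * ?A * op2 s t R * y"
      by (simp add: qtZ mult.assoc)
    finally have 1: "qt p (qt r (op2 p r R * ptr s (ptr t (Z * y)))) = ptr s (ptr t (?A * ?A * op2 s t R * y))" .
    have "qt p (qt r (ptr s (ptr t (Z * y)) * op2 p r R')) = ptr s (ptr t (qt p (qt r (Z * y * op2 p r R'))))"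
      using fst by (simp add: ptr_mult_right flip: *)
    also have "Z * y * op2 p r R' = op2 s t R' * (Z * y)"
      using op2_commute[OF fy, of R'] by (simp add: mult.assoc) (simp add: R'Z flip: mult.assoc)
    also have "qt p (qt r \<dots>) = op2 s t R' * (qt p (qt r Z) * y)"
      using fst fy by (simp add: qt_mult_left qt_mult_right)
    also have "\<dots> = ?A * ?A * op2 s t R * y"
      using ne by (simp add: R'_st mult.assoc qtZ Fi_F_left)
    finally show ?thesis
      using 1 by (simp add: P_def y_def)
  qed
  \<comment> \<open>The four factors \<open>F\<close> of \<open>Z\<close> are removed one at a time by skew invertibility, until an arbitrary
      product of matrix units in the factors \<open>p, r\<close> is left.\<close>
  have step1: "P (ptr t (?B * ?C * u t b d * ?B * u t j i))" for b d j i
  proof (rule skew_span[of P "\<lambda>b d. ptr t (?B * ?C * u t b d * ?B * u t j i)", OF P0 P_add P_scale])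
    fix a c
    have "ptr s (ptr t (Z * (u s c a * u t j i))) = ptr t (ptr s (?B * ?C * (?A * u s c a) * (?B * u t j i)))"
    proof -
      have "?B * u s c a = u s c a * ?B"
        using ne by (intro op2_commute[symmetric] free_u) auto
      then have "Z * (u s c a * u t j i) = ?B * ?C * (?A * u s c a) * (?B * u t j i)"
        by (simp add: Z_def mult.assoc) (simp flip: mult.assoc)
      then show ?thesis using ne by (simp add: ptr_commute)
    qed
    also have "\<dots> = ptr t (?B * ?C * ptr s (?A * u s c a) * (?B * u t j i))"
    proof -
      have "free s (?B * ?C)" "free s (?B * u t j i)" using ne by (auto simp: free_op2 free_u)
      then show ?thesis by (simp add: ptr_mult_left ptr_mult_right)
    qed
    also have "\<dots> = (\<Sum>b\<in>UNIV. \<Sum>d\<in>UNIV. F $ (a,b) $ (c,d) *\<^sub>C ptr t (?B * ?C * u t b d * ?B * u t j i))"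
      using ne by (simp add: ptr_op2_u sum_distrib_left sum_distrib_right ptr_sum ptr_scaleC 
          mult_scaleC_left mult_scaleC_right mult.assoc)
    finally show "P (\<Sum>b\<in>UNIV. \<Sum>d\<in>UNIV. F $ (a,b) $ (c,d) *\<^sub>C ptr t (?B * ?C * u t b d * ?B * u t j i))"
      using base[of c a j i] by (simp only:)
  qed
  have step2: "P (u p b d * ?C * ptr t (u t j a * ?B))" for b d j a
  proof (rule skew_span[of P "\<lambda>b d. u p b d * ?C * ptr t (u t j a * ?B)", OF P0 P_add P_scale])
    fix i c
    have w: "ptr t (u t j a * u p b d * (?C * ?B)) = u p b d * ?C * ptr t (u t j a * ?B)" for b d
    proof -
      have f: "free t (u p b d * ?C)" using ne by (auto simp: free_op2 free_u)
      have "u t j a * u p b d * (?C * ?B) = u p b d * ?C * (u t j a * ?B)"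
        using free_uD[OF f, of j a] by (simp add: mult.assoc) (simp flip: mult.assoc)
      then show ?thesis using f by (simp add: ptr_mult_left)
    qed
    have "ptr t (?B * ?C * u t c a * ?B * u t j i) = ptr t (u t j i * ?B * (?C * u t c a) * ?B)"
      by (subst ptr_cyc_u[symmetric]) (simp add: mult.assoc)
    also have "?C * u t c a = u t c a * ?C"
      using ne op2_commute[of p "u t c a" r F] by (simp add: free_u)
    also have "ptr t (u t j i * ?B * (u t c a * ?C) * ?B) = ptr t ((u t j i * ?B * u t c a) * (?C * ?B))"
      by (simp add: mult.assoc)
    also have "\<dots> = (\<Sum>b\<in>UNIV. \<Sum>d\<in>UNIV. F $ (i,b) $ (c,d) *\<^sub>C (u p b d * ?C * ptr t (u t j a * ?B)))"
      using ne by (simp add: u_op2_u sum_distrib_right ptr_sum ptr_scaleC mult_scaleC_left flip: w)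
    finally show "P (\<Sum>b\<in>UNIV. \<Sum>d\<in>UNIV. F $ (i,b) $ (c,d) *\<^sub>C (u p b d * ?C * ptr t (u t j a * ?B)))"
      using step1[of c a j i] by (simp only:)
  qed
  have step3: "P (u p b' d' * ?C * u p b d)" for b' d' b d
  proof (rule skew_span[of P "\<lambda>b d. u p b' d' * ?C * u p b d", OF P0 P_add P_scale])
    fix a c
    have "u p b' d' * ?C * ptr t (u t c a * ?B)
       = (\<Sum>b\<in>UNIV. \<Sum>d\<in>UNIV. F $ (a,b) $ (c,d) *\<^sub>C (u p b' d' * ?C * u p b d))"
      using ne by (simp add: ptr_cyc_u ptr_op2_u sum_distrib_left mult_scaleC_right)
    then show "P \<dots>"
      using step2 by metis
  qed
  have "P (u p a c * u r b d)"
  proof (rule skew_span[of P "\<lambda>b d. u p a c * u r b d", OF P0 P_add P_scale])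
    fix i e
    have "u p a i * ?C * u p e c = (\<Sum>b\<in>UNIV. \<Sum>d\<in>UNIV. F $ (i,b) $ (e,d) *\<^sub>C (u p a c * u r b d))"
      using pr by (rule u_op2_u)
    then show "P \<dots>"
      using step3 by metis
  qed
  then show ?thesis by (simp add: P_def R'_def)
qed

lemma qt_cyc:
  assumes pr: "p \<noteq> r"
  shows "qt p (qt r (X * op2 p r (twist F (twist F R)))) = qt p (qt r (op2 p r R * X))"
proof -
  let ?c = "\<lambda>a c b d. coeff r b d (coeff p a c X)"
  have fr: "free p (?c a c b d)" "free r (?c a c b d)" for a c b d by auto
  have X: "X = (\<Sum>a\<in>UNIV. \<Sum>c\<in>UNIV. \<Sum>b\<in>UNIV. \<Sum>d\<in>UNIV. u p a c * u r b d * ?c a c b d)"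
    by (subst expand_u[of X p], subst expand_u[of "coeff p _ _ X" r])
      (simp add: sum_distrib_left mult.assoc)
  have *: "qt p (qt r (u p a c * u r b d * ?c a c b d * op2 p r (twist F (twist F R))))
      = qt p (qt r (op2 p r R * (u p a c * u r b d * ?c a c b d)))" for a c b d
  proof -
    have "u p a c * u r b d * ?c a c b d * op2 p r (twist F (twist F R))
      = u p a c * u r b d * op2 p r (twist F (twist F R)) * ?c a c b d"
      using op2_commute[OF fr] by (simp add: mult.assoc)
    then have "qt p (qt r (u p a c * u r b d * ?c a c b d * op2 p r (twist F (twist F R))))
      = qt p (qt r (u p a c * u r b d * op2 p r (twist F (twist F R)))) * ?c a c b d"
      using fr by (simp add: qt_mult_right)
    also have "\<dots> = qt p (qt r (op2 p r R * (u p a c * u r b d) * ?c a c b d))"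
      using fr by (simp add: qt_mult_right qt_cyc_u[OF pr])
    finally show ?thesis by (simp add: mult.assoc)
  qed
  show ?thesis
    by (subst (1 2) X) (simp only: sum_distrib_left sum_distrib_right qt_sum *)
qed

end

section \<open>Antisymmetrizers in a Hecke algebra\<close>

lemma qnum_0 [simp]: "qnum q 0 = 0" and qnum_1 [simp]: "qnum q (Suc 0) = 1"
  by (simp_all add: qnum_def)

lemma qnum_Suc: 
  assumes "q \<noteq> 0"
  shows "qnum q (Suc k) = q ^ k + inverse q * qnum q k"
proof -
  have "q powi (int (Suc k) - 1 - 2 * int (Suc j)) = inverse q * q powi (int k - 1 - 2 * int j)" for j
  proof -
    have "int (Suc k) - 1 - 2 * int (Suc j) = -1 + (int k - 1 - 2 * int j)" by simp
    then have "q powi (int (Suc k) - 1 - 2 * int (Suc j)) = q powi (-1) * q powi (int k - 1 - 2 * int j)"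
      using assms by (simp only: power_int_add simp_thms)
    then show ?thesis by (simp only: power_int_minus power_int_1_right)
  qed
  then have "qnum q (Suc k) = q powi int k + (\<Sum>j<k. inverse q * q powi (int k - 1 - 2 * int j))"
    unfolding qnum_def by (subst sum.lessThan_Suc_shift) simp
  then show ?thesis by (simp add: qnum_def sum_distrib_left)
qed

lemma qnum_uminus_inverse: "qnum (- inverse q) k = (-1) ^ (k - 1) * qnum q k"
proof -
  have "(- inverse q) powi (int k - 1 - 2 * int (k - Suc j)) = (-1) ^ (k - 1) * q powi (int k - 1 - 2 * int j)"
    if "j < k" for j
  proof -
    have e: "int k - 1 - 2 * int (k - Suc j) = - (int k - 1 - 2 * int j)"
      using that by (simp add: of_nat_diff)
    have "- inverse q = inverse (- q)" by simp
    then have "(- inverse q) powi (int k - 1 - 2 * int (k - Suc j)) = (- q) powi (int k - 1 - 2 * int j)"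
      unfolding e by (simp only: power_int_inverse power_int_minus inverse_inverse_eq)
    also have "\<dots> = (-1) powi (int k - 1 - 2 * int j) * q powi (int k - 1 - 2 * int j)"
      by (subst power_int_mult_distrib[symmetric]) simp
    also have "(-1::complex) powi (int k - 1 - 2 * int j) = (-1) powi (int (k - 1))"
      using that by (simp add: power_int_minus_left of_nat_diff)
    finally show ?thesis by simp
  qed
  then have "(\<Sum>j<k. (- inverse q) powi (int k - 1 - 2 * int (k - Suc j))) = (-1) ^ (k - 1) * qnum q k"
    by (simp add: qnum_def sum_distrib_left)
  then show ?thesis
    unfolding qnum_def[of "- inverse q"]
    using sum.nat_diff_reindex[of "\<lambda>j. (- inverse q) powi (int k - 1 - 2 * int j)" k] by simp
qed

text \<open>
  \<open>r 0, \<dots>, r (N - 1)\<close> satisfy the relations of the Hecke algebra on \<open>N + 1\<close> strands.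
\<close>

definition hecke_gens :: "complex \<Rightarrow> (nat \<Rightarrow> 'b::complex_algebra_1) \<Rightarrow> nat \<Rightarrow> bool" where
  "hecke_gens q r N \<longleftrightarrow> q \<noteq> 0 \<and> (\<forall>p<N. r p * r p = 1 + (q - inverse q) *\<^sub>C r p)
    \<and> (\<forall>p. Suc p < N \<longrightarrow> r p * r (Suc p) * r p = r (Suc p) * r p * r (Suc p))
    \<and> (\<forall>p t. t < N \<longrightarrow> p + 2 \<le> t \<longrightarrow> r p * r t = r t * r p)"

text \<open>
  The antisymmetrizer on \<open>k\<close> strands, made of the generators \<open>r 0, \<dots>, r (k - 2)\<close> by the recursion at the
  last strand.
\<close>

fun antisym_of :: "complex \<Rightarrow> (nat \<Rightarrow> 'b::complex_algebra_1) \<Rightarrow> nat \<Rightarrow> 'b" where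
  "antisym_of q r 0 = 1"
| "antisym_of q r (Suc 0) = 1"
| "antisym_of q r (Suc (Suc k)) = (1 / qnum q (k + 2)) *\<^sub>C
     (antisym_of q r (k + 1) * (q ^ (k + 1) *\<^sub>C 1 - qnum q (k + 1) *\<^sub>C r k) * antisym_of q r (k + 1))"

lemma antisym_of_cong: "(\<And>p. p + 1 < k \<Longrightarrow> r p = r' p) \<Longrightarrow> antisym_of q r k = antisym_of q r' k"
  by (induction q r k rule: antisym_of.induct) auto

lemma commute_mult: "x * a = a * x \<Longrightarrow> x * b = b * x \<Longrightarrow> x * (a * b) = a * b * (x :: 'a::semigroup_mult)"
  by (metis mult.assoc)

lemma commute_antisym_of:
  "(\<And>p. p + 1 < k \<Longrightarrow> x * r p = r p * x) \<Longrightarrow> x * antisym_of q r k = antisym_of q r k * x"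
proof (induction q r k rule: antisym_of.induct)
  case (3 q r k)
  let ?A = "antisym_of q r (k + 1)" and ?y = "q ^ (k + 1) *\<^sub>C 1 - qnum q (k + 1) *\<^sub>C r k"
  have A: "x * ?A = ?A * x" using 3 by auto
  have "x * r k = r k * x" using 3(3) by auto
  then have y: "x * ?y = ?y * x"
    by (simp add: algebra_simps mult_scaleC_left mult_scaleC_right)
  have "x * (?A * ?y * ?A) = ?A * ?y * ?A * x"
    using A y commute_mult by blast
  then show ?case by (simp add: mult_scaleC_left mult_scaleC_right)
qed auto

text \<open>
  The inductive step for the eigenvalue property: here \<open>b\<close> is the antisymmetrizer on \<open>k\<close> strands, \<open>c\<close> the
  one on \<open>k - 1\<close> strands, \<open>r'\<close> and \<open>r\<close> are the last generator of \<open>b\<close> and the new one, and \<open>K = [k]\<close>, \<open>K' = [k - 1]\<close>,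
  \<open>\<alpha> = q\<^sup>k\<^sup>-\<^sup>1\<close>.
\<close>

lemma antisym_fusion:
  fixes b c r r' :: "'b::complex_algebra_1"
  assumes q: "q \<noteq> 0" and K: "K = \<alpha> + inverse q * K'"
    and cc: "c * c = c" and cr: "c * r = r * c"
    and b: "b = (1 / K) *\<^sub>C (c * (\<alpha> *\<^sub>C 1 - K' *\<^sub>C r') * c)"
    and bb: "b * b = b"
    and r'b: "r' * b = - inverse q *\<^sub>C b" and br': "b * r' = - inverse q *\<^sub>C b"
    and braid: "r' * r * r' = r * r' * r"
    and hecke: "r * r = 1 + (q - inverse q) *\<^sub>C r"
  shows "r * (b * ((q * \<alpha>) *\<^sub>C 1 - K *\<^sub>C r) * b) = - inverse q *\<^sub>C (b * ((q * \<alpha>) *\<^sub>C 1 - K *\<^sub>C r) * b)"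
    and "(b * ((q * \<alpha>) *\<^sub>C 1 - K *\<^sub>C r) * b) * r = - inverse q *\<^sub>C (b * ((q * \<alpha>) *\<^sub>C 1 - K *\<^sub>C r) * b)"
proof -
  \<comment> \<open>The claims are \<open>x (b y b) = 0\<close> and \<open>(b y b) x = 0\<close>.  One copy of \<open>b\<close> is expanded into \<open>c z c\<close>; since \<open>c\<close>
      commutes with \<open>x\<close> and \<open>y\<close>, only \<open>x z y b\<close> (or \<open>b y z x\<close>) has to vanish.\<close>
  define x where "x = inverse q *\<^sub>C 1 + r"
  define y where "y = (q * \<alpha>) *\<^sub>C 1 - K *\<^sub>C r"
  define z where "z = \<alpha> *\<^sub>C 1 - K' *\<^sub>C r'"
  have zero: "\<alpha> * (q * \<alpha>) + \<alpha> * K' - \<alpha> * K * q = 0"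
    using q by (simp add: K field_simps)
  have xr: "x * r = q *\<^sub>C x" and rx: "r * x = q *\<^sub>C x"
    using q by (simp_all add: x_def distrib_left distrib_right mult_scaleC_left mult_scaleC_right hecke
        scaleC_scaleC scaleC.scale_right_distrib scaleC.scale_left_diff_distrib scaleC_one)
  have cx: "c * x = x * c" and cy: "c * y = y * c"
    by (simp_all add: x_def y_def distrib_left distrib_right left_diff_distrib right_diff_distrib
        mult_scaleC_left mult_scaleC_right cr)
  have left_comm: "x * (c * w) = c * (x * w)" "c * (y * w) = y * (c * w)" for w
    by (simp_all add: cx cy flip: mult.assoc)
  have cb: "c * b = b" and bc: "b * c = b"
    by (simp_all add: b mult_scaleC_left mult_scaleC_right cc mult.assoc) (simp add: cc flip: mult.assoc)
  have bz: "b = (1 / K) *\<^sub>C (c * z * c)" by (simp add: b z_def)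
  have left: "x * (r' * (r * b)) = 0"
  proof -
    have "r * (r' * (r * b)) = r' * (r * (r' * b))"
      by (simp flip: mult.assoc add: braid)
    then show ?thesis
      by (simp add: x_def distrib_right mult_scaleC_left mult_scaleC_right r'b)
  qed
  have right: "b * r * r' * x = 0"
  proof -
    have "b * r * r' * r = b * r' * r * r'"
      using braid by (simp add: mult.assoc)
    then show ?thesis
      by (simp add: x_def distrib_left mult_scaleC_left mult_scaleC_right br')
  qed
  have "x * (z * (y * b)) = (\<alpha> * (q * \<alpha>) + \<alpha> * K' - \<alpha> * K * q) *\<^sub>C (x * b) + (K' * K) *\<^sub>C (x * (r' * (r * b)))"
  proof -
    have yb: "y * b = (q * \<alpha>) *\<^sub>C b - K *\<^sub>C (r * b)"
      by (simp add: y_def left_diff_distrib mult_scaleC_left)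
    have xrb: "x * (r * b) = q *\<^sub>C (x * b)"
      by (simp add: xr mult_scaleC_left flip: mult.assoc)
    have "z * (y * b) = (\<alpha> * (q * \<alpha>) + \<alpha> * K') *\<^sub>C b - (\<alpha> * K) *\<^sub>C (r * b) + (K' * K) *\<^sub>C (r' * (r * b))"
    proof -
      have "r' * (y * b) = - (\<alpha> *\<^sub>C b) - K *\<^sub>C (r' * (r * b))"
        using q by (simp add: yb right_diff_distrib mult_scaleC_right r'b scaleC_scaleC)
      then show ?thesis
        by (simp add: z_def left_diff_distrib mult_scaleC_left)
          (simp add: yb scaleC_scaleC scaleC.scale_right_diff_distrib scaleC.scale_left_distrib mult.commute)
    qed
    then show ?thesis
      by (simp add: right_diff_distrib distrib_left mult_scaleC_right xrb scaleC_scaleC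
          scaleC.scale_left_diff_distrib)
  qed
  then have xzy: "x * (z * (y * b)) = 0" by (simp only: zero left) simp
  have "x * (b * y * b) = (1 / K) *\<^sub>C (c * (x * (z * (y * b))))"
  proof -
    have "x * (c * z * c * y * b) = c * (x * (z * (y * (c * b))))"
      by (simp add: mult.assoc left_comm)
    then show ?thesis
      by (subst (1) bz) (simp add: mult_scaleC_left mult_scaleC_right mult.assoc cb)
  qed
  then have "x * (b * y * b) = 0" by (simp add: xzy)
  then show "r * (b * y * b) = - inverse q *\<^sub>C (b * y * b)" 
    by (simp add: x_def distrib_right mult_scaleC_left add_eq_0_iff)
  have "b * y * z * x = (\<alpha> * (q * \<alpha>) + \<alpha> * K' - \<alpha> * K * q) *\<^sub>C (b * x) + (K' * K) *\<^sub>C (b * r * r' * x)"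
  proof -
    have by': "b * y = (q * \<alpha>) *\<^sub>C b - K *\<^sub>C (b * r)"
      by (simp add: y_def right_diff_distrib mult_scaleC_right)
    have brx: "b * r * x = q *\<^sub>C (b * x)"
      by (simp add: rx mult_scaleC_right mult.assoc)
    have "b * y * z = (\<alpha> * (q * \<alpha>) + \<alpha> * K') *\<^sub>C b - (\<alpha> * K) *\<^sub>C (b * r) + (K' * K) *\<^sub>C (b * r * r')"
    proof -
      have "b * y * r' = - (\<alpha> *\<^sub>C b) - K *\<^sub>C (b * r * r')"
        using q by (simp add: by' left_diff_distrib mult_scaleC_left br' scaleC_scaleC)
      then show ?thesis
        by (simp add: z_def right_diff_distrib mult_scaleC_right)
          (simp add: by' scaleC_scaleC scaleC.scale_right_diff_distrib scaleC.scale_left_distrib mult.commute)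
    qed
    then show ?thesis
      by (simp add: left_diff_distrib distrib_right mult_scaleC_left brx scaleC_scaleC
          scaleC.scale_left_diff_distrib)
  qed
  then have yzx: "b * y * z * x = 0" by (simp only: zero right) simp
  have "(b * y * b) * x = (1 / K) *\<^sub>C (b * y * z * x * c)"
  proof -
    have "b * y * (c * z * c) * x = b * c * y * z * x * c"
      by (simp add: mult.assoc cx) (simp add: left_comm(2)[symmetric])
    then show ?thesis
      by (subst (2) bz) (simp add: mult_scaleC_left mult_scaleC_right bc)
  qed
  then have "(b * y * b) * x = 0" by (simp add: yzx)
  then show "(b * y * b) * r = - inverse q *\<^sub>C (b * y * b)" 
    by (simp add: x_def distrib_left mult_scaleC_right add_eq_0_iff)
qed

lemma absorb_antisym_of_right:
  assumes "q \<noteq> 0" "\<And>m. m \<ge> 1 \<Longrightarrow> qnum q m \<noteq> 0"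
    and "\<And>p. p + 1 < k \<Longrightarrow> a * r p = - inverse q *\<^sub>C a"
  shows "a * antisym_of q r k = a"
  using assms
proof (induction q r k rule: antisym_of.induct)
  case (3 q r k)
  let ?A = "antisym_of q r (k + 1)"
  have "a * ?A = a" using 3 by auto
  moreover have "a * r k = - inverse q *\<^sub>C a" using 3 by auto
  moreover have "q ^ (k + 1) + qnum q (k + 1) * inverse q = qnum q (k + 2)"
    using qnum_Suc[of q "k + 1"] 3(3) by simp
  ultimately have "a * (?A * (q ^ (k + 1) *\<^sub>C 1 - qnum q (k + 1) *\<^sub>C r k)) = qnum q (k + 2) *\<^sub>C a"
    by (simp add: right_diff_distrib mult_scaleC_right scaleC_scaleC scaleC.scale_left_distrib flip: mult.assoc)
      (simp flip: scaleC.scale_left_distrib)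
  then have "a * (?A * (q ^ (k + 1) *\<^sub>C 1 - qnum q (k + 1) *\<^sub>C r k) * ?A) = qnum q (k + 2) *\<^sub>C a"
    using \<open>a * ?A = a\<close> by (simp add: mult_scaleC_left flip: mult.assoc)
  then show ?case
    using 3(4)[of "k + 2"] by (simp add: mult_scaleC_right scaleC_scaleC scaleC_one)
qed auto

lemma absorb_antisym_of_left:
  assumes "q \<noteq> 0" "\<And>m. m \<ge> 1 \<Longrightarrow> qnum q m \<noteq> 0"
    and "\<And>p. p + 1 < k \<Longrightarrow> r p * a = - inverse q *\<^sub>C a"
  shows "antisym_of q r k * a = a"
  using assms
proof (induction q r k rule: antisym_of.induct)
  case (3 q r k)
  let ?A = "antisym_of q r (k + 1)"
  have "?A * a = a" using 3 by auto
  moreover have "r k * a = - inverse q *\<^sub>C a" using 3 by auto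
  moreover have "q ^ (k + 1) + qnum q (k + 1) * inverse q = qnum q (k + 2)"
    using qnum_Suc[of q "k + 1"] 3(3) by simp
  ultimately have "(q ^ (k + 1) *\<^sub>C 1 - qnum q (k + 1) *\<^sub>C r k) * (?A * a) = qnum q (k + 2) *\<^sub>C a"
    by (simp add: left_diff_distrib mult_scaleC_left scaleC_scaleC) (simp flip: scaleC.scale_left_distrib)
  then have "?A * (q ^ (k + 1) *\<^sub>C 1 - qnum q (k + 1) *\<^sub>C r k) * ?A * a = qnum q (k + 2) *\<^sub>C a"
    using \<open>?A * a = a\<close> by (simp add: mult_scaleC_right mult.assoc)
  then show ?case
    using 3(4)[of "k + 2"] by (simp add: mult_scaleC_left scaleC_scaleC scaleC_one)
qed auto

lemma antisym_of_eigen: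
  assumes "hecke_gens q r N" "\<And>m. m \<ge> 1 \<Longrightarrow> qnum q m \<noteq> 0" "k \<le> N + 1"
  shows "p + 1 < k \<Longrightarrow> r p * antisym_of q r k = - inverse q *\<^sub>C antisym_of q r k"
    and "p + 1 < k \<Longrightarrow> antisym_of q r k * r p = - inverse q *\<^sub>C antisym_of q r k"
proof -
  have q: "q \<noteq> 0" 
    and hecke: "p < N \<Longrightarrow> r p * r p = 1 + (q - inverse q) *\<^sub>C r p"
    and braid: "Suc p < N \<Longrightarrow> r p * r (Suc p) * r p = r (Suc p) * r p * r (Suc p)"
    and far: "t < N \<Longrightarrow> p + 2 \<le> t \<Longrightarrow> r p * r t = r t * r p" for p t
    using assms(1) by (auto simp: hecke_gens_def)
  have "\<forall>p. p + 1 < k \<longrightarrow> r p * antisym_of q r k = - inverse q *\<^sub>C antisym_of q r k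
      \<and> antisym_of q r k * r p = - inverse q *\<^sub>C antisym_of q r k"
    using assms(3)
  proof (induction k rule: less_induct)
    case (less k)
    have "k \<le> 1 \<or> k = 2 \<or> (\<exists>m. k = m + 3)"
      by presburger
    then consider "k \<le> 1" | "k = 2" | m where "k = m + 3"
      by blast
    then show ?case
    proof cases
      case 1
      then show ?thesis by auto
    next
      case 2
      have "N > 0" using 2 less.prems by simp
      have "qnum q 2 = q + inverse q"
        using qnum_Suc[OF q, of 1] by (simp add: numeral_2_eq_2)
      have A: "antisym_of q r 2 = (1 / qnum q 2) *\<^sub>C (q *\<^sub>C 1 - r 0)"
        by (simp add: numeral_2_eq_2 scaleC_one)
      have "r 0 * (q *\<^sub>C 1 - r 0) = - inverse q *\<^sub>C (q *\<^sub>C 1 - r 0)" "(q *\<^sub>C 1 - r 0) * r 0 = - inverse q *\<^sub>C (q *\<^sub>C 1 - r 0)"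
        using q hecke[OF \<open>N > 0\<close>]
        by (simp_all add: left_diff_distrib right_diff_distrib mult_scaleC_left mult_scaleC_right scaleC_scaleC
           scaleC.scale_left_diff_distrib scaleC.scale_right_diff_distrib scaleC_one)
      then show ?thesis
        unfolding 2 A by (auto simp: mult_scaleC_left mult_scaleC_right scaleC_scaleC mult.commute)
    next
      case 3
      let ?b = "antisym_of q r (m + 2)" and ?c = "antisym_of q r (m + 1)"
      let ?y = "(q * q ^ (m + 1)) *\<^sub>C 1 - qnum q (m + 2) *\<^sub>C r (m + 1)"
      have IHb: "r p * ?b = - inverse q *\<^sub>C ?b" "?b * r p = - inverse q *\<^sub>C ?b" if "p \<le> m" for p
        using less.IH[of "m + 2"] less.prems that 3 by auto
      have IHc: "r p * ?c = - inverse q *\<^sub>C ?c" "?c * r p = - inverse q *\<^sub>C ?c" if "p < m" for p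
        using less.IH[of "m + 1"] less.prems that 3 by auto
      have bb: "?b * ?b = ?b"
        by (rule absorb_antisym_of_right[OF q assms(2)], assumption, rule IHb(2), simp)
      have cc: "?c * ?c = ?c"
        by (rule absorb_antisym_of_right[OF q assms(2)], assumption, rule IHc(2), simp)
      have cr: "?c * r (m + 1) = r (m + 1) * ?c"
        by (rule commute_antisym_of[symmetric]) (use far[of "m + 1"] less.prems 3 in auto)
      note fusion = antisym_fusion[where q = q and \<alpha> = "q ^ (m + 1)" and K = "qnum q (m + 2)" and K' = "qnum q (m + 1)"
          and b = ?b and c = ?c and r = "r (m + 1)" and r' = "r m"]
      have b: "?b = (1 / qnum q (m + 2)) *\<^sub>C (?c * (q ^ (m + 1) *\<^sub>C 1 - qnum q (m + 1) *\<^sub>C r m) * ?c)"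
        by (simp add: numeral_2_eq_2)
      have K: "qnum q (m + 2) = q ^ (m + 1) + inverse q * qnum q (m + 1)"
        using qnum_Suc[OF q, of "m + 1"] by simp
      have A: "antisym_of q r k = (1 / qnum q (m + 3)) *\<^sub>C (?b * ?y * ?b)"
        using 3 by (simp add: numeral_3_eq_3)
      have f: "r (m + 1) * (?b * ?y * ?b) = - inverse q *\<^sub>C (?b * ?y * ?b)"
        "(?b * ?y * ?b) * r (m + 1) = - inverse q *\<^sub>C (?b * ?y * ?b)"
        using fusion[OF q K cc cr b bb IHb(1)[OF order.refl] IHb(2)[OF order.refl]] braid[of m] hecke[of "m + 1"] less.prems 3
        by simp_all
      have g: "r p * (?b * ?y * ?b) = - inverse q *\<^sub>C (?b * ?y * ?b)"
        "(?b * ?y * ?b) * r p = - inverse q *\<^sub>C (?b * ?y * ?b)" if "p \<le> m" for p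
      proof -
        have "r p * (?b * ?y * ?b) = (r p * ?b) * ?y * ?b" by (simp only: mult.assoc)
        then show "r p * (?b * ?y * ?b) = - inverse q *\<^sub>C (?b * ?y * ?b)"
          by (simp only: IHb[OF that] mult_scaleC_left mult.assoc)
        have "(?b * ?y * ?b) * r p = ?b * ?y * (?b * r p)" by (simp only: mult.assoc)
        then show "(?b * ?y * ?b) * r p = - inverse q *\<^sub>C (?b * ?y * ?b)"
          by (simp only: IHb[OF that] mult_scaleC_right mult.assoc)
      qed
      have "r p * (?b * ?y * ?b) = - inverse q *\<^sub>C (?b * ?y * ?b) \<and>
        (?b * ?y * ?b) * r p = - inverse q *\<^sub>C (?b * ?y * ?b)" if "p + 1 < k" for p
        using f g[of p] that 3 by (cases "p = m + 1") auto
      then show ?thesis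
        unfolding A by (auto simp only: mult_scaleC_left mult_scaleC_right scaleC_scaleC mult.commute)
    qed
  qed
  then show "p + 1 < k \<Longrightarrow> r p * antisym_of q r k = - inverse q *\<^sub>C antisym_of q r k"
    and "p + 1 < k \<Longrightarrow> antisym_of q r k * r p = - inverse q *\<^sub>C antisym_of q r k"
    by auto
qed

lemma antisym_of_idem:
  assumes "hecke_gens q r N" "\<And>m. m \<ge> 1 \<Longrightarrow> qnum q m \<noteq> 0" "k \<le> N + 1"
  shows "antisym_of q r k * antisym_of q r k = antisym_of q r k"
  by (rule absorb_antisym_of_right) (use assms antisym_of_eigen[OF assms] in \<open>auto simp: hecke_gens_def\<close>)

lemma hecke_gens_rev:
  assumes "hecke_gens q r N"
  shows "hecke_gens q (\<lambda>p. r (N - 1 - p)) N"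
  unfolding hecke_gens_def
proof (intro conjI allI impI)
  show "q \<noteq> 0" using assms by (simp add: hecke_gens_def)
  fix p assume "p < N"
  then show "r (N - 1 - p) * r (N - 1 - p) = 1 + (q - inverse q) *\<^sub>C r (N - 1 - p)"
    using assms by (auto simp: hecke_gens_def)
next
  fix p assume "Suc p < N"
  then have "N - 1 - p = Suc (N - 1 - Suc p)" "Suc (N - 1 - Suc p) < N" by auto
  then show "r (N - 1 - p) * r (N - 1 - Suc p) * r (N - 1 - p) = r (N - 1 - Suc p) * r (N - 1 - p) * r (N - 1 - Suc p)"
    using assms unfolding hecke_gens_def by metis
next
  fix p t assume "t < N" "p + 2 \<le> t"
  then have "(N - 1 - t) + 2 \<le> N - 1 - p" "N - 1 - p < N" by auto
  then show "r (N - 1 - p) * r (N - 1 - t) = r (N - 1 - t) * r (N - 1 - p)"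
    using assms unfolding hecke_gens_def by metis
qed

text \<open>
  Reversing the order of the strands does not change the antisymmetrizer: each of the two elements
  absorbs the other.
\<close>

lemma antisym_of_rev:
  assumes h: "hecke_gens q r N" and qn: "\<And>m. m \<ge> 1 \<Longrightarrow> qnum q m \<noteq> 0"
  shows "antisym_of q (\<lambda>p. r (N - 1 - p)) (N + 1) = antisym_of q r (N + 1)"
proof -
  let ?a = "antisym_of q r (N + 1)" and ?a' = "antisym_of q (\<lambda>p. r (N - 1 - p)) (N + 1)"
  have q: "q \<noteq> 0" using h by (simp add: hecke_gens_def)
  have "?a' * ?a = ?a"
  proof (rule absorb_antisym_of_left[OF q qn])
    fix p assume "p + 1 < N + 1"
    then show "r (N - 1 - p) * ?a = - inverse q *\<^sub>C ?a"
      using antisym_of_eigen(1)[OF h qn order.refl, of "N - 1 - p"] by simp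
  qed
  moreover have "?a' * ?a = ?a'"
  proof (rule absorb_antisym_of_right[OF q qn])
    fix p assume "p + 1 < N + 1"
    then have "N - 1 - (N - 1 - p) = p" "N - 1 - p + 1 < N + 1" by auto
    then show "?a' * r p = - inverse q *\<^sub>C ?a'"
      using antisym_of_eigen(2)[OF hecke_gens_rev[OF h] qn order.refl, of "N - 1 - p"] by simp
  qed
  ultimately show ?thesis by simp
qed

lemma hecke_gens_Suc: 
  assumes "hecke_gens q r (Suc N)"
  shows "hecke_gens q (\<lambda>p. r (Suc p)) N"
  unfolding hecke_gens_def
proof (intro conjI allI impI)
  fix p t assume "t < N" "p + 2 \<le> t"
  then have "Suc t < Suc N" "Suc p + 2 \<le> Suc t" by auto
  then show "r (Suc p) * r (Suc t) = r (Suc t) * r (Suc p)"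
    using assms unfolding hecke_gens_def by metis
qed (use assms in \<open>auto simp: hecke_gens_def\<close>)

text \<open>
  Hence the antisymmetrizer also satisfies the recursion at the first strand.
\<close>

lemma antisym_of_first:
  assumes h: "hecke_gens q r (k + 1)" and qn: "\<And>m. m \<ge> 1 \<Longrightarrow> qnum q m \<noteq> 0"
  shows "antisym_of q r (k + 2) = (1 / qnum q (k + 2)) *\<^sub>C
    (antisym_of q (\<lambda>p. r (Suc p)) (k + 1) * (q ^ (k + 1) *\<^sub>C 1 - qnum q (k + 1) *\<^sub>C r 0)
      * antisym_of q (\<lambda>p. r (Suc p)) (k + 1))"
proof -
  let ?r = "\<lambda>p. r (k - p)"
  have "antisym_of q ?r (k + 1 + 1) = antisym_of q r (k + 1 + 1)"
    using antisym_of_rev[OF h qn] by (simp only: add_diff_cancel_right')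
  then have "antisym_of q r (k + 2) = antisym_of q ?r (k + 2)"
    by (simp only: add.assoc one_add_one)
  moreover have "antisym_of q ?r (k + 1) = antisym_of q (\<lambda>p. r (Suc p)) (k + 1)"
  proof -
    have "antisym_of q ?r (k + 1) = antisym_of q (\<lambda>p. r (Suc (k - 1 - p))) (k + 1)"
      by (rule antisym_of_cong) (simp add: Suc_diff_Suc)
    also have "\<dots> = antisym_of q (\<lambda>p. r (Suc p)) (k + 1)"
      using antisym_of_rev[OF hecke_gens_Suc qn] h by simp
    finally show ?thesis .
  qed
  moreover have "antisym_of q ?r (k + 2) = (1 / qnum q (k + 2)) *\<^sub>C
    (antisym_of q ?r (k + 1) * (q ^ (k + 1) *\<^sub>C 1 - qnum q (k + 1) *\<^sub>C r 0) * antisym_of q ?r (k + 1))"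
    by simp
  ultimately show ?thesis by (simp only:)
qed

section \<open>The quantum matrix algebra\<close>

lemma antisym_of_conj:
  fixes g gi :: "'b::complex_algebra_1"
  assumes "gi * g = 1" "g * gi = 1"
  shows "antisym_of q (\<lambda>p. g * r p * gi) k = g * antisym_of q r k * gi"
proof (induction q r k rule: antisym_of.induct)
  case (3 q r k)
  let ?A = "antisym_of q r (k + 1)" and ?y = "q ^ (k + 1) *\<^sub>C 1 - qnum q (k + 1) *\<^sub>C r k"
  have mult: "(g * x * gi) * (g * y * gi) = g * (x * y) * gi" for x y
  proof -
    have "(g * x * gi) * (g * y * gi) = g * x * (gi * g) * y * gi" by (simp only: mult.assoc)
    then show ?thesis by (simp add: assms mult.assoc)
  qed
  have y: "q ^ (k + 1) *\<^sub>C 1 - qnum q (k + 1) *\<^sub>C (g * r k * gi) = g * ?y * gi"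
    by (simp add: left_diff_distrib right_diff_distrib mult_scaleC_left mult_scaleC_right assms)
  show ?case
    by (simp only: antisym_of.simps 3 y mult mult_scaleC_left mult_scaleC_right)
qed (simp_all add: assms)

context matrix_units
begin

lemma free_antisym_of: "(\<And>p. p + 1 < k \<Longrightarrow> free t (r p)) \<Longrightarrow> free t (antisym_of q r k)"
  unfolding free_def by (intro allI, rule commute_antisym_of[symmetric]) (simp add: free_def)

end

text \<open>
  A matrix \<open>M\<close> acting in the factor 0 whose entries satisfy the relation of the quantum matrix algebra
  modulo a two-sided ideal \<open>J\<close>.  Working modulo \<open>J\<close> avoids the quotient ring.
\<close>

locale quantum_matrix = closed_braiding u R F \<Psi> D
  for u :: "nat \<Rightarrow> 'n::finite \<Rightarrow> 'n \<Rightarrow> 'b::complex_algebra_1" and R F \<Psi> D +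
  fixes q :: complex and M :: 'b and J :: "'b set"
  assumes hecke_R: "Hecke q R"
    and qnum_nonzero: "m \<ge> 1 \<Longrightarrow> qnum q m \<noteq> 0"
    and braid_R: "distinct [p,r,s] \<Longrightarrow>
      op2 p r R * op2 r s R * op2 p r R = op2 r s R * op2 p r R * op2 r s R"
    and free_M: "p \<ge> 1 \<Longrightarrow> free p M"
    and J_0: "0 \<in> J" and J_add: "x \<in> J \<Longrightarrow> y \<in> J \<Longrightarrow> x + y \<in> J"
    and J_left: "x \<in> J \<Longrightarrow> y * x \<in> J" and J_right: "x \<in> J \<Longrightarrow> x * y \<in> J"
    and relation: "op2 0 1 R * M * (op2 0 1 F * M * op2 0 1 (matrix_inv F))
      - M * (op2 0 1 F * M * op2 0 1 (matrix_inv F)) * op2 0 1 (twist F (twist F R)) \<in> J"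
begin

subsection \<open>Congruence modulo the ideal\<close>

definition eqJ :: "'b \<Rightarrow> 'b \<Rightarrow> bool" (infix "\<doteq>" 50) where
  "x \<doteq> y \<longleftrightarrow> x - y \<in> J"

lemma J_uminus: "x \<in> J \<Longrightarrow> - x \<in> J"
  using J_left[of x "- 1"] by simp

lemma J_scaleC: "x \<in> J \<Longrightarrow> c *\<^sub>C x \<in> J"
  using J_left[of x "c *\<^sub>C 1"] by (simp add: mult_scaleC_left)

lemma J_sum: "(\<And>i. i \<in> S \<Longrightarrow> f i \<in> J) \<Longrightarrow> sum f S \<in> J"
  by (induction S rule: infinite_finite_induct) (auto intro: J_0 J_add)

lemma eqJ_refl [simp]: "x \<doteq> x"
  by (simp add: eqJ_def J_0)

lemma eqJ_trans [trans]: "x \<doteq> y \<Longrightarrow> y \<doteq> z \<Longrightarrow> x \<doteq> z"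
  using J_add[of "x - y" "y - z"] by (simp add: eqJ_def)

lemma eqJ_diff: "x \<doteq> y \<Longrightarrow> x' \<doteq> y' \<Longrightarrow> x - x' \<doteq> y - y'"
  using J_add[of "x - y" "- (x' - y')"] J_uminus[of "x' - y'"] by (simp add: eqJ_def algebra_simps)

lemma eqJ_scaleC: "x \<doteq> y \<Longrightarrow> c *\<^sub>C x \<doteq> c *\<^sub>C y"
  using J_scaleC[of "x - y" c] by (simp add: eqJ_def scaleC.scale_right_diff_distrib)

lemma eqJ_mult_left: "x \<doteq> y \<Longrightarrow> z * x \<doteq> z * y"
  using J_left[of "x - y" z] by (simp add: eqJ_def right_diff_distrib)

lemma eqJ_mult_right: "x \<doteq> y \<Longrightarrow> x * z \<doteq> y * z"
  using J_right[of "x - y" z] by (simp add: eqJ_def left_diff_distrib)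

lemma eqJ_qt: "x \<doteq> y \<Longrightarrow> qt p x \<doteq> qt p y"
  unfolding eqJ_def qt_diff[symmetric] unfolding qt_def ptr_def by (intro J_sum J_right[OF J_left[OF J_left]])

subsection \<open>Generators in neighbouring factors\<close>

abbreviation Rg :: "nat \<Rightarrow> 'b" where "Rg p \<equiv> op2 p (Suc p) R"
abbreviation Fg :: "nat \<Rightarrow> 'b" where "Fg p \<equiv> op2 p (Suc p) F"
abbreviation Fig :: "nat \<Rightarrow> 'b" where "Fig p \<equiv> op2 p (Suc p) Fi"
abbreviation RR :: "nat \<Rightarrow> 'b" where "RR p \<equiv> op2 p (Suc p) (twist F (twist F R))"

lemma op2_far: "p + 2 \<le> t \<Longrightarrow> op2 p (Suc p) X * op2 t (Suc t) Y = op2 t (Suc t) Y * op2 p (Suc p) X"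
  by (intro op2_commute free_op2) auto

lemma RR: "RR p = Fg p * Fg p * Rg p * Fig p * Fig p"
  by (simp add: op2_twist mult.assoc)

lemma hecke_gens_Rg: "hecke_gens q (\<lambda>p. Rg (s + p)) N"
  unfolding hecke_gens_def
proof (intro conjI allI impI)
  show "q \<noteq> 0" using hecke_R by (simp add: Hecke_def)
next
  fix p
  have "mat (q - inverse q) ** R = (\<chi> a b. (q - inverse q) * R $ a $ b)"
    by (simp add: vec_eq_iff matrix_matrix_mult_def mat_def if_distrib[of "\<lambda>x. x * _"] cong: if_cong)
  then have "R ** R = (\<chi> a b. mat 1 $ a $ b + (q - inverse q) * R $ a $ b)"
    using hecke_R by (simp add: Hecke_def vec_eq_iff)
  moreover have "op2 (s + p) (Suc (s + p)) (\<chi> a b. mat 1 $ a $ b + c * R $ a $ b) = op2 (s + p) (Suc (s + p)) (mat 1) + c *\<^sub>C Rg (s + p)" for c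
    unfolding op2_def
    by (simp add: scaleC_add_left sum.distrib scaleC.scale_sum_right scaleC_scaleC)
  ultimately show "Rg (s + p) * Rg (s + p) = 1 + (q - inverse q) *\<^sub>C Rg (s + p)"
    by (simp add: op2_mult op2_one)
next
  fix p
  show "Rg (s + p) * Rg (s + Suc p) * Rg (s + p) = Rg (s + Suc p) * Rg (s + p) * Rg (s + Suc p)"
    using braid_R[of "s + p" "Suc (s + p)" "Suc (Suc (s + p))"] by simp
next
  fix p t :: nat assume "p + 2 \<le> t"
  then show "Rg (s + p) * Rg (s + t) = Rg (s + t) * Rg (s + p)"
    by (intro op2_far) simp
qed

text \<open>
  \<open>Mb p\<close> is the copy of \<open>M\<close> with the overlined index \<open>p + 1\<close>, and \<open>Mp s n\<close> is the product of the \<open>n\<close> copies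
  \<open>Mb s, \<dots>, Mb (s + n - 1)\<close>.
\<close>

primrec Mb :: "nat \<Rightarrow> 'b" where
  "Mb 0 = M"
| "Mb (Suc p) = Fg p * Mb p * Fig p"

primrec Mp :: "nat \<Rightarrow> nat \<Rightarrow> 'b" where
  "Mp s 0 = 1"
| "Mp s (Suc n) = Mp s n * Mb (s + n)"

lemma free_Mb: "p < t \<Longrightarrow> free t (Mb p)"
  by (induction p) (auto intro!: free_mult free_op2 free_M)

lemma free_Mp: "s + n \<le> t \<Longrightarrow> free t (Mp s n)"
  by (induction n) (auto intro!: free_mult free_Mb)

lemma Mp_add: "Mp s (a + b) = Mp s a * Mp (s + a) b"
  by (induction b) (simp_all add: mult.assoc add.assoc)

lemma op2_Mb_below: "t < p \<Longrightarrow> op2 p (Suc p) X * Mb t = Mb t * op2 p (Suc p) X"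
  by (rule op2_commute[symmetric]) (auto intro: free_Mb)

lemma op2_Mb_above:
  assumes X: "op2 r (Suc r) X * Fg (Suc r) * Fg r = Fg (Suc r) * Fg r * op2 (Suc r) (Suc (Suc r)) X"
    and "r + 2 \<le> p"
  shows "op2 r (Suc r) X * Mb p = Mb p * op2 r (Suc r) X"
  using assms(2)
proof (induction p rule: dec_induct)
  case base
  let ?X = "op2 r (Suc r) X" and ?X' = "op2 (Suc r) (Suc (Suc r)) X"
  let ?G = "Fg (Suc r) * Fg r" and ?Gi = "Fig r * Fig (Suc r)"
  have G: "?Gi * ?G = 1" "?G * ?Gi = 1"
    by (simp_all add: mult.assoc Fi_F_left F_Fi_left Fi_F F_Fi)
  have "?X' * ?Gi = ?Gi * (?G * ?X') * ?Gi" using G by (simp flip: mult.assoc)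
  also have "\<dots> = ?Gi * (?X * (?G * ?Gi))" by (simp only: X[symmetric]) (simp only: mult.assoc)
  finally have X': "?X' * ?Gi = ?Gi * ?X" using G by simp
  have M: "Mb (r + 2) = ?G * Mb r * ?Gi" by (simp add: mult.assoc)
  have "?X * Mb (r + 2) = ?G * (?X' * Mb r) * ?Gi"
    using X by (simp only: M mult.assoc) (simp flip: mult.assoc)
  also have "\<dots> = ?G * Mb r * (?X' * ?Gi)"
    by (simp add: op2_Mb_below mult.assoc)
  also have "\<dots> = Mb (r + 2) * ?X"
    by (simp only: X' M mult.assoc)
  finally show ?case .
next
  case (step n)
  have far: "op2 r (Suc r) X * op2 n (Suc n) Y = op2 n (Suc n) Y * op2 r (Suc r) X" for Y
    using step by (intro op2_far) simp
  show ?case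
    unfolding Mb.simps by (intro commute_mult far step.IH)
qed

lemma Rg_Mb_above: "r + 2 \<le> p \<Longrightarrow> Rg r * Mb p = Mb p * Rg r"
  by (rule op2_Mb_above) (use RFF[of r "Suc r" "Suc (Suc r)"] in simp_all)

lemma Fg_Mb_above: "r + 2 \<le> p \<Longrightarrow> Fg r * Mb p = Mb p * Fg r"
  by (rule op2_Mb_above) (use braid_F[of r "Suc r" "Suc (Suc r)"] in simp_all)

lemma Fig_commute: "Fg r * x = x * Fg r \<Longrightarrow> Fig r * x = x * Fig r"
proof -
  assume *: "Fg r * x = x * Fg r"
  have "Fig r * x = Fig r * (x * Fg r) * Fig r" by (simp add: mult.assoc F_Fi)
  also have "\<dots> = x * Fig r" by (simp add: *[symmetric] Fi_F_left mult.assoc)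
  finally show ?thesis .
qed

lemma RR_Mb_above: 
  assumes "r + 2 \<le> p"
  shows "RR r * Mb p = Mb p * RR r"
proof -
  have "Mb p * RR r = RR r * Mb p"
    unfolding RR
    by (intro commute_mult)
      (simp_all only: Rg_Mb_above[OF assms] Fg_Mb_above[OF assms] Fig_commute[OF Fg_Mb_above[OF assms]])
  then show ?thesis ..
qed

subsection \<open>Shifting by one factor\<close>

text \<open>
  \<open>G m i = F\<^sub>m F\<^sub>m\<^sub>+\<^sub>1 \<dots> F\<^sub>m\<^sub>+\<^sub>i\<^sub>-\<^sub>1\<close>, with inverse \<open>Gi m i\<close>.  Conjugation by \<open>G m i\<close> shifts operators and copies of
  \<open>M\<close> in the factors \<open>m, \<dots>, m + i - 1\<close> by one factor.
\<close>

primrec G :: "nat \<Rightarrow> nat \<Rightarrow> 'b" where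
  "G m 0 = 1"
| "G m (Suc i) = G m i * Fg (m + i)"

primrec Gi :: "nat \<Rightarrow> nat \<Rightarrow> 'b" where
  "Gi m 0 = 1"
| "Gi m (Suc i) = Fig (m + i) * Gi m i"

lemma Gi_G: "Gi m i * G m i = 1"
proof (induction i)
  case (Suc i)
  have "Gi m (Suc i) * G m (Suc i) = Fig (m + i) * (Gi m i * G m i) * Fg (m + i)" by (simp only: Gi.simps G.simps mult.assoc)
  then show ?case by (simp add: Suc Fi_F)
qed simp

lemma G_Gi: "G m i * Gi m i = 1"
proof (induction i)
  case (Suc i)
  have "G m (Suc i) * Gi m (Suc i) = G m i * (Fg (m + i) * Fig (m + i)) * Gi m i" by (simp only: Gi.simps G.simps mult.assoc)
  then show ?case by (simp add: Suc F_Fi)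
qed simp

lemma G_conj_trivial:
  assumes "\<And>r. m \<le> r \<Longrightarrow> r < m + i \<Longrightarrow> Fg r * x = x * Fg r"
  shows "G m i * x * Gi m i = x"
proof -
  have "x * G m i = G m i * x"
    using assms by (induction i) (simp_all add: commute_mult)
  then have "G m i * x * Gi m i = x * (G m i * Gi m i)"
    by (simp only: mult.assoc[symmetric])
  then show ?thesis by (simp add: G_Gi)
qed

lemma G_conj_mult: "(G m i * x * Gi m i) * (G m i * y * Gi m i) = G m i * (x * y) * Gi m i"
proof -
  have "(G m i * x * Gi m i) * (G m i * y * Gi m i) = G m i * x * (Gi m i * G m i) * y * Gi m i"
    by (simp only: mult.assoc)
  then show ?thesis by (simp add: Gi_G mult.assoc)
qed

lemma G_conj_op2:
  assumes X: "\<And>p r s. distinct [p,r,s] \<Longrightarrow>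
      op2 p r F * op2 r s F * op2 p r X = op2 r s X * op2 p r F * op2 r s F"
    and "m \<le> p" "p + 1 < m + i"
  shows "G m i * op2 p (Suc p) X * Gi m i = op2 (Suc p) (Suc (Suc p)) X"
  using assms(3)
proof (induction i)
  case (Suc i)
  let ?X = "op2 p (Suc p) X"
  show ?case
  proof (cases "p + 1 < m + i")
    case True
    have "Fg (m + i) * ?X = ?X * Fg (m + i)"
      using True by (intro op2_far[symmetric]) simp
    then have "Fg (m + i) * ?X * Fig (m + i) = ?X"
      by (simp add: mult.assoc F_Fi)
    moreover have "G m (Suc i) * ?X * Gi m (Suc i) = G m i * (Fg (m + i) * ?X * Fig (m + i)) * Gi m i"
      by (simp only: G.simps Gi.simps mult.assoc)
    ultimately show ?thesis using Suc.IH True by simp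
  next
    case False
    then have p: "m + i = Suc p" using Suc.prems by simp
    then obtain i' where i': "i = Suc i'" using assms(2) by (cases i) auto
    have mi': "m + i' = p" using p i' by simp
    have FF: "Fg p * Fg (Suc p) * ?X = op2 (Suc p) (Suc (Suc p)) X * Fg p * Fg (Suc p)"
      using X[of p "Suc p" "Suc (Suc p)"] by simp
    have "Fg p * Fg (Suc p) * ?X * Fig (Suc p) * Fig p = op2 (Suc p) (Suc (Suc p)) X"
      unfolding FF by (simp add: mult.assoc F_Fi_left F_Fi)
    moreover have "G m (Suc i) * ?X * Gi m (Suc i) = G m i' * (Fg p * Fg (Suc p) * ?X * Fig (Suc p) * Fig p) * Gi m i'"
      using mi' by (simp add: i' mult.assoc)
    moreover have "G m i' * op2 (Suc p) (Suc (Suc p)) X * Gi m i' = op2 (Suc p) (Suc (Suc p)) X"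
      using mi' by (intro G_conj_trivial op2_far) simp
    ultimately show ?thesis by simp
  qed
qed (use assms(2) in simp)

lemma G_conj_Rg: "m \<le> p \<Longrightarrow> p + 1 < m + i \<Longrightarrow> G m i * Rg p * Gi m i = Rg (Suc p)"
  by (rule G_conj_op2[OF FFR])

lemma G_conj_Fg: "m \<le> p \<Longrightarrow> p + 1 < m + i \<Longrightarrow> G m i * Fg p * Gi m i = Fg (Suc p)"
  by (rule G_conj_op2[OF braid_F])

lemma G_conj_Fig: 
  assumes "m \<le> p" "p + 1 < m + i"
  shows "G m i * Fig p * Gi m i = Fig (Suc p)"
proof -
  have "Fg (Suc p) * (G m i * Fig p * Gi m i) = 1"
    using G_conj_mult[of m i "Fg p" "Fig p"] by (simp add: G_conj_Fg[OF assms] F_Fi G_Gi)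
  then have "Fig (Suc p) * (Fg (Suc p) * (G m i * Fig p * Gi m i)) = Fig (Suc p)" by simp
  then show ?thesis by (simp add: Fi_F_left)
qed

lemma G_conj_RR: "m \<le> p \<Longrightarrow> p + 1 < m + i \<Longrightarrow> G m i * RR p * Gi m i = RR (Suc p)"
  unfolding RR by (simp add: G_conj_Rg G_conj_Fg G_conj_Fig flip: G_conj_mult)

lemma G_conj_Mb:
  assumes "m \<le> p" "p < m + i"
  shows "G m i * Mb p * Gi m i = Mb (Suc p)"
  using assms(2)
proof (induction i)
  case (Suc i)
  have *: "G m (Suc i) * Mb p * Gi m (Suc i) = G m i * (Fg (m + i) * Mb p * Fig (m + i)) * Gi m i"
    by (simp only: G.simps Gi.simps mult.assoc)
  show ?case
  proof (cases "p < m + i")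
    case True
    then have "Fg (m + i) * Mb p * Fig (m + i) = Mb p"
      by (simp add: op2_Mb_below mult.assoc F_Fi)
    then show ?thesis using Suc.IH True * by simp
  next
    case False
    then have p: "m + i = p" using Suc.prems by simp
    have "G m i * Mb (Suc p) * Gi m i = Mb (Suc p)"
      using p by (intro G_conj_trivial Fg_Mb_above) simp
    then show ?thesis using * p by simp
  qed
qed (use assms(1) in simp)

lemma G_conj_Mp: "n \<le> i \<Longrightarrow> G m i * Mp m n * Gi m i = Mp (Suc m) n"
proof (induction n)
  case (Suc n)
  then show ?case
    by (simp add: G_conj_Mb flip: G_conj_mult)
qed (simp add: G_Gi)

subsection \<open>Exchange relations\<close>

lemma relation_Mb: "Rg j * Mb j * Mb (Suc j) \<doteq> Mb j * Mb (Suc j) * RR j"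
proof (induction j)
  case 0
  then show ?case using relation by (simp add: eqJ_def)
next
  case (Suc j)
  have c: "Mb (Suc j) = G j 2 * Mb j * Gi j 2" "Mb (Suc (Suc j)) = G j 2 * Mb (Suc j) * Gi j 2"
      "Rg (Suc j) = G j 2 * Rg j * Gi j 2" "RR (Suc j) = G j 2 * RR j * Gi j 2"
    by (simp_all only: G_conj_Mb G_conj_Rg G_conj_RR)
  have "Rg (Suc j) * Mb (Suc j) * Mb (Suc (Suc j)) = G j 2 * (Rg j * Mb j * Mb (Suc j)) * Gi j 2"
    by (simp only: c G_conj_mult)
  also have "\<dots> \<doteq> G j 2 * (Mb j * Mb (Suc j) * RR j) * Gi j 2"
    by (intro eqJ_mult_left eqJ_mult_right Suc)
  also have "\<dots> = Mb (Suc j) * Mb (Suc (Suc j)) * RR (Suc j)"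
    by (simp only: c G_conj_mult)
  finally show ?case .
qed

lemma relation_Mp:
  assumes "j + 1 < k"
  shows "Rg j * Mp 0 k \<doteq> Mp 0 k * RR j"
proof -
  obtain l where k: "k = j + 2 + l" 
    using assms by (metis add.commute add_2_eq_Suc' le_Suc_ex less_eq_Suc_le Suc_eq_plus1)
  have Mp: "Mp 0 k = Mp 0 j * (Mb j * Mb (Suc j)) * Mp (j + 2) l"
  proof -
    have "Mp 0 (j + 2) = Mp 0 j * (Mb j * Mb (Suc j))"
      by (simp add: mult.assoc del: Mb.simps)
    then show ?thesis
      using Mp_add[of 0 "j + 2" l] by (simp only: k add_0)
  qed
  have 1: "Rg j * Mp 0 j = Mp 0 j * Rg j"
    by (rule op2_commute[symmetric]) (auto intro!: free_Mp)
  have 2: "RR j * Mp (j + 2) l = Mp (j + 2) l * RR j"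
  proof (induction l)
    case (Suc l)
    then show ?case
      unfolding Mp.simps by (intro commute_mult RR_Mb_above) simp_all
  qed simp
  have "Rg j * Mp 0 k = Mp 0 j * (Rg j * Mb j * Mb (Suc j)) * Mp (j + 2) l"
    using 1 by (simp add: Mp flip: mult.assoc)
  also have "\<dots> \<doteq> Mp 0 j * (Mb j * Mb (Suc j) * RR j) * Mp (j + 2) l"
    by (intro eqJ_mult_left eqJ_mult_right relation_Mb)
  also have "\<dots> = Mp 0 k * RR j"
    using 2 by (simp add: Mp mult.assoc)
  finally show ?thesis .
qed

subsection \<open>Quantum traces in several factors\<close>

text \<open>
  \<open>QT j n\<close> is the quantum trace over the \<open>n\<close> factors \<open>j, \<dots>, j + n - 1\<close>.
\<close>

primrec QT :: "nat \<Rightarrow> nat \<Rightarrow> 'b \<Rightarrow> 'b" where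
  "QT j 0 X = X"
| "QT j (Suc n) X = QT j n (qt (j + n) X)"

lemma QT_diff: "QT j n (X - Y) = QT j n X - QT j n Y"
  and QT_scaleC: "QT j n (c *\<^sub>C X) = c *\<^sub>C QT j n X"
  by (induction n arbitrary: X Y) (simp_all add: qt_diff qt_scaleC)

lemma eqJ_QT: "x \<doteq> y \<Longrightarrow> QT j n x \<doteq> QT j n y"
  by (induction n arbitrary: x y) (auto intro: eqJ_qt)

lemma QT_mult_left: "(\<And>p. j \<le> p \<Longrightarrow> p < j + n \<Longrightarrow> free p A) \<Longrightarrow> QT j n (A * X) = A * QT j n X"
  by (induction n arbitrary: X) (simp_all add: qt_mult_left)

lemma QT_mult_right: "(\<And>p. j \<le> p \<Longrightarrow> p < j + n \<Longrightarrow> free p A) \<Longrightarrow> QT j n (X * A) = QT j n X * A"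
  by (induction n arbitrary: X) (simp_all add: qt_mult_right)

lemma QT_split: "QT j (a + b) X = QT j a (QT (j + a) b X)"
  by (induction b arbitrary: X) (simp_all add: add.assoc)

lemma free_QT: "free p X \<Longrightarrow> free p (QT j n X)"
  by (induction n arbitrary: X) auto

lemma free_QT_same: "j \<le> p \<Longrightarrow> p < j + n \<Longrightarrow> free p (QT j n X)"
proof (induction n arbitrary: X)
  case (Suc n)
  then show ?case by (cases "p = j + n") (auto intro: free_QT)
qed simp

lemma QT_G_conj: "free (m + i) X \<Longrightarrow> QT (Suc m) i (G m i * X * Gi m i) = QT m i X"
proof (induction i arbitrary: X)
  case (Suc i)
  have fG: "free t (G m i)" "free t (Gi m i)" if "m + i < t" for t
    using that by (induction i) (auto intro!: free_mult free_op2)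
  have "QT (Suc m) (Suc i) (G m (Suc i) * X * Gi m (Suc i))
    = QT (Suc m) i (qt (Suc (m + i)) (G m i * (Fg (m + i) * X * Fig (m + i)) * Gi m i))"
    by (simp add: mult.assoc)
  also have "qt (Suc (m + i)) (G m i * (Fg (m + i) * X * Fig (m + i)) * Gi m i)
    = G m i * qt (Suc (m + i)) (Fg (m + i) * X * Fig (m + i)) * Gi m i"
    using fG by (simp only: qt_mult_left qt_mult_right lessI)
  also have "qt (Suc (m + i)) (Fg (m + i) * X * Fig (m + i)) = qt (m + i) X"
    using Suc.prems by (intro qt_conj) auto
  also have "QT (Suc m) i (G m i * qt (m + i) X * Gi m i) = QT m i (qt (m + i) X)"
    by (rule Suc.IH) simp
  finally show ?case by simp
qed simp

lemma QT_cyc: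
  assumes "s \<le> j" "j + 1 < s + n"
  shows "QT s n (X * RR j) = QT s n (Rg j * X)"
proof -
  obtain a where a: "j = s + a" using assms(1) le_Suc_ex by blast
  obtain b where b: "n = a + (2 + b)"
    using assms(2) unfolding a by (intro that[of "n - a - 2"]) simp
  have 1: "QT (s + a + 2) b (X * RR j) = QT (s + a + 2) b X * RR j"
    unfolding a by (rule QT_mult_right) auto
  have 2: "QT (s + a + 2) b (Rg j * X) = Rg j * QT (s + a + 2) b X"
    unfolding a by (rule QT_mult_left) auto
  have *: "QT s n Y = QT s a (qt j (qt (Suc j) (QT (s + a + 2) b Y)))" for Y
    unfolding b QT_split[of s a] QT_split[of "s + a" 2] by (simp add: numeral_2_eq_2 a)
  show ?thesis
    unfolding * 1 2 by (simp add: qt_cyc)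
qed

subsection \<open>Symmetric functions\<close>

text \<open>
  The antisymmetrizer in the \<open>k\<close> factors \<open>s, \<dots>, s + k - 1\<close>; the product of the first \<open>m\<close> generators \<open>Rg\<close>; and
  the element \<open>\<sigma>\<^sub>i(M)\<close>, as a multiple of the identity.
\<close>

definition A :: "nat \<Rightarrow> nat \<Rightarrow> 'b" where
  "A s k = antisym_of q (\<lambda>p. Rg (s + p)) k"

primrec chain :: "nat \<Rightarrow> 'b" where
  "chain 0 = 1"
| "chain (Suc m) = chain m * Rg m"

definition sg :: "nat \<Rightarrow> 'b" where
  "sg i = QT 0 i (A 0 i * Mp 0 i)"

lemma A_0 [simp]: "A s 0 = 1" and A_1 [simp]: "A s (Suc 0) = 1"
  by (simp_all add: A_def)

lemma free_A: "t < s \<or> s + k \<le> t \<Longrightarrow> free t (A s k)"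
  unfolding A_def by (intro free_antisym_of free_op2) auto

lemma G_conj_A: "G m i * A m i * Gi m i = A (Suc m) i"
  unfolding A_def antisym_of_conj[OF Gi_G G_Gi, symmetric]
  by (rule antisym_of_cong) (simp add: G_conj_Rg)

lemma sg_shift: "QT m i (A m i * Mp m i) = sg i"
proof (induction m)
  case 0
  then show ?case by (simp add: sg_def)
next
  case (Suc m)
  have "QT (Suc m) i (A (Suc m) i * Mp (Suc m) i) = QT (Suc m) i (G m i * (A m i * Mp m i) * Gi m i)"
    by (simp only: G_conj_A[symmetric] G_conj_Mp[OF order.refl, symmetric] G_conj_mult)
  also have "\<dots> = QT m i (A m i * Mp m i)"
    by (intro QT_G_conj free_mult free_A free_Mp) auto
  finally show ?case using Suc by simp
qed

lemma free_sg: "free p (sg i)"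
proof (cases "p < i")
  case True
  then show ?thesis unfolding sg_def by (intro free_QT_same) auto
next
  case False
  then show ?thesis unfolding sg_def by (intro free_QT free_mult free_A free_Mp) auto
qed

text \<open>
  The matrix power of exponent \<open>s + 1\<close>.
\<close>

definition pw :: "nat \<Rightarrow> 'b" where
  "pw s = QT 1 s (chain s * Mp 0 (Suc s))"

lemma free_chain: "s < t \<Longrightarrow> free t (chain s)"
  by (induction s) (auto intro!: free_mult free_op2)

text \<open>
  The quantum trace over the factors from \<open>Suc s\<close> on produces \<open>\<sigma>\<^sub>i(M)\<close>, whatever the first of these factors
  is; the trace over the remaining ones produces the matrix power.
\<close>

lemma pw_sg: "QT 1 (s + i) (chain s * A (Suc s) i * Mp 0 (Suc s + i)) = pw s * sg i"
proof -
  have "Mp 0 (Suc s) * A (Suc s) i = A (Suc s) i * Mp 0 (Suc s)"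
    unfolding A_def by (rule commute_antisym_of, rule op2_commute) (auto intro!: free_Mp simp del: Mp.simps)
  then have "chain s * A (Suc s) i * Mp 0 (Suc s + i) = chain s * Mp 0 (Suc s) * (A (Suc s) i * Mp (Suc s) i)"
    unfolding Mp_add by (simp add: mult.assoc del: Mp.simps) (simp flip: mult.assoc del: Mp.simps)
  also have "QT (1 + s) i \<dots> = chain s * Mp 0 (Suc s) * sg i"
    by (subst QT_mult_left) (auto intro!: free_mult free_chain free_Mp simp: sg_shift simp del: Mp.simps)
  finally show ?thesis
    unfolding QT_split by (simp add: QT_mult_right free_sg pw_def del: Mp.simps)
qed

subsection \<open>The recursion\<close>

text \<open>
  The functional \<open>\<Phi>\<close> for \<open>k + 1\<close> copies of \<open>M\<close>: all factors but the factor 0 are traced out.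
\<close>

definition Phi :: "nat \<Rightarrow> 'b \<Rightarrow> 'b" where
  "Phi k X = QT 1 k (X * Mp 0 (Suc k))"

lemma Phi_diff: "Phi k (X - Y) = Phi k X - Phi k Y"
  and Phi_scaleC: "Phi k (c *\<^sub>C X) = c *\<^sub>C Phi k X"
  by (simp_all add: Phi_def left_diff_distrib QT_diff mult_scaleC_left QT_scaleC del: Mp.simps)

lemma Phi_cyc_Rg:
  assumes "1 \<le> j" "j < k"
  shows "Phi k (X * Rg j) \<doteq> Phi k (Rg j * X)"
proof -
  have "Phi k (X * Rg j) = QT 1 k (X * (Rg j * Mp 0 (Suc k)))"
    by (simp only: Phi_def mult.assoc)
  also have "\<dots> \<doteq> QT 1 k (X * (Mp 0 (Suc k) * RR j))"
    using assms by (intro eqJ_QT eqJ_mult_left relation_Mp) simp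
  also have "\<dots> = QT 1 k (X * Mp 0 (Suc k) * RR j)"
    by (simp only: mult.assoc)
  also have "\<dots> = QT 1 k (Rg j * (X * Mp 0 (Suc k)))"
    using assms by (intro QT_cyc) auto
  also have "\<dots> = Phi k (Rg j * X)"
    by (simp only: Phi_def mult.assoc)
  finally show ?thesis .
qed

lemma Phi_cyc_antisym:
  assumes "\<And>p X. p + 1 < n \<Longrightarrow> Phi k (X * r p) \<doteq> Phi k (r p * X)"
  shows "Phi k (X * antisym_of q' r n) \<doteq> Phi k (antisym_of q' r n * X)"
  using assms
proof (induction q' r n arbitrary: X rule: antisym_of.induct)
  case (3 q' r n)
  let ?a = "antisym_of q' r (n + 1)" and ?y = "q' ^ (n + 1) *\<^sub>C 1 - qnum q' (n + 1) *\<^sub>C r n"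
  have a: "Phi k (X * ?a) \<doteq> Phi k (?a * X)" for X
    by (rule 3(1)) (use 3(3) in auto)
  have y: "Phi k (X * ?y) \<doteq> Phi k (?y * X)" for X
    using 3(3)[of n X]
    by (simp add: left_diff_distrib right_diff_distrib mult_scaleC_left mult_scaleC_right Phi_diff Phi_scaleC
       eqJ_diff eqJ_scaleC del: power_Suc)
  have "Phi k (X * (?a * ?y * ?a)) = Phi k ((X * ?a * ?y) * ?a)" by (simp only: mult.assoc)
  also have "\<dots> \<doteq> Phi k (?a * (X * ?a * ?y))" by (rule a)
  also have "\<dots> = Phi k ((?a * X * ?a) * ?y)" by (simp only: mult.assoc)
  also have "\<dots> \<doteq> Phi k (?y * (?a * X * ?a))" by (rule y)
  also have "\<dots> = Phi k ((?y * ?a * X) * ?a)" by (simp only: mult.assoc)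
  also have "\<dots> \<doteq> Phi k (?a * (?y * ?a * X))" by (rule a)
  also have "\<dots> = Phi k (?a * ?y * ?a * X)" by (simp only: mult.assoc)
  finally show ?case
    by (simp only: antisym_of.simps mult_scaleC_left mult_scaleC_right Phi_scaleC) (rule eqJ_scaleC)
qed simp_all

lemma Phi_cyc_A: "1 \<le> s \<Longrightarrow> s + i \<le> Suc k \<Longrightarrow> Phi k (X * A s i) \<doteq> Phi k (A s i * X)"
  unfolding A_def by (intro Phi_cyc_antisym Phi_cyc_Rg) auto

text \<open>
  \<open>B s i\<close> interpolates between a matrix power (\<open>i = 0\<close>) and a wedge power (\<open>s = 0\<close>).
\<close>

definition B :: "nat \<Rightarrow> nat \<Rightarrow> 'b" where
  "B s i = Phi (s + i) (chain s * A s (Suc i))"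

lemma B_0: "B s 0 = pw s * sg 0"
  by (simp add: B_def Phi_def pw_def sg_def del: Mp.simps(2))

lemma chain_A_commute: "chain s * A (Suc s) i = A (Suc s) i * chain s"
  unfolding A_def
proof (rule commute_antisym_of)
  fix p
  show "chain s * Rg (Suc s + p) = Rg (Suc s + p) * chain s"
    by (rule op2_commute) (auto intro!: free_chain)
qed

lemma B_Suc: "qnum q (i + 2) *\<^sub>C B s (Suc i) \<doteq> q ^ (i + 1) *\<^sub>C (pw s * sg (Suc i)) - qnum q (i + 1) *\<^sub>C B (Suc s) i"
proof -
  let ?a = "A (Suc s) (Suc i)" and ?k = "s + Suc i"
  let ?y = "q ^ (i + 1) *\<^sub>C 1 - qnum q (i + 1) *\<^sub>C Rg s"
  have aa: "?a * ?a = ?a"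
    unfolding A_def by (rule antisym_of_idem[OF hecke_gens_Rg qnum_nonzero, where N = i]) auto
  have "A s (Suc (Suc i)) = (1 / qnum q (i + 2)) *\<^sub>C (?a * ?y * ?a)"
    using antisym_of_first[OF hecke_gens_Rg[of s] qnum_nonzero, of i] by (simp add: A_def)
  then have "qnum q (i + 2) *\<^sub>C A s (Suc (Suc i)) = ?a * ?y * ?a"
    using qnum_nonzero[of "i + 2"] by (simp add: scaleC_scaleC scaleC_one)
  then have "qnum q (i + 2) *\<^sub>C B s (Suc i) = Phi ?k (chain s * (?a * ?y * ?a))"
    by (simp add: B_def flip: Phi_scaleC mult_scaleC_right)
  also have "\<dots> = Phi ?k ((chain s * ?a * ?y) * ?a)" by (simp only: mult.assoc)
  \<comment> \<open>The right copy of the antisymmetrizer is moved to the left, where it merges with the other one.\<close>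
  also have "\<dots> \<doteq> Phi ?k (?a * (chain s * ?a * ?y))" by (rule Phi_cyc_A) auto
  also have "?a * (chain s * ?a * ?y) = chain s * ?a * ?y"
  proof -
    have "?a * (chain s * ?a * ?y) = (?a * chain s) * ?a * ?y" by (simp only: mult.assoc)
    also have "\<dots> = chain s * (?a * ?a) * ?y" by (simp only: chain_A_commute[symmetric] mult.assoc)
    finally show ?thesis by (simp only: aa)
  qed
  also have "Phi ?k (chain s * ?a * ?y) = q ^ (i + 1) *\<^sub>C Phi ?k (chain s * ?a) - qnum q (i + 1) *\<^sub>C Phi ?k (chain s * ?a * Rg s)"
    by (simp only: right_diff_distrib mult_scaleC_right mult_1_right Phi_diff Phi_scaleC)
  also have "\<dots> \<doteq> q ^ (i + 1) *\<^sub>C (pw s * sg (Suc i)) - qnum q (i + 1) *\<^sub>C B (Suc s) i"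
  proof (intro eqJ_diff eqJ_scaleC)
    show "Phi ?k (chain s * ?a) \<doteq> pw s * sg (Suc i)"
      using pw_sg[of s "Suc i"] by (simp add: Phi_def del: Mp.simps)
    have "Phi ?k (chain s * ?a * Rg s) = Phi ?k (?a * (chain s * Rg s))"
      by (simp only: chain_A_commute mult.assoc)
    also have "Phi ?k ((chain s * Rg s) * ?a) \<doteq> \<dots>" by (rule Phi_cyc_A) auto
    finally have "B (Suc s) i \<doteq> Phi ?k (chain s * ?a * Rg s)" by (simp add: B_def)
    then show "Phi ?k (chain s * ?a * Rg s) \<doteq> B (Suc s) i"
      using eqJ_diff[OF eqJ_refl[of 0]] eqJ_def J_uminus minus_diff_eq by metis
  qed
  finally show ?thesis .
qed

lemma B_sum: "qnum q (Suc i) *\<^sub>C B s i \<doteq> (\<Sum>t\<le>i. ((-1) ^ (i - t) * q ^ t) *\<^sub>C (pw (s + i - t) * sg t))"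
proof (induction i arbitrary: s)
  case 0
  then show ?case by (simp add: B_0 scaleC_one)
next
  case (Suc i)
  have "qnum q (Suc (Suc i)) *\<^sub>C B s (Suc i) \<doteq> q ^ (i + 1) *\<^sub>C (pw s * sg (Suc i)) - qnum q (Suc i) *\<^sub>C B (Suc s) i"
    using B_Suc[of i s] by simp
  also have "\<dots> \<doteq> q ^ (i + 1) *\<^sub>C (pw s * sg (Suc i)) -
      (\<Sum>t\<le>i. ((-1) ^ (i - t) * q ^ t) *\<^sub>C (pw (Suc s + i - t) * sg t))"
    by (intro eqJ_diff eqJ_refl Suc.IH)
  also have "\<dots> = (\<Sum>t\<le>Suc i. ((-1) ^ (Suc i - t) * q ^ t) *\<^sub>C (pw (s + Suc i - t) * sg t))"
    by (simp add: Suc_diff_le sum_negf)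
  finally show ?case .
qed

theorem Newton_relation:
  "((-1) ^ k * qnum q (Suc k)) *\<^sub>C QT 1 k (A 0 (Suc k) * Mp 0 (Suc k))
    \<doteq> (\<Sum>t\<le>k. (- q) ^ t *\<^sub>C (pw (k - t) * sg t))"
proof -
  have "((-1) ^ k * qnum q (Suc k)) *\<^sub>C QT 1 k (A 0 (Suc k) * Mp 0 (Suc k)) = (-1) ^ k *\<^sub>C (qnum q (Suc k) *\<^sub>C B 0 k)"
    by (simp add: B_def Phi_def scaleC_scaleC del: Mp.simps)
  also have "\<dots> \<doteq> (-1) ^ k *\<^sub>C (\<Sum>t\<le>k. ((-1) ^ (k - t) * q ^ t) *\<^sub>C (pw (0 + k - t) * sg t))"
    by (intro eqJ_scaleC B_sum)
  also have "\<dots> = (\<Sum>t\<le>k. (- q) ^ t *\<^sub>C (pw (k - t) * sg t))"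
  proof -
    have "(-1) ^ k * ((-1) ^ (k - t) * q ^ t) = (- q) ^ t" if "t \<le> k" for t
    proof -
      have "(-1::complex) ^ k = (-1) ^ (k - t) * (-1) ^ t" 
        using that by (simp flip: power_add)
      moreover have "(-1::complex) ^ (k - t) * (-1) ^ (k - t) = 1"
        by (simp flip: power_mult_distrib)
      ultimately show ?thesis by (simp add: power_minus[of q] mult.assoc mult.left_commute)
    qed
    then show ?thesis by (simp add: scaleC.scale_sum_right scaleC_scaleC)
  qed
  finally show ?thesis .
qed

end

section \<open>Row-finite matrices\<close>

text \<open>
  Basis vectors of an infinite tensor power of \<open>V\<close> are sequences \<open>nat \<Rightarrow> 'n\<close>.  Matrices over them with finitely
  many nonzero entries in each row form a ring that contains the operators in all finite tensor powers.
\<close>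

typedef (overloaded) ('n, 'a) op =
    "{X :: (nat \<Rightarrow> 'n) \<Rightarrow> (nat \<Rightarrow> 'n) \<Rightarrow> 'a::zero. \<forall>i. finite {j. X i j \<noteq> 0}}"
  morphisms ent Op
  by (rule exI[of _ "\<lambda>i j. 0"]) simp

setup_lifting type_definition_op

lemma finite_row: "finite {j. ent X i j \<noteq> 0}"
  using ent[of X] by simp

lemma op_eqI: "(\<And>i j. ent X i j = ent Y i j) \<Longrightarrow> X = Y"
  by (simp add: ent_inject[symmetric] fun_eq_iff)

instantiation op :: (type, complex_algebra_1) complex_algebra_1
begin

lift_definition zero_op :: "('a, 'b) op" is "\<lambda>i j. 0" by simp

lift_definition one_op :: "('a, 'b) op" is "\<lambda>i j. if i = j then 1 else 0" by simp

lift_definition plus_op :: "('a, 'b) op \<Rightarrow> ('a, 'b) op \<Rightarrow> ('a, 'b) op" is "\<lambda>X Y i j. X i j + Y i j"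
proof -
  fix X Y :: "(nat \<Rightarrow> 'a) \<Rightarrow> (nat \<Rightarrow> 'a) \<Rightarrow> 'b" and i
  assume "\<And>i. finite {j. X i j \<noteq> 0}" "\<And>i. finite {j. Y i j \<noteq> 0}"
  then have "finite ({j. X i j \<noteq> 0} \<union> {j. Y i j \<noteq> 0})" by simp
  then show "finite {j. X i j + Y i j \<noteq> 0}"
    by (rule rev_finite_subset) auto
qed

lift_definition uminus_op :: "('a, 'b) op \<Rightarrow> ('a, 'b) op" is "\<lambda>X i j. - X i j" by simp

lift_definition minus_op :: "('a, 'b) op \<Rightarrow> ('a, 'b) op \<Rightarrow> ('a, 'b) op" is "\<lambda>X Y i j. X i j - Y i j"
proof -
  fix X Y :: "(nat \<Rightarrow> 'a) \<Rightarrow> (nat \<Rightarrow> 'a) \<Rightarrow> 'b" and i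
  assume "\<And>i. finite {j. X i j \<noteq> 0}" "\<And>i. finite {j. Y i j \<noteq> 0}"
  then have "finite ({j. X i j \<noteq> 0} \<union> {j. Y i j \<noteq> 0})" by simp
  then show "finite {j. X i j - Y i j \<noteq> 0}"
    by (rule rev_finite_subset) auto
qed

lift_definition scaleC_op :: "complex \<Rightarrow> ('a, 'b) op \<Rightarrow> ('a, 'b) op" is "\<lambda>c X i j. c *\<^sub>C X i j"
proof -
  fix X :: "(nat \<Rightarrow> 'a) \<Rightarrow> (nat \<Rightarrow> 'a) \<Rightarrow> 'b" and c i
  assume "\<And>i. finite {j. X i j \<noteq> 0}"
  then have "finite {j. X i j \<noteq> 0}" .
  then show "finite {j. c *\<^sub>C X i j \<noteq> 0}"
    by (rule rev_finite_subset) auto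
qed

lift_definition times_op :: "('a, 'b) op \<Rightarrow> ('a, 'b) op \<Rightarrow> ('a, 'b) op" is
  "\<lambda>X Y i j. \<Sum>l | X i l \<noteq> 0. X i l * Y l j"
proof -
  fix X Y :: "(nat \<Rightarrow> 'a) \<Rightarrow> (nat \<Rightarrow> 'a) \<Rightarrow> 'b" and i
  assume *: "\<And>i. finite {j. X i j \<noteq> 0}" "\<And>i. finite {j. Y i j \<noteq> 0}"
  have "{j. (\<Sum>l | X i l \<noteq> 0. X i l * Y l j) \<noteq> 0} \<subseteq> (\<Union>l\<in>{l. X i l \<noteq> 0}. {j. Y l j \<noteq> 0})"
  proof
    fix j assume "j \<in> {j. (\<Sum>l | X i l \<noteq> 0. X i l * Y l j) \<noteq> 0}"
    then have "(\<Sum>l | X i l \<noteq> 0. X i l * Y l j) \<noteq> 0" by simp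
    then obtain l where "X i l \<noteq> 0" "X i l * Y l j \<noteq> 0"
      by (auto elim: sum.not_neutral_contains_not_neutral)
    then show "j \<in> (\<Union>l\<in>{l. X i l \<noteq> 0}. {j. Y l j \<noteq> 0})" by auto
  qed
  moreover have "finite (\<Union>l\<in>{l. X i l \<noteq> 0}. {j. Y l j \<noteq> 0})" using * by simp
  ultimately show "finite {j. (\<Sum>l | X i l \<noteq> 0. X i l * Y l j) \<noteq> 0}"
    by (rule finite_subset)
qed

lemma ent_times:
  assumes "finite S" "\<And>l. l \<notin> S \<Longrightarrow> ent X i l * ent Y l j = 0"
  shows "ent (X * Y) i j = (\<Sum>l\<in>S. ent X i l * ent (Y :: ('a,'b) op) l j)"
proof -
  have "ent (X * Y) i j = (\<Sum>l | ent X i l \<noteq> 0. ent X i l * ent Y l j)"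
    by (simp add: times_op.rep_eq)
  also have "\<dots> = (\<Sum>l\<in>{l. ent X i l \<noteq> 0} \<union> S. ent X i l * ent Y l j)"
    using finite_row[of X i] assms(1) by (intro sum.mono_neutral_left) auto
  also have "\<dots> = (\<Sum>l\<in>S. ent X i l * ent Y l j)"
    using finite_row[of X i] assms by (intro sum.mono_neutral_right) auto
  finally show ?thesis .
qed

instance
proof
  fix X Y Z :: "('a, 'b) op" and c d :: complex
  note eqs = plus_op.rep_eq minus_op.rep_eq uminus_op.rep_eq zero_op.rep_eq scaleC_op.rep_eq
  show "X + Y + Z = X + (Y + Z)" "X + Y = Y + X" "0 + X = X" "- X + X = 0" "X - Y = X + - Y"
    by (auto intro!: op_eqI simp: eqs)
  show "c *\<^sub>C (X + Y) = c *\<^sub>C X + c *\<^sub>C Y" "(c + d) *\<^sub>C X = c *\<^sub>C X + d *\<^sub>C X"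
    "c *\<^sub>C d *\<^sub>C X = (c * d) *\<^sub>C X" "1 *\<^sub>C X = X"
    by (auto intro!: op_eqI simp: eqs scaleC_add_left scaleC_add_right scaleC_scaleC scaleC_one)
  show "(0::('a,'b) op) \<noteq> 1"
    by (simp add: ent_inject[symmetric] zero_op.rep_eq one_op.rep_eq fun_eq_iff exI[of _ "undefined"])
  show "X * Y * Z = X * (Y * Z)"
  proof (rule op_eqI)
    fix i j
    define S where "S = {l. ent X i l \<noteq> 0}"
    define T where "T = (\<Union>l\<in>S. {m. ent Y l m \<noteq> 0})"
    have S: "finite S" by (simp add: S_def finite_row)
    have T: "finite T" by (simp add: T_def S finite_row)
    have XY: "ent (X * Y) i m = (\<Sum>l\<in>S. ent X i l * ent Y l m)" for m
      by (rule ent_times[OF S]) (simp add: S_def)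
    have "ent (X * Y * Z) i j = (\<Sum>m\<in>T. ent (X * Y) i m * ent Z m j)"
    proof (rule ent_times[OF T])
      fix m assume "m \<notin> T"
      then have "ent (X * Y) i m = 0" unfolding XY by (intro sum.neutral) (auto simp: T_def)
      then show "ent (X * Y) i m * ent Z m j = 0" by simp
    qed
    also have "\<dots> = (\<Sum>m\<in>T. \<Sum>l\<in>S. ent X i l * (ent Y l m * ent Z m j))"
      by (simp add: XY sum_distrib_right mult.assoc)
    also have "\<dots> = (\<Sum>l\<in>S. ent X i l * (\<Sum>m\<in>T. ent Y l m * ent Z m j))"
      by (subst sum.swap) (simp add: sum_distrib_left)
    also have "\<dots> = (\<Sum>l\<in>S. ent X i l * ent (Y * Z) l j)"
    proof (intro sum.cong refl arg_cong2[where f = "(*)"] ent_times[OF T, symmetric])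
      fix l m assume "l \<in> S" "m \<notin> T"
      then show "ent Y l m * ent Z m j = 0" by (auto simp: T_def)
    qed
    also have "\<dots> = ent (X * (Y * Z)) i j"
      by (rule ent_times[OF S, symmetric]) (simp add: S_def)
    finally show "ent (X * Y * Z) i j = ent (X * (Y * Z)) i j" .
  qed
  show "1 * X = X"
  proof (rule op_eqI)
    fix i j
    show "ent (1 * X) i j = ent X i j"
      by (subst ent_times[of "{i}"]) (auto simp: one_op.rep_eq)
  qed
  show "X * 1 = X"
  proof (rule op_eqI)
    fix i j
    show "ent (X * 1) i j = ent X i j"
      by (subst ent_times[of "{j}"]) (auto simp: one_op.rep_eq)
  qed
  show "(X + Y) * Z = X * Z + Y * Z"
  proof (rule op_eqI)
    fix i j
    let ?S = "{l. ent X i l \<noteq> 0} \<union> {l. ent Y i l \<noteq> 0}"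
    have "ent ((X + Y) * Z) i j = (\<Sum>l\<in>?S. ent (X + Y) i l * ent Z l j)"
      "ent (X * Z) i j = (\<Sum>l\<in>?S. ent X i l * ent Z l j)"
      "ent (Y * Z) i j = (\<Sum>l\<in>?S. ent Y i l * ent Z l j)"
      by (rule ent_times; auto simp: eqs finite_row)+
    then show "ent ((X + Y) * Z) i j = ent (X * Z + Y * Z) i j"
      by (simp add: eqs distrib_right sum.distrib)
  qed
  show "X * (Y + Z) = X * Y + X * Z"
  proof (rule op_eqI)
    fix i j
    let ?S = "{l. ent X i l \<noteq> 0}"
    have "ent (X * W) i j = (\<Sum>l\<in>?S. ent X i l * ent W l j)" for W
      by (rule ent_times; auto simp: eqs finite_row)
    then show "ent (X * (Y + Z)) i j = ent (X * Y + X * Z) i j"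
      by (simp add: eqs distrib_left sum.distrib)
  qed
  show "(c *\<^sub>C X) * Y = c *\<^sub>C (X * Y)"
  proof (rule op_eqI)
    fix i j
    let ?S = "{l. ent X i l \<noteq> 0}"
    have "ent ((c *\<^sub>C X) * Y) i j = (\<Sum>l\<in>?S. ent (c *\<^sub>C X) i l * ent Y l j)"
      "ent (X * Y) i j = (\<Sum>l\<in>?S. ent X i l * ent Y l j)"
      by (rule ent_times; auto simp: eqs finite_row)+
    then show "ent ((c *\<^sub>C X) * Y) i j = ent (c *\<^sub>C (X * Y)) i j"
      by (simp add: eqs mult_scaleC_left scaleC.scale_sum_right)
  qed
  show "X * (c *\<^sub>C Y) = c *\<^sub>C (X * Y)"
  proof (rule op_eqI)
    fix i j
    let ?S = "{l. ent X i l \<noteq> 0}"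
    have "ent (X * W) i j = (\<Sum>l\<in>?S. ent X i l * ent W l j)" for W
      by (rule ent_times; auto simp: eqs finite_row)
    then show "ent (X * (c *\<^sub>C Y)) i j = ent (c *\<^sub>C (X * Y)) i j"
      by (simp add: eqs mult_scaleC_right scaleC.scale_sum_right)
  qed
qed

end

lemmas ent_simps = plus_op.rep_eq minus_op.rep_eq uminus_op.rep_eq zero_op.rep_eq one_op.rep_eq scaleC_op.rep_eq

lemma ent_sum: "ent (sum f S) i j = (\<Sum>x\<in>S. ent (f x) i j)"
  by (induction S rule: infinite_finite_induct) (simp_all add: ent_simps)

text \<open>
  The matrix unit in the factor \<open>p\<close>.
\<close>

lift_definition mu :: "nat \<Rightarrow> 'n \<Rightarrow> 'n \<Rightarrow> ('n, 'a::complex_algebra_1) op" is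
  "\<lambda>p a b i j. if i p = a \<and> j = i(p := b) then 1 else 0"
  by simp

lemma ent_mu_times: "ent (mu p a b * Y) i j = (if i p = a then ent Y (i(p := b)) j else 0)"
  by (subst ent_times[of "{i(p := b)}"]) (auto simp: mu.rep_eq)

lemma ent_times_mu: 
  fixes Y :: "('n, 'a::complex_algebra_1) op"
  shows "ent (Y * mu p a b) i j = (if j p = b then ent Y i (j(p := a)) else 0)"
proof -
  have *: "ent (mu p a b :: ('n, 'a) op) l j = (if l = j(p := a) \<and> j p = b then 1 else 0)" for l
  proof -
    have "l p = a \<and> j = l(p := b) \<longleftrightarrow> l = j(p := a) \<and> j p = b"
      by (metis fun_upd_same fun_upd_upd fun_upd_triv)
    then show ?thesis by (simp only: mu.rep_eq)
  qed
  show ?thesis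
    by (subst ent_times[of "{j(p := a)}"]) (auto simp: *)
qed

interpretation mu: matrix_units "mu :: nat \<Rightarrow> 'n::finite \<Rightarrow> 'n \<Rightarrow> ('n, 'a::complex_algebra_1) op"
proof
  fix p r :: nat and a b c d :: 'n
  show "mu p a b * mu p c d = (if b = c then mu p a d else (0 :: ('n, 'a) op))"
    by (rule op_eqI) (auto simp: ent_mu_times ent_simps mu.rep_eq)
  show "(\<Sum>a\<in>UNIV. mu p a a) = (1 :: ('n, 'a) op)"
  proof (rule op_eqI)
    fix i j :: "nat \<Rightarrow> 'n"
    have "ent (\<Sum>a\<in>UNIV. mu p a a :: ('n, 'a) op) i j = (\<Sum>a\<in>UNIV. if a = i p then if j = i then 1 else 0 else 0)"
      unfolding ent_sum mu.rep_eq by (intro sum.cong) auto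
    then show "ent (\<Sum>a\<in>UNIV. mu p a a) i j = ent (1 :: ('n, 'a) op) i j"
      by (simp add: ent_simps eq_commute)
  qed
  show "mu p a b * mu r c d = (mu r c d * mu p a b :: ('n, 'a) op)" if "p \<noteq> r"
    using that by (intro op_eqI) (auto simp: ent_mu_times mu.rep_eq fun_upd_twist)
qed

text \<open>
  A matrix with entries in the coefficient algebra, acting in the factor \<open>p\<close>.
\<close>

lift_definition aop :: "nat \<Rightarrow> 'a::complex_algebra_1^'n^'n \<Rightarrow> ('n::finite, 'a) op" is
  "\<lambda>p M i j. if \<forall>s. s \<noteq> p \<longrightarrow> i s = j s then M $ (i p) $ (j p) else 0"
proof -
  fix p and M :: "'a^'n^'n" and i :: "nat \<Rightarrow> 'n"
  have "{j. (if \<forall>s. s \<noteq> p \<longrightarrow> i s = j s then M $ i p $ j p else 0) \<noteq> 0} \<subseteq> range (\<lambda>b. i(p := b))"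
  proof
    fix j assume "j \<in> {j. (if \<forall>s. s \<noteq> p \<longrightarrow> i s = j s then M $ i p $ j p else 0) \<noteq> 0}"
    then have "\<forall>s. s \<noteq> p \<longrightarrow> i s = j s" by (simp split: if_splits)
    then have "j = i(p := j p)" by (simp add: fun_eq_iff)
    then show "j \<in> range (\<lambda>b. i(p := b))" by (rule range_eqI)
  qed
  then show "finite {j. (if \<forall>s. s \<noteq> p \<longrightarrow> i s = j s then M $ i p $ j p else 0) \<noteq> 0}"
    by (rule finite_subset) simp
qed

lemma eq_upd_iff: "j = i(p := b) \<longleftrightarrow> j p = b \<and> (\<forall>s. s \<noteq> p \<longrightarrow> i s = j s)"
  by (auto simp: fun_eq_iff)

lemma eq_upd2_iff: 
  "p \<noteq> r \<Longrightarrow> j = i(p := b, r := d) \<longleftrightarrow> j p = b \<and> j r = d \<and> (\<forall>s. s \<noteq> p \<and> s \<noteq> r \<longrightarrow> i s = j s)"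
  by (auto simp: fun_eq_iff)

lemma free_aop: 
  assumes "p \<noteq> r"
  shows "mu.free p (aop r M)"
  unfolding mu.free_def
proof (intro allI op_eqI)
  fix a b :: 'a and i j :: "nat \<Rightarrow> 'a"
  have "j p = b \<and> (\<forall>s. s \<noteq> r \<longrightarrow> i s = (j(p := a)) s) \<longleftrightarrow> i p = a \<and> (\<forall>s. s \<noteq> r \<longrightarrow> (i(p := b)) s = j s)"
    using assms by (metis fun_upd_apply)
  then show "ent (aop r M * mu p a b) i j = ent (mu p a b * aop r M) i j"
    using assms by (auto simp: ent_mu_times ent_times_mu aop.rep_eq)
qed

lemma ent_op1: "ent (mu.op1 p x :: ('n::finite, 'a::complex_algebra_1) op) i j 
  = (if \<forall>s. s \<noteq> p \<longrightarrow> i s = j s then x $ (i p) $ (j p) *\<^sub>C 1 else 0)"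
proof -
  let ?c = "\<forall>s. s \<noteq> p \<longrightarrow> i s = j s"
  have "ent (mu.op1 p x :: ('n, 'a) op) i j
    = (\<Sum>a\<in>UNIV. \<Sum>b\<in>UNIV. if b = j p then if a = i p then if ?c then x $ (i p) $ (j p) *\<^sub>C 1 else 0 else 0 else 0)"
    unfolding mu.op1_def ent_sum scaleC_op.rep_eq mu.rep_eq eq_upd_iff
    by (intro sum.cong refl) auto
  then show ?thesis by simp
qed

lemma ent_op2: 
  assumes "p \<noteq> r"
  shows "ent (mu.op2 p r X :: ('n::finite, 'a::complex_algebra_1) op) i j 
    = (if \<forall>s. s \<noteq> p \<and> s \<noteq> r \<longrightarrow> i s = j s then X $ (i p, i r) $ (j p, j r) *\<^sub>C 1 else 0)"
proof -
  let ?c = "\<forall>s. s \<noteq> p \<and> s \<noteq> r \<longrightarrow> i s = j s"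
  have "ent (mu.op2 p r X :: ('n, 'a) op) i j
    = (\<Sum>a\<in>UNIV. \<Sum>c\<in>UNIV. \<Sum>b\<in>UNIV. \<Sum>d\<in>UNIV. if d = j r then if b = i r then if c = j p then if a = i p then 
      if ?c then X $ (i p, i r) $ (j p, j r) *\<^sub>C 1 else 0 else 0 else 0 else 0 else 0)"
    unfolding mu.op2_def ent_sum scaleC_op.rep_eq ent_mu_times mu.rep_eq eq_upd2_iff[OF assms]
    using assms by (intro sum.cong refl) auto
  then show ?thesis by simp
qed

lemma ent_ptr: "ent (mu.ptr p X) i j = (if i p = j p then \<Sum>b\<in>UNIV. ent X (i(p := b)) (j(p := b)) else 0)"
proof -
  have "ent (mu.ptr p X) i j = (\<Sum>a\<in>UNIV. \<Sum>b\<in>UNIV. if a = i p then if i p = j p then ent X (i(p := b)) (j(p := b)) else 0 else 0)"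
    unfolding mu.ptr_def ent_sum mult.assoc ent_mu_times ent_times_mu
    by (intro sum.cong refl) auto
  also have "\<dots> = (\<Sum>a\<in>UNIV. if a = i p then (\<Sum>b\<in>UNIV. if i p = j p then ent X (i(p := b)) (j(p := b)) else 0) else 0)"
    by (intro sum.cong refl) simp
  finally show ?thesis by simp
qed

section \<open>Representing matrices acting in a tensor power\<close>

text \<open>
  Two basis vectors agree in all factors outside \<open>S\<close>.
\<close>

definition agree_off :: "nat set \<Rightarrow> (nat \<Rightarrow> 'n) \<Rightarrow> (nat \<Rightarrow> 'n) \<Rightarrow> bool" where
  "agree_off S i j \<longleftrightarrow> (\<forall>s. s \<notin> S \<longrightarrow> i s = j s)"

text \<open>
  \<open>Y\<close> is the matrix \<open>X\<close>, taken in the tensor power of exponent \<open>length ps\<close>, acting in the factors listed in \<open>ps\<close>.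
\<close>

definition rep :: "nat list \<Rightarrow> ('n::finite, 'a::complex_algebra_1) tens_mat \<Rightarrow> ('n, 'a) op \<Rightarrow> bool" where
  "rep ps X Y \<longleftrightarrow> (\<forall>i j. ent Y i j = (if agree_off (set ps) i j then X (map i ps) (map j ps) else 0))"

lemma repD: "rep ps X Y \<Longrightarrow> ent Y i j = (if agree_off (set ps) i j then X (map i ps) (map j ps) else 0)"
  by (simp add: rep_def)

lemma rep_unique: 
  assumes "rep ps X Y" "rep ps X' Y'" "eq_in_power (length ps) X X'"
  shows "Y = Y'"
proof (rule op_eqI)
  fix i j
  have "X (map i ps) (map j ps) = X' (map i ps) (map j ps)"
    using assms(3) by (simp add: eq_in_power_def)
  then show "ent Y i j = ent Y' i j"
    by (simp only: repD[OF assms(1)] repD[OF assms(2)])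
qed

lemma rep_diff: "rep ps X Y \<Longrightarrow> rep ps X' Y' \<Longrightarrow> rep ps (\<lambda>i j. X i j - X' i j) (Y - Y')"
  and rep_scaleC: "rep ps X Y \<Longrightarrow> rep ps (\<lambda>i j. c *\<^sub>C X i j) (c *\<^sub>C Y)"
  by (simp_all add: rep_def ent_simps)

lemma rep_id: "rep ps tens_id 1"
  unfolding rep_def tens_id_def agree_off_def by (auto simp: ent_simps fun_eq_iff map_eq_conv)

lemma bij_betw_map:
  fixes i :: "nat \<Rightarrow> 'n"
  assumes "distinct ps"
  shows "bij_betw (\<lambda>l. map l ps) {l. agree_off (set ps) i l} {L. length L = length ps}"
  unfolding bij_betw_def
proof (intro conjI equalityI subsetI)
  show "inj_on (\<lambda>l. map l ps) {l. agree_off (set ps) i l}"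
  proof (rule inj_onI, rule ext)
    fix l l' s
    assume "l \<in> {l. agree_off (set ps) i l}" "l' \<in> {l. agree_off (set ps) i l}" "map l ps = map l' ps"
    then show "l s = l' s"
      by (cases "s \<in> set ps") (auto simp: agree_off_def)
  qed
next
  fix L :: "'n list" assume "L \<in> {L. length L = length ps}"
  then have L: "length L = length ps" by simp
  define l where "l s = (case map_of (zip ps L) s of None \<Rightarrow> i s | Some x \<Rightarrow> x)" for s
  have "map l ps = L"
    using L assms by (intro nth_equalityI) (auto simp: l_def map_of_zip_nth)
  moreover have "i s = l s" if "s \<notin> set ps" for s
  proof -
    have "map_of (zip ps L) s = None" using that L by (simp add: map_of_zip_is_None)
    then show ?thesis by (simp add: l_def)
  qed
  ultimately show "L \<in> (\<lambda>l. map l ps) ` {l. agree_off (set ps) i l}"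
    unfolding agree_off_def by blast
qed auto

lemma finite_lists: "finite {L :: 'n::finite list. length L = m}"
  using finite_lists_length_eq[of "UNIV :: 'n set" m] by simp

lemma rep_mult:
  assumes ps: "distinct ps" and "rep ps X Y" "rep ps X' Y'"
  shows "rep ps (X \<star> X') (Y * Y')"
  unfolding rep_def
proof (intro allI)
  fix i j :: "nat \<Rightarrow> 'a"
  let ?S = "{l. agree_off (set ps) i l}"
  have fin: "finite ?S"
    using bij_betw_finite[OF bij_betw_map[OF ps, of i]] by (simp add: finite_lists)
  have "ent (Y * Y') i j = (\<Sum>l\<in>?S. ent Y i l * ent Y' l j)"
    by (rule ent_times[OF fin]) (simp add: repD[OF assms(2)])
  also have "\<dots> = (\<Sum>l\<in>?S. if agree_off (set ps) i j then X (map i ps) (map l ps) * X' (map l ps) (map j ps) else 0)"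
  proof (intro sum.cong refl)
    fix l assume "l \<in> ?S"
    then have "agree_off (set ps) i l" "agree_off (set ps) l j \<longleftrightarrow> agree_off (set ps) i j"
      by (auto simp: agree_off_def)
    then show "ent Y i l * ent Y' l j
        = (if agree_off (set ps) i j then X (map i ps) (map l ps) * X' (map l ps) (map j ps) else 0)"
      by (simp add: repD[OF assms(2)] repD[OF assms(3)])
  qed
  also have "\<dots> = (if agree_off (set ps) i j then
      (\<Sum>l\<in>?S. X (map i ps) (map l ps) * X' (map l ps) (map j ps)) else 0)"
    by (simp del: sum.If_cases)
  also have "(\<Sum>l\<in>?S. X (map i ps) (map l ps) * X' (map l ps) (map j ps)) = (X \<star> X') (map i ps) (map j ps)"
    unfolding tens_mult_def length_map
    by (rule sum.reindex_bij_betw[OF bij_betw_map[OF ps], where g = "\<lambda>L. X (map i ps) L * X' L (map j ps)"])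
  finally show "ent (Y * Y') i j = (if agree_off (set ps) i j then (X \<star> X') (map i ps) (map j ps) else 0)" .
qed

lemma rep_aop:
  assumes ps: "distinct ps" and k: "k < length ps"
  shows "rep ps (at1 (Suc k) M) (aop (ps ! k) M)"
  unfolding rep_def
proof (intro allI)
  fix i j :: "nat \<Rightarrow> 'a"
  have "(\<forall>s. s \<noteq> ps ! k \<longrightarrow> i s = j s) \<longleftrightarrow>
      (agree_off (set ps) i j) \<and> (\<forall>r<length ps. r \<noteq> k \<longrightarrow> i (ps ! r) = j (ps ! r))"
    (is "?l \<longleftrightarrow> ?r")
  proof
    assume ?l
    moreover have "s \<noteq> ps ! k" if "s \<notin> set ps" for s
      using that k by (auto intro: nth_mem)
    ultimately show ?r using ps k by (simp add: nth_eq_iff_index_eq agree_off_def)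
  next
    assume r: ?r
    show ?l
    proof (intro allI impI)
      fix s assume s: "s \<noteq> ps ! k"
      show "i s = j s"
      proof (cases "s \<in> set ps")
        case True
        then obtain t where "t < length ps" "s = ps ! t" by (auto simp: in_set_conv_nth)
        then show ?thesis using r s by metis
      qed (use r in \<open>simp add: agree_off_def\<close>)
    qed
  qed
  then show "ent (aop (ps ! k) M) i j = (if agree_off (set ps) i j then at1 (Suc k) M (map i ps) (map j ps) else 0)"
    using k by (auto simp: aop.rep_eq at1_def)
qed

lemma rep_op1:
  assumes "distinct ps" and "k < length ps"
  shows "rep ps (alg_mat (at1 (Suc k) x)) (mu.op1 (ps ! k) x)"
proof -
  have "alg_mat (at1 (Suc k) x) = (at1 (Suc k) (\<chi> a b. x $ a $ b *\<^sub>C (1::'b)))"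
    by (auto simp: alg_mat_def at1_def fun_eq_iff)
  moreover have "mu.op1 (ps ! k) x = aop (ps ! k) (\<chi> a b. x $ a $ b *\<^sub>C (1::'b))"
    by (rule op_eqI) (simp only: ent_op1 aop.rep_eq vec_lambda_beta)
  ultimately show ?thesis using rep_aop[OF assms] by simp
qed

lemma rep_op2:
  assumes ps: "distinct ps" and k: "Suc k < length ps"
  shows "rep ps (alg_mat (at2 (Suc k) X)) (mu.op2 (ps ! k) (ps ! Suc k) X)"
  unfolding rep_def
proof (intro allI)
  fix i j :: "nat \<Rightarrow> 'a"
  have ne: "ps ! k \<noteq> ps ! Suc k" using ps k by (simp add: nth_eq_iff_index_eq)
  have "(\<forall>s. s \<noteq> ps ! k \<and> s \<noteq> ps ! Suc k \<longrightarrow> i s = j s) \<longleftrightarrow>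
      (agree_off (set ps) i j) \<and> (\<forall>r<length ps. r \<noteq> k \<and> r \<noteq> Suc k \<longrightarrow> i (ps ! r) = j (ps ! r))"
    (is "?l \<longleftrightarrow> ?r")
  proof
    assume ?l
    moreover have "s \<noteq> ps ! k \<and> s \<noteq> ps ! Suc k" if "s \<notin> set ps" for s
      using that k by (auto intro: nth_mem)
    ultimately show ?r using ps k by (simp add: nth_eq_iff_index_eq agree_off_def)
  next
    assume r: ?r
    show ?l
    proof (intro allI impI)
      fix s assume s: "s \<noteq> ps ! k \<and> s \<noteq> ps ! Suc k"
      show "i s = j s"
      proof (cases "s \<in> set ps")
        case True
        then obtain t where "t < length ps" "s = ps ! t" by (auto simp: in_set_conv_nth)
        then show ?thesis using r s by metis
      qed (use r in \<open>simp add: agree_off_def\<close>)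
    qed
  qed
  then show "ent (mu.op2 (ps ! k) (ps ! Suc k) X :: ('a, 'b) op) i j =
      (if agree_off (set ps) i j then alg_mat (at2 (Suc k) X) (map i ps) (map j ps) else 0)"
    using k by (auto simp: ent_op2[OF ne] alg_mat_def at2_def)
qed

lemma alg_mat_mult: "alg_mat (X \<star> Y) = alg_mat X \<star> alg_mat Y"
  by (simp add: alg_mat_def tens_mult_def fun_eq_iff scaleC.scale_sum_left mult_scaleC_left
      mult_scaleC_right scaleC_scaleC mult.commute)

lemma alg_mat_id: "alg_mat tens_id = tens_id"
  by (auto simp: alg_mat_def tens_id_def fun_eq_iff scaleC_one)

lemma alg_mat_scale: "alg_mat (\<lambda>i j. c * X i j) = (\<lambda>i j. c *\<^sub>C alg_mat X i j)"
  by (simp add: alg_mat_def scaleC_scaleC)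

lemma alg_mat_diff: "alg_mat (\<lambda>i j. X i j - Y i j) = (\<lambda>i j. alg_mat X i j - alg_mat Y i j)"
  by (simp add: alg_mat_def scaleC.scale_left_diff_distrib)

lemma op2_braid:
  assumes "eq_in_power 3 (at2 1 X \<star> at2 2 Y \<star> at2 1 Z) (at2 2 X' \<star> at2 1 Y' \<star> at2 2 Z')" 
    and "distinct [p, r, s]"
  shows "mu.op2 p r X * mu.op2 r s Y * mu.op2 p r Z
    = (mu.op2 r s X' * mu.op2 p r Y' * mu.op2 r s Z' :: ('n::finite, 'a::complex_algebra_1) op)"
proof (rule rep_unique)
  have at: "rep [p, r, s] (alg_mat (at2 1 W)) (mu.op2 p r W :: ('n, 'a) op)" 
      "rep [p, r, s] (alg_mat (at2 2 W)) (mu.op2 r s W :: ('n, 'a) op)" for W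
    using rep_op2[OF assms(2), of 0 W] rep_op2[OF assms(2), of 1 W] by (simp_all add: numeral_2_eq_2)
  show "rep [p, r, s] (alg_mat (at2 1 X \<star> at2 2 Y \<star> at2 1 Z)) (mu.op2 p r X * mu.op2 r s Y * mu.op2 p r Z :: ('n, 'a) op)"
    "rep [p, r, s] (alg_mat (at2 2 X' \<star> at2 1 Y' \<star> at2 2 Z')) (mu.op2 r s X' * mu.op2 p r Y' * mu.op2 r s Z' :: ('n, 'a) op)"
    unfolding alg_mat_mult by (intro rep_mult assms(2) at)+
  show "eq_in_power (length [p, r, s]) (alg_mat (at2 1 X \<star> at2 2 Y \<star> at2 1 Z) :: ('n, 'a) tens_mat) (alg_mat (at2 2 X' \<star> at2 1 Y' \<star> at2 2 Z'))"
    using assms(1) by (simp add: eq_in_power_def alg_mat_def)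
qed

lemma rep_ptr:
  assumes "rep [0..<Suc m] X Y"
  shows "rep [0..<m] (\<lambda>i i'. \<Sum>a\<in>UNIV. X (i @ [a]) (i' @ [a])) (mu.ptr m Y)"
  unfolding rep_def
proof (intro allI)
  fix i j :: "nat \<Rightarrow> 'a"
  have map: "map (i(m := b)) [0..<Suc m] = map i [0..<m] @ [b]" for i :: "nat \<Rightarrow> 'a" and b by simp
  have "(agree_off (set [0..<m]) i j) \<longleftrightarrow> i m = j m \<and> (agree_off (set [0..<Suc m]) i j)"
    unfolding agree_off_def by (auto simp: less_Suc_eq)
  moreover have "(agree_off (set [0..<Suc m]) (i(m := b)) (j(m := b))) \<longleftrightarrow> (agree_off (set [0..<Suc m]) i j)" for b
    unfolding agree_off_def by auto
  ultimately show "ent (mu.ptr m Y) i j = (if agree_off (set [0..<m]) i j then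
      \<Sum>a\<in>UNIV. X (map i [0..<m] @ [a]) (map j [0..<m] @ [a]) else 0)"
    unfolding ent_ptr repD[OF assms] map by auto
qed

lemma sum_lists_Suc:
  "(\<Sum>l | length l = Suc n. f l) = (\<Sum>l | length (l :: 'n::finite list) = n. \<Sum>a\<in>UNIV. f (l @ [a]))"
proof -
  have "(\<Sum>l | length l = n. \<Sum>a\<in>UNIV. f (l @ [a])) = (\<Sum>(l, a)\<in>{l. length l = n} \<times> UNIV. f (l @ [a]))"
    by (rule sum.cartesian_product)
  also have "\<dots> = (\<Sum>l | length l = Suc n. f l)"
  proof (rule sum.reindex_bij_witness[of _ "\<lambda>l. (butlast l, last l)" "\<lambda>(l, a). l @ [a]"])
    fix l :: "'n list" assume "l \<in> {l. length l = Suc n}"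
    then show "(case (butlast l, last l) of (l, a) \<Rightarrow> l @ [a]) = l" by (cases l rule: rev_cases) auto
  qed auto
  finally show ?thesis ..
qed

context quantum_matrix
begin

text \<open>
  \<open>PT j n\<close> is the ordinary partial trace over the factors \<open>j, \<dots>, j + n - 1\<close>.
\<close>

primrec PT :: "nat \<Rightarrow> nat \<Rightarrow> 'b \<Rightarrow> 'b" where
  "PT j 0 X = X"
| "PT j (Suc n) X = PT j n (ptr (j + n) X)"

lemma QT_PT: "QT j n X = PT j n (foldr (\<lambda>p Y. op1 p D * Y) [j..<j + n] 1 * X)"
proof (induction n arbitrary: X)
  case (Suc n)
  let ?P = "\<lambda>xs. foldr (\<lambda>p Y. op1 p D * Y) xs 1"
  have snoc: "?P (xs @ [x]) = ?P xs * op1 x D" for xs x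
    by (induction xs) (simp_all add: mult.assoc)
  have fr: "free t (?P xs)" if "t \<notin> set xs" for t xs
    using that by (induction xs) (auto intro!: free_mult free_op1)
  have "?P [j..<j + Suc n] * X = ?P [j..<j + n] * (op1 (j + n) D * X)"
    by (simp only: upt_Suc_append le_add1 add_Suc_right snoc mult.assoc)
  then have "ptr (j + n) (?P [j..<j + Suc n] * X) = ?P [j..<j + n] * qt (j + n) X"
    by (simp only: qt_def) (rule ptr_mult_left, rule fr, simp)
  then show ?case by (simp only: QT.simps PT.simps Suc.IH)
qed simp

end

text \<open>
  The substitution of \<open>-1/q\<close> for \<open>q\<close> exchanges symmetrizers and antisymmetrizers.
\<close>

lemma symm_eq_antisym: "symm q R k = antisym (- inverse q) R k"
proof (induction q R k rule: symm.induct)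
  case (3 q R k)
  have scale: "X \<star> (\<lambda>i j. c * Y i j) \<star> Z = (\<lambda>i j. c * (X \<star> Y \<star> Z) i j)" for X Y Z :: "('a, complex) tens_mat" and c
    by (simp add: tens_mult_def fun_eq_iff sum_distrib_left sum_distrib_right ac_simps)
  have "(\<lambda>i' j'. (- inverse q) ^ (k + 1) * tens_id i' j' - qnum (- inverse q) (k + 1) * at2 (k + 1) R i' j')
     = (\<lambda>i' j'. (-1) ^ (k + 1) * (inverse q ^ (k + 1) * tens_id i' j' + qnum q (k + 1) * at2 (k + 1) R i' j'))"
    by (simp add: fun_eq_iff qnum_uminus_inverse power_minus[of "inverse q"] algebra_simps)
  moreover have "1 / qnum (- inverse q) (k + 2) * ((-1) ^ (k + 1) * x) = 1 / qnum q (k + 2) * x" for x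
    by (simp add: qnum_uminus_inverse)
  ultimately show ?case
    by (simp only: antisym.simps symm.simps 3 scale)
qed auto

section \<open>The identities in the algebra M(R,F)\<close>

lemma rep_at2: "Suc p < m \<Longrightarrow> rep [0..<m] (alg_mat (at2 (Suc p) X)) (mu.op2 p (Suc p) X)"
  using rep_op2[of "[0..<m]" p X] by simp

lemma rep_antisym:
  "k \<le> m \<Longrightarrow> rep [0..<m] (alg_mat (antisym q R k)) (antisym_of q (\<lambda>p. mu.op2 p (Suc p) R) k)"
proof (induction q R k rule: antisym.induct)
  case (3 q R k)
  have "rep [0..<m] (alg_mat (at2 (k + 1) R)) (mu.op2 k (Suc k) R)"
    using rep_at2[of k m R] 3 by simp
  then have "rep [0..<m] (alg_mat (\<lambda>i' j'. q ^ (k + 1) * tens_id i' j' - qnum q (k + 1) * at2 (k + 1) R i' j'))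
    (q ^ (k + 1) *\<^sub>C 1 - qnum q (k + 1) *\<^sub>C mu.op2 k (Suc k) R)"
    unfolding alg_mat_diff alg_mat_scale alg_mat_id by (intro rep_diff rep_scaleC rep_id)
  then show ?case
    unfolding antisym.simps antisym_of.simps alg_mat_scale alg_mat_mult
    using 3 by (intro rep_scaleC rep_mult distinct_upt) auto
qed (simp_all add: alg_mat_id rep_id)

text \<open>
  The matrix \<open>N\<close> over the coefficient algebra acting in the factor 0.  Here the elements of the abstract
  calculation are identified with the matrices in tensor powers indexed by lists.
\<close>

locale quantum_matrix_rep = quantum_matrix mu R F \<Psi> "qtr_D F" q "aop 0 N" J
  for R F \<Psi> :: "'n::finite mat2" and q and N :: "'a::complex_algebra_1^'n^'n" and J
begin

lemma rep_A: "k \<le> m \<Longrightarrow> rep [0..<m] (alg_mat (antisym q R k)) (A 0 k)"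
  using rep_antisym[of k m q R] by (simp add: A_def)

lemma rep_chain: "k < m \<Longrightarrow> rep [0..<m] (alg_mat (Rchain R k)) (chain k)"
proof (induction k)
  case (Suc k)
  then show ?case
    unfolding Rchain.simps chain.simps alg_mat_mult by (intro rep_mult rep_at2 distinct_upt) auto
qed (simp add: alg_mat_id rep_id)

lemma rep_Mbar: "p < m \<Longrightarrow> rep [0..<m] (Mbar F N (Suc p)) (Mb p)"
proof (induction p)
  case 0
  then show ?case using rep_aop[of "[0..<m]" 0 N] by simp
next
  case (Suc p)
  then show ?case
    unfolding Mbar.simps Mb.simps Suc_eq_plus1[symmetric] by (intro rep_mult rep_at2 distinct_upt) auto
qed

lemma rep_Mprod: "k \<le> m \<Longrightarrow> rep [0..<m] (Mprod F N k) (Mp 0 k)"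
proof (induction k)
  case (Suc k)
  then show ?case
    unfolding Mprod.simps Mp.simps add_0 by (intro rep_mult rep_Mbar distinct_upt) auto
qed (simp add: rep_id)

lemma rep_D_prod:
  assumes "k \<le> m"
  shows "rep [0..<m] (alg_mat (D_prod F j k)) (foldr (\<lambda>p Y. op1 p (qtr_D F) * Y) [j..<k] 1)"
proof -
  have *: "rep [0..<m] (alg_mat (foldr (\<lambda>p Y. at1 p (qtr_D F) \<star> Y) (map Suc xs) tens_id))
      (foldr (\<lambda>p Y. op1 p (qtr_D F) * Y) xs 1)" if "set xs \<subseteq> {..<m}" for xs
    using that
  proof (induction xs)
    case (Cons x xs)
    have "rep [0..<m] (alg_mat (at1 (Suc x) (qtr_D F))) (op1 x (qtr_D F))"
      using rep_op1[of "[0..<m]" x "qtr_D F"] Cons.prems by simp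
    then show ?case
      using Cons by (simp add: alg_mat_mult rep_mult)
  qed (simp add: alg_mat_id rep_id)
  have "set [j..<k] \<subseteq> {..<m}" using assms by auto
  from *[OF this] show ?thesis by (simp only: D_prod_def map_Suc_upt Suc_eq_plus1[symmetric])
qed

lemma rep_PT: "rep [0..<j + n] X Y \<Longrightarrow>
  rep [0..<j] (\<lambda>i i'. \<Sum>l | length l = n. X (i @ l) (i' @ l)) (PT j n Y)"
proof (induction n arbitrary: X Y)
  case 0
  then show ?case by simp
next
  case (Suc n)
  have "rep [0..<j + n] (\<lambda>i i'. \<Sum>a\<in>UNIV. X (i @ [a]) (i' @ [a])) (ptr (j + n) Y)"
    using Suc.prems by (intro rep_ptr) simp
  from Suc.IH[OF this] show ?case
    by (simp add: sum_lists_Suc)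
qed

lemma rep_qtr:
  assumes "rep [0..<j + n] X Y"
  shows "rep [0..<j] (qtr F j (j + n) X) (QT j n Y)"
  using rep_PT[OF rep_mult[OF distinct_upt rep_D_prod[OF order.refl] assms], of j]
  by (simp add: qtr_def QT_PT)

lemma ent_sg: "ent (sg i) x y = (if x = y then sigma_fun q R F N i else 0)"
proof (cases "i = 0")
  case True
  then show ?thesis by (simp add: sg_def sigma_fun_def ent_simps)
next
  case False
  have "rep [0..<0 + i] (alg_mat (antisym q R i) \<star> Mprod F N i) (A 0 i * Mp 0 i)"
    by (intro rep_mult distinct_upt rep_A rep_Mprod) auto
  from repD[OF rep_qtr[OF this]] show ?thesis
    using False by (simp add: sg_def sigma_fun_def agree_off_def fun_eq_iff)
qed

lemma ent_QT_1:
  assumes "rep [0..<Suc k] X Y"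
  shows "ent (QT 1 k Y) (\<lambda>_. a) ((\<lambda>_. a)(0 := b)) = qtr F 1 (Suc k) X [a] [b]"
proof -
  have "rep [0..<1] (qtr F 1 (1 + k) X) (QT 1 k Y)"
    using assms by (intro rep_qtr) simp
  from repD[OF this] show ?thesis by (simp add: agree_off_def)
qed

lemma ent_pw: "ent (pw k) (\<lambda>_. a) ((\<lambda>_. a)(0 := b)) = mat_power R F N (Suc k) $ a $ b"
proof -
  have "rep [0..<Suc k] (alg_mat (Rchain R k) \<star> Mprod F N (Suc k)) (chain k * Mp 0 (Suc k))"
    by (intro rep_mult distinct_upt rep_chain rep_Mprod) auto
  from ent_QT_1[OF this] show ?thesis
    by (simp add: pw_def mat_power_def del: Mp.simps Mprod.simps)
qed

lemma ent_wedge: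
  "ent (QT 1 k (A 0 (Suc k) * Mp 0 (Suc k))) (\<lambda>_. a) ((\<lambda>_. a)(0 := b)) = wedge_power q R F N (Suc k) $ a $ b"
proof -
  have "rep [0..<Suc k] (alg_mat (antisym q R (Suc k)) \<star> Mprod F N (Suc k)) (A 0 (Suc k) * Mp 0 (Suc k))"
    by (intro rep_mult distinct_upt rep_A rep_Mprod) auto
  from ent_QT_1[OF this] show ?thesis
    by (simp add: wedge_power_def del: Mp.simps Mprod.simps)
qed

lemma ent_mult_sg: "ent (Y * sg i) x y = ent Y x y * sigma_fun q R F N i"
  by (subst ent_times[of "{y}"]) (auto simp: ent_sg)

end

lemma QM_ideal_closed:
  fixes R F :: "'n::finite mat2"
  shows "0 \<in> QM_ideal R F"
    and "x \<in> QM_ideal R F \<Longrightarrow> y \<in> QM_ideal R F \<Longrightarrow> x + y \<in> QM_ideal R F"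
    and "x \<in> QM_ideal R F \<Longrightarrow> z * x \<in> QM_ideal R F"
    and "x \<in> QM_ideal R F \<Longrightarrow> x * z \<in> QM_ideal R F"
proof -
  interpret ideal "QM_ideal R F" free_ring by (rule ideal_QM_ideal)
  show "0 \<in> QM_ideal R F"
    and "x \<in> QM_ideal R F \<Longrightarrow> y \<in> QM_ideal R F \<Longrightarrow> x + y \<in> QM_ideal R F"
    and "x \<in> QM_ideal R F \<Longrightarrow> z * x \<in> QM_ideal R F"
    and "x \<in> QM_ideal R F \<Longrightarrow> x * z \<in> QM_ideal R F"
    using additive_subgroup.zero_closed[OF is_additive_subgroup]
      additive_subgroup.a_closed[OF is_additive_subgroup, of x y] I_l_closed[of x z] I_r_closed[of x z] by (simp_all add: free_ring_def)
qed

lemma QM_ideal_sum: "(\<And>x. x \<in> S \<Longrightarrow> f x \<in> QM_ideal R F) \<Longrightarrow> sum f S \<in> QM_ideal R F"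
  by (induction S rule: infinite_finite_induct) (auto intro: QM_ideal_closed)

lemma QM_relators_ideal: "QM_relators R F \<subseteq> QM_ideal R F"
  unfolding QM_ideal_def by (rule ring.genideal_self[OF ring_free_ring]) (simp add: free_ring_def)

text \<open>
  Row-finite matrices with all entries in the ideal of relations.
\<close>

definition ideal_ops :: "'n::finite mat2 \<Rightarrow> 'n mat2 \<Rightarrow> ('n, ('n \<times> 'n) free_alg) op set" where
  "ideal_ops R F = {X. \<forall>i j. ent X i j \<in> QM_ideal R F}"

lemma quantum_matrix_rep_QM:
  fixes R F :: "'n::finite mat2"
  assumes "compatible_pair R F" and "Hecke q R" and "\<forall>m\<ge>1. qnum q m \<noteq> 0" and "closed_R F"
  shows "quantum_matrix_rep R F (SOME \<Psi>. skew_inverse F \<Psi>) q gen_mat (ideal_ops R F)"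
proof unfold_locales
  show "invertible F" using assms(4) by (simp add: closed_R_def)
  show "skew_inverse F (SOME \<Psi>. skew_inverse F \<Psi>)"
    using assms(4) unfolding closed_R_def by (auto intro: someI_ex)
  show "qtr_D F = (\<chi> a b. \<Sum>c\<in>UNIV. (SOME \<Psi>. skew_inverse F \<Psi>) $ (a, c) $ (b, c))"
    by (simp add: qtr_D_def Let_def)
  show "Hecke q R" by fact
  show "qnum q m \<noteq> 0" if "m \<ge> 1" for m using assms(3) that by simp
  note C = assms(1)[unfolded compatible_pair_def R_matrix_def]
  fix p r s :: nat assume "distinct [p, r, s]"
  then show "mu.op2 p r F * mu.op2 r s F * mu.op2 p r F = (mu.op2 r s F * mu.op2 p r F * mu.op2 r s F :: ('n, ('n \<times> 'n) free_alg) op)"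
    and "mu.op2 p r R * mu.op2 r s F * mu.op2 p r F = (mu.op2 r s F * mu.op2 p r F * mu.op2 r s R :: ('n, ('n \<times> 'n) free_alg) op)"
    and "mu.op2 p r F * mu.op2 r s F * mu.op2 p r R = (mu.op2 r s R * mu.op2 p r F * mu.op2 r s F :: ('n, ('n \<times> 'n) free_alg) op)"
    and "mu.op2 p r R * mu.op2 r s R * mu.op2 p r R = (mu.op2 r s R * mu.op2 p r R * mu.op2 r s R :: ('n, ('n \<times> 'n) free_alg) op)"
    using C by (intro op2_braid; simp)+
next
  show "mu.free p (aop 0 gen_mat)" if "p \<ge> 1" for p using that by (intro free_aop) simp
  show "0 \<in> ideal_ops R F" by (simp add: ideal_ops_def ent_simps QM_ideal_closed)
  show "X + Y \<in> ideal_ops R F" if "X \<in> ideal_ops R F" "Y \<in> ideal_ops R F" for X Y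
    using that by (simp add: ideal_ops_def ent_simps QM_ideal_closed)
  show "Y * X \<in> ideal_ops R F" if "X \<in> ideal_ops R F" for X Y
    using that by (simp add: ideal_ops_def times_op.rep_eq QM_ideal_closed QM_ideal_sum)
  show "X * Y \<in> ideal_ops R F" if "X \<in> ideal_ops R F" for X Y
    using that by (simp add: ideal_ops_def times_op.rep_eq QM_ideal_closed QM_ideal_sum)
  let ?M = "aop 0 gen_mat :: ('n, ('n \<times> 'n) free_alg) op"
  let ?L = "alg_mat (at2 1 R) \<star> Mbar F gen_mat 1 \<star> Mbar F gen_mat 2"
  let ?R = "Mbar F gen_mat 1 \<star> Mbar F gen_mat 2 \<star> alg_mat (at2 1 (twist F (twist F R)))"
  let ?rel = "mu.op2 0 1 R * ?M * (mu.op2 0 1 F * ?M * mu.op2 0 1 (matrix_inv F))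
      - ?M * (mu.op2 0 1 F * ?M * mu.op2 0 1 (matrix_inv F)) * mu.op2 0 1 (twist F (twist F R))"
  have at: "rep [0..<2] (alg_mat (at2 1 X)) (mu.op2 0 1 X :: ('n, ('n \<times> 'n) free_alg) op)" for X
    using rep_at2[of 0 2 X] by simp
  have M1: "rep [0..<2] (Mbar F gen_mat 1) ?M"
    using rep_aop[of "[0..<2]" 0 gen_mat] by simp
  have M2: "rep [0..<2] (Mbar F gen_mat 2) (mu.op2 0 1 F * ?M * mu.op2 0 1 (matrix_inv F))"
    using rep_mult[OF distinct_upt rep_mult[OF distinct_upt at[of F] M1] at[of "matrix_inv F"]]
    by (simp add: numeral_2_eq_2)
  have "rep [0..<2] (\<lambda>i j. ?L i j - ?R i j) ?rel"
    by (intro rep_diff rep_mult distinct_upt at M1 M2)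
  moreover have "?L i j - ?R i j \<in> QM_ideal R F" if "length i = 2" "length j = 2" for i j
    using QM_relators_ideal[of R F] that unfolding QM_relators_def by blast
  ultimately have "ent ?rel i j \<in> QM_ideal R F" for i j
    by (subst repD) (auto simp: QM_ideal_closed)
  then show "?rel \<in> ideal_ops R F" by (simp add: ideal_ops_def)
qed

lemma Newton_wedge:
  fixes R F :: "'n::finite mat2"
  assumes "compatible_pair R F" and "Hecke q R" and "\<forall>m\<ge>1. qnum q m \<noteq> 0" and "closed_R F" and "k \<ge> 1"
  shows "QM_proj R F (((-1)^(k - 1) * qnum q k) *\<^sub>C (wedge_power q R F gen_mat k $ a $ b))
           = QM_proj R F (\<Sum>i=0..k-1. (-q)^i *\<^sub>C
               (mat_power R F gen_mat (k - i) $ a $ b * sigma_fun q R F gen_mat i))"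
proof -
  interpret quantum_matrix_rep R F "SOME \<Psi>. skew_inverse F \<Psi>" q gen_mat "ideal_ops R F"
    by (rule quantum_matrix_rep_QM) fact+
  obtain l where k: "k = Suc l" using assms(5) by (cases k) auto
  \<comment> \<open>The entries of the matrix identity in the factor 0 are read off at sequences that agree from
      position 1 on; the value \<open>a\<close> there is arbitrary.\<close>
  let ?x = "\<lambda>_::nat. a" and ?y = "(\<lambda>_::nat. a)(0 := b)"
  have "ent (((-1) ^ l * qnum q (Suc l)) *\<^sub>C QT 1 l (A 0 (Suc l) * Mp 0 (Suc l))
      - (\<Sum>t\<le>l. (- q) ^ t *\<^sub>C (pw (l - t) * sg t))) ?x ?y \<in> QM_ideal R F"
    using Newton_relation[of l] unfolding eqJ_def by (simp only: ideal_ops_def mem_Collect_eq)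
  then have "((-1) ^ l * qnum q (Suc l)) *\<^sub>C (wedge_power q R F gen_mat (Suc l) $ a $ b)
      - (\<Sum>t\<le>l. (- q) ^ t *\<^sub>C (mat_power R F gen_mat (Suc (l - t)) $ a $ b * sigma_fun q R F gen_mat t)) \<in> QM_ideal R F"
    unfolding ent_sum minus_op.rep_eq scaleC_op.rep_eq ent_mult_sg ent_pw ent_wedge .
  then show ?thesis
    unfolding QM_proj_eq_iff k by (simp add: Suc_diff_le atLeast0AtMost)
qed

theorem mainTheorem1:
  fixes R F :: "'n::finite mat2" and q :: complex and n k :: nat
  assumes "compatible_pair R F"
    and "Hecke q R"
    and "\<forall>m\<ge>1. qnum q m \<noteq> 0"
    and "even_height q R n"
    and "closed_R F"
    and "k \<ge> 1"
  shows "(\<forall>a b. QM_proj R F (((-1)^(k - 1) * qnum q k) *\<^sub>C (wedge_power q R F gen_mat k $ a $ b))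
           = QM_proj R F (\<Sum>i=0..k-1. (-q)^i *\<^sub>C
               (mat_power R F gen_mat (k - i) $ a $ b * sigma_fun q R F gen_mat i)))
    \<and> (\<forall>a b. QM_proj R F (qnum q k *\<^sub>C (sym_power q R F gen_mat k $ a $ b))
           = QM_proj R F (\<Sum>i=0..k-1. inverse q ^ i *\<^sub>C
               (mat_power R F gen_mat (k - i) $ a $ b * tau_fun q R F gen_mat i)))"
proof (intro conjI allI)
  fix a b
  show "QM_proj R F (((-1)^(k - 1) * qnum q k) *\<^sub>C (wedge_power q R F gen_mat k $ a $ b))
           = QM_proj R F (\<Sum>i=0..k-1. (-q)^i *\<^sub>C
               (mat_power R F gen_mat (k - i) $ a $ b * sigma_fun q R F gen_mat i))"
    by (rule Newton_wedge) fact+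
  let ?q = "- inverse q"
  have "Hecke ?q R"
    using assms(2) by (simp add: Hecke_def add.commute)
  moreover have "\<forall>m\<ge>1. qnum ?q m \<noteq> 0"
    using assms(3) by (simp add: qnum_uminus_inverse)
  moreover have "(-1) ^ (k - 1) * qnum ?q k = qnum q k"
    unfolding qnum_uminus_inverse by (simp flip: mult.assoc power_mult_distrib)
  moreover have "wedge_power ?q R F N k = sym_power q R F N k" "sigma_fun ?q R F N i = tau_fun q R F N i"
    for i and N :: "('n \<times> 'n) free_alg^'n^'n"
    by (simp_all add: wedge_power_def sym_power_def sigma_fun_def tau_fun_def symm_eq_antisym)
  ultimately show "QM_proj R F (qnum q k *\<^sub>C (sym_power q R F gen_mat k $ a $ b))
           = QM_proj R F (\<Sum>i=0..k-1. inverse q ^ i *\<^sub>C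
               (mat_power R F gen_mat (k - i) $ a $ b * tau_fun q R F gen_mat i))"
    using Newton_wedge[of R F ?q k a b] assms by simp
qed

end
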